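(* Consider a smooth pure exchange economy with $m$ consumers and $l$ goods, equilibrium manifold $E\subset S\times\Omega$, natural projection $\pi\colon E\to\Omega$ and set of crisis transitions $\mathcal B\subset E$ (all as defined in the context). Let $e=(p,\omega)\in E$ be an equilibrium such that (i) $\dim \operatorname{Ker} D\pi(e)$ is odd; (ii) for some $v\in T_e(E)$, the second intrinsic derivative $\partial^2_v\pi(e)\colon \operatorname{Ker} D\pi(e)\to\operatorname{Coker} D\pi(e)$ in the direction $v$ is an isomorphism. Then $e$ is an unavoidable crisis. Namely, $e\in\mathcal B$, and in every neighbourhood of $e$ in $E$ there exist two regular equilibria $e_\pm=(p_\pm,\omega_\pm)$ belonging to different path components of $E\setminus\mathcal B$ (equivalently, every continuous path in $E$ between $e_+$ and $e_-$ must intersect $\mathcal B$).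
   Context: Economy. $X=\mathbb R^l_{++}$ is the strictly positive orthant; $S=\{(p_1,\dots,p_l)\in\mathbb R^l_{++} : p_l=1\}$ is the set of normalized prices, identified with an open subset of $\mathbb R^{l-1}$. Each consumer $i=1,\dots,m$ has a fixed smooth utility function $u_i\colon X\to\mathbb R$ such that: (monotonicity) $\nabla u_i(x)\in\mathbb R^l_{++}$ for every $x\in X$; (strict quasi-concavity) the Hessian $D^2u_i(x)$ is negative definite on the tangent hyperplane at $x$ to the indifference surface through $x$; (necessity) for every $r\in\mathbb R$ the indifference surface $\{x\in X: u_i(x)=r\}$ is closed in $\mathbb R^l$. For an endowment $\omega_i\in X$ and $p\in S$, the demand $x_i(p,\omega_i)\in X$ is the unique maximizer of $u_i$ on $\{x\in X: p\cdot x\le p\cdot\omega_i\}$; it satisfies $p\cdot x_i(p,\omega_i)=p\cdot\omega_i$ and depends smoothly on $(p,\omega_i)$. An economy is $\omega=(\omega_1,\dots,\omega_m)\in\Omega=\mathbb R^{ml}_{++}$. The excess demand is $z\colon S\times\Omega\to\mathbb R^l$, $z(p,\omega)=\sum_{i=1}^m(x_i(p,\omega_i)-\omega_i)$. An equilibrium is a pair $(p,\omega)\in S\times\Omega$ with $z(p,\omega)=0$. The equilibrium manifold $E=\{(p,\omega): z(p,\omega)=0\}$ is a smooth $ml$-dimensional submanifold of $S\times\Omega$, diffeomorphic to Euclidean space; the natural projection $\pi\colon E\to\Omega$, $\pi(p,\omega)=\omega$, is smooth and proper. A regular equilibrium is a point $e\in E$ at which $D\pi(e)$ is an isomorphism.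 A crisis transition (crisis) is a point $e_*=(p_*,\omega_* )\in E$ such that on no neighbourhood of $\omega_*$ does there exist a continuous selection $\omega\mapsto p(\omega)$ of equilibrium prices with $p(\omega_* )=p_*$; equivalently, $\pi$ is not a local homeomorphism at $e_*$. $\mathcal B\subset E$ denotes the set of crisis transitions. Intrinsic derivative. Let $\psi\colon F\to F'$ be a morphism of smooth vector bundles over a manifold $M$, $x\in M$, $v\in T_x(M)$. Choose trivializations of $F,F'$ over a neighbourhood $U$ of $x$ with fibres $F_x,F'_x$, equal to the identity at $x$; in them $\psi$ becomes a smooth map $L\colon U\to\operatorname{Hom}(F_x,F'_x)$ with $L(x)=\psi_x$. With $l(t)=L(\exp(tv))$, where $\exp$ is any exponential map at $x$, the intrinsic derivative is $\partial_v\psi(x)=k\,\dot l(0)\,i\colon\operatorname{Ker}\psi_x\to\operatorname{Coker}\psi_x$, where $i\colon\operatorname{Ker}\psi_x\to F_x$ is the inclusion and $k\colon F'_x\to\operatorname{Coker}\psi_x$ the projection. It is independent of the choices. For a smooth map $f\colon M\to N$ regard $Df$ as a bundle morphism $T(M)\to f^*T(N)$; the intrinsic second derivative of $f$ at $x$ in the direction $v$ is $\partial_v^2f(x)=\partial_v(Df)(x)\colon\operatorname{Ker}Df(x)\to\operatorname{Coker}Df(x)$. *)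

theory Defs
  imports "HOL-Analysis.Analysis"
begin

section \<open>Smooth maps and tangent spaces of subsets of Euclidean space\<close>

text \<open>Intended for open \<open>U\<close>.\<close>

primrec Ck_on :: "nat \<Rightarrow> 'a::euclidean_space set \<Rightarrow> ('a \<Rightarrow> 'b::euclidean_space) \<Rightarrow> bool" where
  "Ck_on 0 U f \<longleftrightarrow> continuous_on U f"
| "Ck_on (Suc k) U f \<longleftrightarrow>
     (\<forall>x\<in>U. f differentiable (at x)) \<and> (\<forall>v. Ck_on k U (\<lambda>x. frechet_derivative f (at x) v))"

definition smooth_on :: "'a::euclidean_space set \<Rightarrow> ('a \<Rightarrow> 'b::euclidean_space) \<Rightarrow> bool" where
  "smooth_on U f \<longleftrightarrow> (\<forall>k. Ck_on k U f)"

text \<open>On a subset that need not be open (in particular on a submanifold), a map is smooth if near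
  each point of the subset it extends to a smooth map on an open set of the ambient space.\<close>

definition smooth_map_on :: "'a::euclidean_space set \<Rightarrow> ('a \<Rightarrow> 'b::euclidean_space) \<Rightarrow> bool" where
  "smooth_map_on A f \<longleftrightarrow>
     (\<forall>x\<in>A. \<exists>U g. open U \<and> x \<in> U \<and> smooth_on U g \<and> (\<forall>y\<in>A \<inter> U. g y = f y))"

text \<open>Manifolds are embedded in a Euclidean space; tangent vectors are velocities of smooth
  curves lying in the manifold.\<close>

definition tangent_space :: "'a::euclidean_space set \<Rightarrow> 'a \<Rightarrow> 'a set" where
  "tangent_space M x =
     {v. \<exists>c \<epsilon>. 0 < \<epsilon> \<and> smooth_on {-\<epsilon><..<\<epsilon>} c \<and> c ` {-\<epsilon><..<\<epsilon>} \<subseteq> M \<and> c (0::real) = x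
           \<and> (c has_vector_derivative v) (at 0)}"

text \<open>An exponential map at \<open>x\<close>: a smooth map from a neighbourhood of the origin of the tangent
  space at \<open>x\<close> into \<open>M\<close> that sends \<open>0\<close> to \<open>x\<close> and whose derivative at \<open>0\<close> is the identity.\<close>

definition exponential_map_at :: "'a::euclidean_space set \<Rightarrow> 'a \<Rightarrow> ('a \<Rightarrow> 'a) \<Rightarrow> bool" where
  "exponential_map_at M x ex \<longleftrightarrow>
     (\<exists>V. open V \<and> 0 \<in> V \<and> ex ` (tangent_space M x \<inter> V) \<subseteq> M \<and>
          smooth_map_on (tangent_space M x \<inter> V) ex \<and> ex 0 = x \<and>
          (\<forall>w\<in>tangent_space M x. ((\<lambda>t::real. ex (t *\<^sub>R w)) has_vector_derivative w) (at 0)))"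


section \<open>Kernels, cokernels and the intrinsic derivative\<close>

definition kernel_on :: "'a::real_vector set \<Rightarrow> ('a \<Rightarrow> 'b::real_vector) \<Rightarrow> 'a set" where
  "kernel_on V T = {w \<in> V. T w = 0}"

text \<open>The cokernel of \<open>T : V \<rightarrow> V'\<close> is the quotient of \<open>V'\<close> by \<open>T ` V\<close>, as a set of cosets;
  \<open>coker_proj V T\<close> is the projection of \<open>V'\<close> onto it.\<close>

definition coker_proj :: "'a::real_vector set \<Rightarrow> ('a \<Rightarrow> 'b::real_vector) \<Rightarrow> 'b \<Rightarrow> 'b set" where
  "coker_proj V T y = (+) y ` (T ` V)"

definition cokernel_on :: "'a::real_vector set \<Rightarrow> 'b set \<Rightarrow> ('a \<Rightarrow> 'b::real_vector) \<Rightarrow> 'b set set" where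
  "cokernel_on V V' T = coker_proj V T ` V'"

text \<open>\<open>D\<close> is a linear isomorphism from the kernel to the cokernel of \<open>T : V \<rightarrow> V'\<close>. A map into the
  quotient is linear iff it is induced by a linear map into \<open>V'\<close>.\<close>

definition ker_coker_isomorphism ::
    "'a::real_vector set \<Rightarrow> 'b set \<Rightarrow> ('a \<Rightarrow> 'b::real_vector) \<Rightarrow> ('a \<Rightarrow> 'b set) \<Rightarrow> bool" where
  "ker_coker_isomorphism V V' T D \<longleftrightarrow>
     (\<exists>A. linear A \<and> (\<forall>w\<in>kernel_on V T. A w \<in> V' \<and> D w = coker_proj V T (A w))) \<and>
     bij_betw D (kernel_on V T) (cokernel_on V V' T)"

text \<open>A vector bundle over \<open>M\<close> is given by its fibres \<open>F y\<close>, subspaces of a fixed Euclidean space.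
  A trivialization over \<open>M \<inter> U\<close> with fibre \<open>F x\<close> is written in the direction
  \<open>(M \<inter> U) \<times> F x \<rightarrow> F\<close>; smoothness of its fibrewise inverse is then automatic. Only the values of
  \<open>\<tau> y\<close> on \<open>F x\<close> matter, and linear maps on \<open>F x\<close> extend to the whole space.\<close>

definition local_trivialization ::
    "'a::euclidean_space set \<Rightarrow> ('a \<Rightarrow> 'b::euclidean_space set) \<Rightarrow> 'a \<Rightarrow> 'a set \<Rightarrow> ('a \<Rightarrow> 'b \<Rightarrow> 'b) \<Rightarrow> bool"
  where
  "local_trivialization M F x U \<tau> \<longleftrightarrow>
     open U \<and> x \<in> U \<and>
     (\<forall>y\<in>M \<inter> U. linear (\<tau> y) \<and> bij_betw (\<tau> y) (F x) (F y)) \<and>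
     (\<forall>w\<in>F x. \<tau> x w = w) \<and>
     smooth_map_on ((M \<inter> U) \<times> F x) (\<lambda>(y, w). \<tau> y w)"

text \<open>\<open>D\<close> is the intrinsic derivative at \<open>x\<close>, in the direction \<open>v\<close>, of the smooth bundle morphism
  \<open>\<psi> : F \<rightarrow> F'\<close> over \<open>M\<close>. Here \<open>L y = (\<tau>' y)\<^sup>-\<^sup>1 \<circ> \<psi> y \<circ> \<tau> y\<close> is the morphism read in the
  trivializations, and \<open>l'\<close> is the derivative at \<open>0\<close> of \<open>t \<mapsto> L (ex (t v))\<close> in \<open>Hom (F x) (F' x)\<close>.
  Because \<open>D\<close> does not depend on the choices, they are quantified existentially.\<close>

definition has_intrinsic_derivative ::
    "'a::euclidean_space set \<Rightarrow> ('a \<Rightarrow> 'b::euclidean_space set) \<Rightarrow> ('a \<Rightarrow> 'c::euclidean_space set)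
      \<Rightarrow> ('a \<Rightarrow> 'b \<Rightarrow> 'c) \<Rightarrow> 'a \<Rightarrow> 'a \<Rightarrow> ('b \<Rightarrow> 'c set) \<Rightarrow> bool" where
  "has_intrinsic_derivative M F F' \<psi> x v D \<longleftrightarrow>
     (\<exists>U \<tau> \<tau>' ex l'.
        local_trivialization M F x U \<tau> \<and> local_trivialization M F' x U \<tau>' \<and>
        exponential_map_at M x ex \<and>
        (let L = (\<lambda>y w. inv_into (F' x) (\<tau>' y) (\<psi> y (\<tau> y w))) in
           (\<forall>w\<in>F x. ((\<lambda>t::real. L (ex (t *\<^sub>R v)) w) has_vector_derivative l' w) (at 0))) \<and>
        (\<forall>w\<in>kernel_on (F x) (\<psi> x). D w = coker_proj (F x) (\<psi> x) (l' w)))"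

text \<open>For \<open>f\<close> smooth on an ambient neighbourhood of \<open>M\<close> and mapping \<open>M\<close> to \<open>N\<close>, the derivative
  of \<open>f : M \<rightarrow> N\<close> at \<open>y\<close> is the restriction of the ambient derivative to the tangent space of
  \<open>M\<close> at \<open>y\<close>.\<close>

definition has_intrinsic_second_derivative ::
    "'a::euclidean_space set \<Rightarrow> 'b::euclidean_space set \<Rightarrow> ('a \<Rightarrow> 'b) \<Rightarrow> 'a \<Rightarrow> 'a
      \<Rightarrow> ('a \<Rightarrow> 'b set) \<Rightarrow> bool" where
  "has_intrinsic_second_derivative M N f x v D \<longleftrightarrow>
     has_intrinsic_derivative M (tangent_space M) (\<lambda>y. tangent_space N (f y))
       (\<lambda>y. frechet_derivative f (at y)) x v D"


section \<open>Smooth pure exchange economies\<close>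

text \<open>Goods are indexed by \<open>'l\<close>, consumers by \<open>'m\<close>; \<open>n\<close> is the numeraire, the good
  whose price is normalized to \<open>1\<close>.\<close>

definition orthant :: "(real^'l) set" where
  "orthant = {x. \<forall>j. 0 < x $ j}"

definition prices :: "'l::finite \<Rightarrow> (real^'l) set" where
  "prices n = {p \<in> orthant. p $ n = 1}"

definition economies :: "(real^'l^'m) set" where
  "economies = {\<omega>. \<forall>i. \<omega> $ i \<in> orthant}"

definition indifference_surface :: "(real^'l \<Rightarrow> real) \<Rightarrow> real \<Rightarrow> (real^'l) set" where
  "indifference_surface u r = {x \<in> orthant. u x = r}"

definition smooth_utility :: "(real^'l::finite \<Rightarrow> real) \<Rightarrow> bool" where
  "smooth_utility u \<longleftrightarrow>
     smooth_on orthant u \<and>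
     (\<forall>x\<in>orthant. \<exists>g\<in>orthant. GDERIV u x :> g) \<and>
     (\<forall>x\<in>orthant. \<forall>v\<in>tangent_space (indifference_surface u (u x)) x.
        v \<noteq> 0 \<longrightarrow> frechet_derivative (\<lambda>y. frechet_derivative u (at y) v) (at x) v < 0) \<and>
     (\<forall>r. closed (indifference_surface u r))"

definition demand :: "(real^'l::finite \<Rightarrow> real) \<Rightarrow> real^'l \<Rightarrow> real^'l \<Rightarrow> real^'l" where
  "demand u p w = (THE x. is_arg_max u (\<lambda>x. x \<in> orthant \<and> p \<bullet> x \<le> p \<bullet> w) x)"

definition excess_demand ::
    "('m::finite \<Rightarrow> real^'l::finite \<Rightarrow> real) \<Rightarrow> real^'l \<Rightarrow> real^'l^'m \<Rightarrow> real^'l" where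
  "excess_demand u p \<omega> = (\<Sum>i\<in>UNIV. demand (u i) p (\<omega> $ i) - \<omega> $ i)"

definition equilibrium_manifold ::
    "'l::finite \<Rightarrow> ('m::finite \<Rightarrow> real^'l \<Rightarrow> real) \<Rightarrow> ((real^'l) \<times> (real^'l^'m)) set" where
  "equilibrium_manifold n u =
     {(p, \<omega>). p \<in> prices n \<and> \<omega> \<in> economies \<and> excess_demand u p \<omega> = 0}"

definition natural_projection :: "(real^'l) \<times> (real^'l^'m) \<Rightarrow> real^'l^'m" where
  "natural_projection = snd"

definition regular_equilibrium ::
    "'l::finite \<Rightarrow> ('m::finite \<Rightarrow> real^'l \<Rightarrow> real) \<Rightarrow> (real^'l) \<times> (real^'l^'m) \<Rightarrow> bool" where
  "regular_equilibrium n u e \<longleftrightarrow>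
     e \<in> equilibrium_manifold n u \<and>
     bij_betw (frechet_derivative natural_projection (at e))
       (tangent_space (equilibrium_manifold n u) e)
       (tangent_space economies (natural_projection e))"

definition crisis_transitions ::
    "'l::finite \<Rightarrow> ('m::finite \<Rightarrow> real^'l \<Rightarrow> real) \<Rightarrow> ((real^'l) \<times> (real^'l^'m)) set" where
  "crisis_transitions n u =
     {(p0, \<omega>0) \<in> equilibrium_manifold n u.
        \<not> (\<exists>U p. open U \<and> \<omega>0 \<in> U \<and> U \<subseteq> economies \<and> continuous_on U p \<and> p \<omega>0 = p0 \<and>
               (\<forall>\<omega>\<in>U. (p \<omega>, \<omega>) \<in> equilibrium_manifold n u))}"

end

theory Submission
  imports Defs "HOL-Homology.Brouwer_Degree"
begin

text \<open>By Walras' law \<open>E\<close> is the zero set of a smooth map \<open>Z\<close> from pairs \<open>(p, \<omega>)\<close> to \<open>\<real>\<^sup>l\<close>, and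
  \<open>T\<^sub>y(E) = Ker DZ(y)\<close>. Hence \<open>D\<pi>(y)\<close> has the same kernel and cokernel as the square matrix
  \<open>A(y) = D\<^sub>pZ(y)\<close>. By (ii) the derivative of \<open>A\<close> along a curve in \<open>E\<close> through \<open>e\<close> with velocity \<open>v\<close>
  induces an isomorphism \<open>Ker A(e) \<rightarrow> Coker A(e)\<close>, so that \<open>det A\<close> behaves like \<open>c t\<^sup>k\<close> with \<open>c \<noteq> 0\<close> and
  \<open>k = dim Ker A(e)\<close>. As \<open>k\<close> is odd, \<open>det A\<close> takes both signs, at regular equilibria, arbitrarily close to \<open>e\<close>.

  Outside \<open>\<B>\<close> the projection \<open>\<pi>\<close> is locally injective by invariance of domain, so along a path in
  \<open>E - \<B>\<close> the price \<open>p\<close> is an isolated zero of \<open>Z(\<cdot>, \<omega>)\<close>, with a uniform isolation radius. By homotopy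
  invariance of the Brouwer degree its index is constant along the path; at a regular equilibrium the
  index is the sign of \<open>det A\<close>. If \<open>e\<close> were not a crisis, it would have a path connected neighbourhood
  in \<open>E - \<B>\<close>.\<close>

subsection \<open>Calculus of \<open>C\<^sup>k\<close> maps\<close>

text \<open>The sign of \<open>det A\<close> need not stay constant along a path that avoids the
  crises, because \<open>det A\<close> may vanish off them: \<pi> can be a local homeomorphism with
  singular derivative, as t -> t^3 is. The two signs are therefore compared through a quantity that
  sees only isolated zeros, the degree on small spheres, and not through continuity of the
  determinant.

  Demand is a definite description, so its smoothness is found by running it backwards. Every bundle
  is demanded at exactly one pair of normalized price and income, and the map from bundles to such
  pairs is an explicit smooth bijection of the orthant with injective derivative; demand is its
  inverse.

  Tangent vectors are velocities of curves. Strict quasi-concavity and the computation of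
  \<open>T\<^sub>y(E)\<close> thus both require curves with prescribed velocity: for level sets of
  the utility they come from a local straightening, for E from a smooth retraction onto E, so that
  the rank of DZ is never computed.\<close>

lemma Ck_on_cong:
  assumes "open U" "\<And>x. x \<in> U \<Longrightarrow> f x = g x"
  shows "Ck_on k U f \<longleftrightarrow> Ck_on k U g"
proof -
  have *: "Ck_on k U g" if "\<And>x. x \<in> U \<Longrightarrow> f x = g x" "Ck_on k U f" for f g :: "'a \<Rightarrow> 'b" and k
    using that
  proof (induction k arbitrary: f g)
    case 0
    then show ?case by (simp add: continuous_on_eq)
  next
    case (Suc k)
    have D: "(g has_derivative frechet_derivative f (at x)) (at x)" if "x \<in> U" for x
    proof (rule has_derivative_transform_within_open[OF _ assms(1) that])
      show "(f has_derivative frechet_derivative f (at x)) (at x)"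
        using Suc.prems(2) that by (simp add: frechet_derivative_works)
    qed (rule Suc.prems(1))
    then have eq: "frechet_derivative f (at x) = frechet_derivative g (at x)" if "x \<in> U" for x
      using frechet_derivative_at that by blast
    have "Ck_on k U (\<lambda>x. frechet_derivative g (at x) v)" for v
      using Suc.prems(2) eq by (rule_tac Suc.IH[of "\<lambda>x. frechet_derivative f (at x) v"]) auto
    with D show ?case by (auto intro: differentiableI)
  qed
  show ?thesis using *[of f g] *[of g f] assms(2) by metis
qed

lemma Ck_on_subset:
  assumes "Ck_on k U f" "V \<subseteq> U"
  shows "Ck_on k V f"
  using assms by (induction k arbitrary: f) (auto intro: continuous_on_subset)

lemma Ck_on_SucD: "Ck_on (Suc k) U f \<Longrightarrow> Ck_on k U f"
proof (induction k arbitrary: f)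
  case 0
  then show ?case
    by (auto intro!: continuous_at_imp_continuous_on differentiable_imp_continuous_within)
qed simp

lemma Ck_on_le: "Ck_on k U f \<Longrightarrow> j \<le> k \<Longrightarrow> Ck_on j U f"
proof (induction k)
  case (Suc k)
  then show ?case using Ck_on_SucD le_Suc_eq by blast
qed simp

lemma Ck_on_imp_continuous_on: "Ck_on k U f \<Longrightarrow> continuous_on U f"
  using Ck_on_le[of k U f 0] by simp

lemma Ck_on_has_derivative:
  "Ck_on (Suc k) U f \<Longrightarrow> x \<in> U \<Longrightarrow> (f has_derivative frechet_derivative f (at x)) (at x)"
  by (simp add: frechet_derivative_works)

lemma Ck_on_SucI:
  assumes "open U" "\<And>x. x \<in> U \<Longrightarrow> (f has_derivative f' x) (at x)" "\<And>v. Ck_on k U (\<lambda>x. f' x v)"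
  shows "Ck_on (Suc k) U f"
proof -
  have "frechet_derivative f (at x) = f' x" if "x \<in> U" for x
    using assms(2) that frechet_derivative_at by metis
  then have "Ck_on k U (\<lambda>x. frechet_derivative f (at x) v)" for v
    using Ck_on_cong[OF assms(1), of "\<lambda>x. frechet_derivative f (at x) v" "\<lambda>x. f' x v" k] assms(3) by auto
  then show ?thesis using assms(2) by (auto simp: differentiable_def)
qed

lemma Ck_on_const: "open U \<Longrightarrow> Ck_on k U (\<lambda>x. c)"
proof (induction k arbitrary: c)
  case (Suc k)
  then show ?case by (intro Ck_on_SucI[of _ _ "\<lambda>_ _. 0"]) auto
qed simp

lemma Ck_on_bounded_linear:
  assumes "bounded_linear L" "open U" "Ck_on k U f"
  shows "Ck_on k U (\<lambda>x. L (f x))"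
  using assms(3)
proof (induction k arbitrary: f)
  case 0
  then show ?case using assms(1) by (simp add: linear_continuous_on_compose bounded_linear.linear)
next
  case (Suc k)
  show ?case
    using Suc.prems Ck_on_has_derivative[OF Suc.prems]
    by (intro Ck_on_SucI[OF assms(2), of _ "\<lambda>x v. L (frechet_derivative f (at x) v)"]
        bounded_linear.has_derivative[OF assms(1)] Suc.IH) auto
qed

lemma Ck_on_id: "open U \<Longrightarrow> Ck_on k U (\<lambda>x. x)"
  by (cases k) (auto intro!: Ck_on_SucI[where f' = "\<lambda>x v. v"] Ck_on_const)

lemma Ck_on_linear: "bounded_linear L \<Longrightarrow> open U \<Longrightarrow> Ck_on k U L"
  using Ck_on_bounded_linear[OF _ _ Ck_on_id] by blast

lemma Ck_on_add:
  assumes "open U" "Ck_on k U f" "Ck_on k U g"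
  shows "Ck_on k U (\<lambda>x. f x + g x)"
  using assms(2,3)
proof (induction k arbitrary: f g)
  case 0
  then show ?case by (simp add: continuous_on_add)
next
  case (Suc k)
  show ?case
    using Suc.prems Ck_on_has_derivative[OF Suc.prems(1)] Ck_on_has_derivative[OF Suc.prems(2)]
    by (intro Ck_on_SucI[OF assms(1), of _ "\<lambda>x v. frechet_derivative f (at x) v + frechet_derivative g (at x) v"]
        has_derivative_add Suc.IH) auto
qed

lemma Ck_on_sum:
  assumes "open U" "\<And>i. i \<in> I \<Longrightarrow> Ck_on k U (f i)"
  shows "Ck_on k U (\<lambda>x. \<Sum>i\<in>I. f i x)"
  using assms(2)
  by (induction I rule: infinite_finite_induct) (auto intro!: Ck_on_const Ck_on_add assms(1))

lemma Ck_on_bilinear: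
  assumes "bounded_bilinear pr" "open U" "Ck_on k U f" "Ck_on k U g"
  shows "Ck_on k U (\<lambda>x. pr (f x) (g x))"
  using assms(3,4)
proof (induction k arbitrary: f g)
  case 0
  then show ?case using bounded_bilinear.continuous_on[OF assms(1)] by simp
next
  case (Suc k)
  show ?case
  proof (intro Ck_on_SucI[OF assms(2)])
    show "((\<lambda>x. pr (f x) (g x)) has_derivative
       (\<lambda>v. pr (f x) (frechet_derivative g (at x) v) + pr (frechet_derivative f (at x) v) (g x))) (at x)" 
      if "x \<in> U" for x
      by (rule bounded_bilinear.FDERIV[OF assms(1) Ck_on_has_derivative[OF Suc.prems(1) that] Ck_on_has_derivative[OF Suc.prems(2) that]])
    show "Ck_on k U (\<lambda>x. pr (f x) (frechet_derivative g (at x) v) + pr (frechet_derivative f (at x) v) (g x))" for v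
      using Suc.prems by (intro Ck_on_add assms Suc.IH Ck_on_SucD[OF Suc.prems(1)] Ck_on_SucD[OF Suc.prems(2)]) auto
  qed
qed

lemmas Ck_on_scaleR = Ck_on_bilinear[OF bounded_bilinear_scaleR]
  and Ck_on_mult = Ck_on_bilinear[OF bounded_bilinear_mult]
  and Ck_on_inner = Ck_on_bilinear[OF bounded_bilinear_inner]

lemma Ck_on_diff:
  assumes "open U" "Ck_on k U f" "Ck_on k U g"
  shows "Ck_on k U (\<lambda>x. f x - g x)"
  using Ck_on_add[OF assms(1,2) Ck_on_bounded_linear[OF bounded_linear_minus[OF bounded_linear_ident] assms(1,3)]]
  by simp

lemma Ck_on_prod:
  fixes f :: "'i \<Rightarrow> 'a::euclidean_space \<Rightarrow> real"
  assumes "open U" "\<And>i. i \<in> I \<Longrightarrow> Ck_on k U (f i)"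
  shows "Ck_on k U (\<lambda>x. \<Prod>i\<in>I. f i x)"
  using assms(2)
  by (induction I rule: infinite_finite_induct) (auto intro!: Ck_on_const Ck_on_mult assms(1))

text \<open>The induction hypothesis covers \<open>g'\<close> at \<open>f x\<close> only in a fixed
  direction, whereas the chain rule evaluates it in the direction \<open>f' x v\<close>, which moves
  with \<open>x\<close>. Expanding this direction over \<open>Basis\<close> separates the two
  dependences.\<close>

lemma Ck_on_compose:
  assumes "open U" "open V" "f ` U \<subseteq> V" "Ck_on k U f" "Ck_on k V g"
  shows "Ck_on k U (\<lambda>x. g (f x))"
  using assms(4,5)
proof (induction k arbitrary: g)
  case 0
  then show ?case using continuous_on_compose2[of V g U f] assms(3) by simp
next
  case (Suc k)
  let ?f' = "\<lambda>x. frechet_derivative f (at x)" and ?g' = "\<lambda>x. frechet_derivative g (at x)"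
  have g': "(g has_derivative ?g' (f x)) (at (f x))" if "x \<in> U" for x
    using Ck_on_has_derivative[OF Suc.prems(2)] assms(3) that by blast
  show ?case
  proof (intro Ck_on_SucI[OF assms(1)])
    show "((\<lambda>x. g (f x)) has_derivative (\<lambda>v. \<Sum>b\<in>Basis. (?f' x v \<bullet> b) *\<^sub>R ?g' (f x) b)) (at x)"
      if "x \<in> U" for x
    proof -
      have lin: "linear (?g' (f x))" using g'[OF that] has_derivative_linear by blast
      have "((\<lambda>x. g (f x)) has_derivative (\<lambda>v. ?g' (f x) (?f' x v))) (at x)"
        using has_derivative_compose[OF Ck_on_has_derivative[OF Suc.prems(1) that] g'[OF that]] .
      moreover have "?g' (f x) (?f' x v) = (\<Sum>b\<in>Basis. (?f' x v \<bullet> b) *\<^sub>R ?g' (f x) b)" for v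
        by (subst euclidean_representation[of "?f' x v", symmetric])
          (simp only: linear_sum[OF lin] linear_scale[OF lin])
      ultimately show ?thesis by simp
    qed
    show "Ck_on k U (\<lambda>x. \<Sum>b\<in>Basis. (?f' x v \<bullet> b) *\<^sub>R ?g' (f x) b)" for v
      using Suc.prems Ck_on_SucD[OF Suc.prems(1)]
      by (intro Ck_on_sum Ck_on_scaleR Ck_on_inner Ck_on_const Suc.IH assms(1)) auto
  qed
qed

lemma Ck_on_inverse_real: "open S \<Longrightarrow> 0 \<notin> S \<Longrightarrow> Ck_on k S (inverse :: real \<Rightarrow> real)"
proof (induction k)
  case 0
  then show ?case by (auto intro!: continuous_intros)
next
  case (Suc k)
  have "Ck_on k S (\<lambda>x. - (inverse x * v * inverse x))" for v
    using Suc by (intro Ck_on_bounded_linear[OF bounded_linear_minus[OF bounded_linear_ident]] Ck_on_mult Ck_on_const) auto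
  moreover have "(inverse has_derivative (\<lambda>v. - (inverse x * v * inverse x))) (at x)" if "x \<in> S" for x
    using that Suc.prems by (intro has_derivative_inverse') auto
  ultimately show ?case by (intro Ck_on_SucI[OF Suc.prems(1)]) auto
qed

lemma Ck_on_inverse:
  fixes f :: "'a::euclidean_space \<Rightarrow> real"
  assumes "open U" "Ck_on k U f" "\<And>x. x \<in> U \<Longrightarrow> f x \<noteq> 0"
  shows "Ck_on k U (\<lambda>x. inverse (f x))"
  by (rule Ck_on_compose[OF assms(1) _ _ assms(2) Ck_on_inverse_real[of "- {0}"]]) (use assms(3) in auto)

lemma Ck_on_divide:
  fixes f g :: "'a::euclidean_space \<Rightarrow> real"
  assumes "open U" "Ck_on k U f" "Ck_on k U g" "\<And>x. x \<in> U \<Longrightarrow> g x \<noteq> 0"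
  shows "Ck_on k U (\<lambda>x. f x / g x)"
  unfolding divide_inverse using assms by (intro Ck_on_mult Ck_on_inverse) auto

lemma Ck_on_vec_nth: "open U \<Longrightarrow> Ck_on k U f \<Longrightarrow> Ck_on k U (\<lambda>x. f x $ i)"
  by (rule Ck_on_bounded_linear[OF bounded_linear_vec_nth])

lemma Ck_on_vec_lambda:
  fixes f :: "'n::finite \<Rightarrow> 'a::euclidean_space \<Rightarrow> real"
  assumes "open U" "\<And>i. Ck_on k U (f i)"
  shows "Ck_on k U (\<lambda>x. \<chi> i. f i x)"
proof -
  have "(\<lambda>x. \<chi> i. f i x) = (\<lambda>x. \<Sum>i\<in>UNIV. f i x *\<^sub>R axis i (1::real))"
    by (simp add: fun_eq_iff vec_eq_iff axis_def if_distrib cong: if_cong)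
  then show ?thesis
    by (simp only:) (intro Ck_on_sum Ck_on_scaleR Ck_on_const assms)
qed

lemma Ck_on_det:
  fixes A :: "'a::euclidean_space \<Rightarrow> real^'n^'n"
  assumes "open U" "\<And>i j. Ck_on k U (\<lambda>x. A x $ i $ j)"
  shows "Ck_on k U (\<lambda>x. det (A x))"
  unfolding det_def by (intro Ck_on_sum Ck_on_mult Ck_on_prod Ck_on_const assms)

section \<open>Smooth inverse functions\<close>

text \<open>By Cramer's rule the derivative of \<open>g\<close> at \<open>y\<close> is a quotient of
  determinants in the entries of \<open>f'\<close> at \<open>g y\<close>. If \<open>g\<close> is
  \<open>C\<^sup>k\<close>, so are these entries, and hence \<open>g\<close> is
  \<open>C\<^sup>k\<^sup>+\<^sup>1\<close>.\<close>

lemma Ck_on_inverse_function: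
  fixes f g :: "real^'n \<Rightarrow> real^'n"
  assumes "open U" "open V" "\<And>k. Ck_on k U f" "g ` V \<subseteq> U" "\<And>x. x \<in> U \<Longrightarrow> g (f x) = x" "\<And>y. y \<in> V \<Longrightarrow> f (g y) = y"
    and inj: "\<And>x h. x \<in> U \<Longrightarrow> frechet_derivative f (at x) h = 0 \<Longrightarrow> h = 0"
  shows "Ck_on k V g"
proof -
  let ?f' = "\<lambda>x. frechet_derivative f (at x)"
  have f': "(f has_derivative ?f' x) (at x)" if "x \<in> U" for x
    using Ck_on_has_derivative[OF assms(3) that] .
  have lin: "linear (?f' x)" if "x \<in> U" for x
    using f'[OF that] has_derivative_linear by blast
  define A where "A x = matrix (?f' x)" for x
  have Af: "A x *v h = ?f' x h" if "x \<in> U" for x h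
    unfolding A_def using lin[OF that] by (simp add: matrix_works)
  have detA: "det (A x) \<noteq> 0" if "x \<in> U" for x
    unfolding A_def using lin[OF that] inj[OF that] det_nz_iff_inj linear_injective_0 by blast
  define G where "G y h = (\<chi> k. det (\<chi> i j. if j = k then h $ i else A (g y) $ i $ j) / det (A (g y)))" for y h
  have AG: "A (g y) *v G y h = h" if "y \<in> V" for y h
    using cramer[of "A (g y)" "G y h" h] detA[of "g y"] assms(4) that unfolding G_def by blast
  have g': "(g has_derivative G y) (at y)" if "y \<in> V" for y
  proof -
    have gy: "g y \<in> U" using that assms(4) by blast
    have "?f' (g y) \<circ> G y = id"
      using AG[OF that] Af[OF gy] by (simp add: fun_eq_iff)
    from has_derivative_inverse_strong_x[OF assms(1) gy Ck_on_imp_continuous_on[OF assms(3)] assms(5) f'[OF gy] this assms(6)[OF that]]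
    show ?thesis by blast
  qed
  show ?thesis
  proof (induction k)
    case 0
    show ?case
      unfolding Ck_on.simps by (rule has_derivative_continuous_on[OF has_derivative_at_withinI[OF g']])
  next
    case (Suc k)
    have "Ck_on k U (\<lambda>x. ?f' x h)" for h
      using assms(3)[of "Suc k"] by simp
    then have "Ck_on k U (\<lambda>x. A x $ i $ j)" for i j
      unfolding A_def matrix_def by (simp add: Ck_on_vec_nth assms(1))
    then have A: "Ck_on k V (\<lambda>y. A (g y) $ i $ j)" for i j
      by (rule Ck_on_compose[OF assms(2,1,4) Suc.IH])
    have "Ck_on k V (\<lambda>y. if j = m then h $ i else A (g y) $ i $ j)" for i j m h
      using A Ck_on_const[OF assms(2)] by (cases "j = m") simp_all
    then have "Ck_on k V (\<lambda>y. G y h)" for h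
      unfolding G_def using detA assms(4)
      by (intro Ck_on_vec_lambda Ck_on_divide Ck_on_det assms(2)) (auto intro: A)
    with g' show ?case using Ck_on_SucI[OF assms(2)] by blast
  qed
qed

text \<open>Injectivity of the derivative is assumed at \<open>x0\<close> alone but returned on all
  of \<open>U'\<close>, the form in which \<open>Ck_on_inverse_function\<close> asks for it.\<close>

lemma Ck_on_local_inverse:
  fixes f :: "'a::euclidean_space \<Rightarrow> 'a"
  assumes "open U" "Ck_on (Suc 0) U f" "x0 \<in> U" "\<And>h. frechet_derivative f (at x0) h = 0 \<Longrightarrow> h = 0"
  obtains U' V g where "open U'" "open V" "U' \<subseteq> U" "x0 \<in> U'" "homeomorphism U' V f g"
    "\<And>x h. x \<in> U' \<Longrightarrow> frechet_derivative f (at x) h = 0 \<Longrightarrow> h = 0"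
proof -
  let ?f' = "\<lambda>x. frechet_derivative f (at x)"
  have f': "(f has_derivative ?f' x) (at x)" if "x \<in> U" for x
    using Ck_on_has_derivative[OF assms(2) that] .
  have bl: "bounded_linear (?f' x)" if "x \<in> U" for x using f'[OF that] has_derivative_bounded_linear by blast
  have app: "blinfun_apply (Blinfun (?f' x)) = ?f' x" if "x \<in> U" for x
    using bounded_linear_Blinfun_apply bl[OF that] by blast
  have lin0: "linear (?f' x0)" "inj (?f' x0)"
    using bl[OF assms(3)] assms(4) linear_injective_0 bounded_linear.linear by blast+
  obtain L where L: "linear L" "L \<circ> ?f' x0 = id"
    using linear_injective_left_inverse[OF lin0] by blast
  have iL: "Blinfun L o\<^sub>L Blinfun (?f' x0) = id_blinfun"
    using L(2) app[OF assms(3)] bounded_linear_Blinfun_apply[of L] L(1)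
    by (intro blinfun_eqI) (auto simp: fun_eq_iff linear_conv_bounded_linear)
  have cont: "continuous_on U (\<lambda>x. Blinfun (?f' x))"
  proof (rule continuous_on_blinfun_componentwise)
    fix i :: 'a
    show "continuous_on U (\<lambda>x. blinfun_apply (Blinfun (?f' x)) i)"
      using assms(2) app by (auto cong: continuous_on_cong)
  qed
  show thesis
  proof (rule inverse_function_theorem[OF assms(1) _ cont assms(3) iL])
    show "(f has_derivative blinfun_apply (Blinfun (?f' x))) (at x)" if "x \<in> U" for x
      using f'[OF that] app[OF that] by simp
  next
    fix U' V g g'
    assume *: "open U'" "U' \<subseteq> U" "x0 \<in> U'" "open V" "homeomorphism U' V f g"
      and bij: "\<And>y. y \<in> V \<Longrightarrow> bij (blinfun_apply (Blinfun (?f' (g y))))"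
    have "h = 0" if x: "x \<in> U'" and h: "?f' x h = 0" for x h
    proof -
      have "f x \<in> V" "g (f x) = x" using *(5) x unfolding homeomorphism_def by auto
      with bij[of "f x"] app[of x] x *(2) have "inj (?f' x)" by (simp add: bij_is_inj subsetD)
      then show ?thesis using h bl[of x] x *(2) linear_injective_0 bounded_linear.linear by blast
    qed
    then show thesis using that * by blast
  qed
qed

subsection \<open>Sign change of a determinant along a curve\<close>

definition orthonormal_proj :: "(real^'n) set \<Rightarrow> real^'n \<Rightarrow> real^'n" where
  "orthonormal_proj B x = (\<Sum>b\<in>B. (x \<bullet> b) *\<^sub>R b)"

text \<open>An orthogonal map taking a coordinate axis to \<open>b\<close> conjugates the reflection
  into a diagonal matrix with a single entry -1.\<close>

lemma det_reflection_unit: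
  fixes b :: "real^'n"
  assumes "norm b = 1"
  shows "det (matrix (\<lambda>x. x - 2 *\<^sub>R ((x \<bullet> b) *\<^sub>R b))) = -1"
proof -
  fix k :: 'n
  obtain f :: "real^'n \<Rightarrow> real^'n" where f: "orthogonal_transformation f" "f (axis k 1) = b"
    using orthogonal_transformation_exists_1[of "axis k 1 :: real^'n" b] assms norm_axis_1 by metis
  let ?R = "\<lambda>x::real^'n. \<chi> i. (if i = k then -1 else 1) * x $ i"
  have linf: "linear f" using f(1) by (simp add: orthogonal_transformation_linear)
  have linR: "linear ?R" by (rule linearI) (auto simp: vec_eq_iff algebra_simps)
  have R: "?R x = x - 2 *\<^sub>R ((x \<bullet> axis k 1) *\<^sub>R axis k 1)" for x :: "real^'n"
    by (simp only: inner_axis) (auto simp: vec_eq_iff axis_def)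
  have comp: "(\<lambda>x. x - 2 *\<^sub>R ((x \<bullet> b) *\<^sub>R b)) \<circ> f = f \<circ> ?R"
  proof
    fix x
    have "f x \<bullet> b = x \<bullet> axis k 1" using f unfolding orthogonal_transformation_def by metis
    then show "((\<lambda>x. x - 2 *\<^sub>R ((x \<bullet> b) *\<^sub>R b)) \<circ> f) x = (f \<circ> ?R) x"
      unfolding o_def R using linf by (simp add: linear_diff linear_scale f(2))
  qed
  have lin: "linear (\<lambda>x. x - 2 *\<^sub>R ((x \<bullet> b) *\<^sub>R b))"
    by (rule linearI) (auto simp: algebra_simps scaleR_add_left inner_add_left)
  have "det (matrix (\<lambda>x. x - 2 *\<^sub>R ((x \<bullet> b) *\<^sub>R b))) * det (matrix f) = det (matrix f) * det (matrix ?R)"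
    using arg_cong[OF comp, of "\<lambda>f. det (matrix f)"]
    by (simp only: matrix_compose[OF linf lin] matrix_compose[OF linR linf] det_mul)
  moreover have "det (matrix f) \<noteq> 0"
    using f(1) orthogonal_transformation_det by fastforce
  moreover have "det (matrix ?R) = -1"
  proof -
    have "det (matrix ?R) = (\<Prod>i\<in>UNIV. matrix ?R $ i $ i)"
      by (rule det_diagonal) (simp add: matrix_def axis_def)
    also have "\<dots> = (\<Prod>i\<in>UNIV. if i = k then -1 else 1)"
      by (simp add: matrix_def axis_def)
    also have "\<dots> = -1" by simp
    finally show ?thesis .
  qed
  ultimately have "(det (matrix (\<lambda>x. x - 2 *\<^sub>R ((x \<bullet> b) *\<^sub>R b))) + 1) * det (matrix f) = 0"
    by (simp add: distrib_right)
  with \<open>det (matrix f) \<noteq> 0\<close> show ?thesis by simp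
qed

lemma linear_orthonormal_proj: "linear (orthonormal_proj B)"
  unfolding orthonormal_proj_def
  by (intro linear_compose_sum ballI linearI) (auto simp: inner_add_left scaleR_add_left)

text \<open>Values of \<open>orthonormal_proj B\<close> are orthogonal to a further vector
  \<open>b\<close>, so the reflection for \<open>insert b B\<close> is the one in \<open>b\<close>
  after the one for \<open>B\<close>; each vector contributes a factor -1.\<close>

lemma det_reflection_orthonormal:
  fixes B :: "(real^'n) set"
  assumes "finite B" "pairwise orthogonal B" "\<And>b. b \<in> B \<Longrightarrow> norm b = 1"
  shows "det (matrix (\<lambda>x. x - 2 *\<^sub>R orthonormal_proj B x)) = (-1) ^ card B"
  using assms
proof (induction B)
  case empty
  have "matrix (\<lambda>x::real^'n. x) = mat 1" using matrix_id_mat_1 by (simp add: id_def)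
  then show ?case by (simp add: orthonormal_proj_def)
next
  case (insert b B)
  have orth: "x \<bullet> b = 0" if "x \<in> B" for x
    using insert that unfolding pairwise_def orthogonal_def by (metis insertCI inner_commute)
  have pb: "orthonormal_proj B x \<bullet> b = 0" for x
    using orth by (simp add: orthonormal_proj_def inner_sum_left)
  have lin: "linear (\<lambda>x. x - 2 *\<^sub>R orthonormal_proj B x)"
    using linear_orthonormal_proj[of B] by (intro linear_compose_sub linear_ident linear_compose_scale_right)
  have linb: "linear (\<lambda>x. x - 2 *\<^sub>R ((x \<bullet> b) *\<^sub>R b))"
    by (rule linearI) (auto simp: algebra_simps scaleR_add_left inner_add_left)
  have "(\<lambda>x. x - 2 *\<^sub>R orthonormal_proj (insert b B) x)
      = (\<lambda>x. x - 2 *\<^sub>R ((x \<bullet> b) *\<^sub>R b)) \<circ> (\<lambda>x. x - 2 *\<^sub>R orthonormal_proj B x)"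
  proof
    fix x
    have "orthonormal_proj (insert b B) x = (x \<bullet> b) *\<^sub>R b + orthonormal_proj B x"
      using insert by (simp add: orthonormal_proj_def)
    then show "x - 2 *\<^sub>R orthonormal_proj (insert b B) x
      = ((\<lambda>x. x - 2 *\<^sub>R ((x \<bullet> b) *\<^sub>R b)) \<circ> (\<lambda>x. x - 2 *\<^sub>R orthonormal_proj B x)) x"
      by (simp add: pb inner_diff_left algebra_simps)
  qed
  then have "det (matrix (\<lambda>x. x - 2 *\<^sub>R orthonormal_proj (insert b B) x))
     = det (matrix (\<lambda>x. x - 2 *\<^sub>R ((x \<bullet> b) *\<^sub>R b))) * det (matrix (\<lambda>x. x - 2 *\<^sub>R orthonormal_proj B x))"
    by (simp only: matrix_compose[OF lin linb] det_mul)
  moreover have "det (matrix (\<lambda>x. x - 2 *\<^sub>R orthonormal_proj B x)) = (-1) ^ card B"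
    using insert by (intro insert.IH) (auto simp: pairwise_insert)
  moreover have "norm b = 1" using insert by blast
  ultimately show ?case using insert.hyps det_reflection_unit[of b] by simp
qed

lemma tendsto_det:
  fixes A :: "'a \<Rightarrow> real^'n^'n"
  assumes "\<And>i j. ((\<lambda>t. A t $ i $ j) \<longlongrightarrow> L $ i $ j) F"
  shows "((\<lambda>t. det (A t)) \<longlongrightarrow> det L) F"
  unfolding det_def by (intro tendsto_intros assms)

lemma has_vector_derivative_quotient_tendsto:
  assumes "(f has_vector_derivative d) (at x)"
  shows "((\<lambda>h. (f (x + h) - f x) /\<^sub>R h) \<longlongrightarrow> d) (at 0)"
proof -
  have "((\<lambda>h. norm (f (x + h) - f x - h *\<^sub>R d) / norm h) \<longlongrightarrow> 0) (at 0)"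
    using assms unfolding has_vector_derivative_def has_derivative_at by simp
  then have "((\<lambda>h. norm ((f (x + h) - f x) /\<^sub>R h - d)) \<longlongrightarrow> 0) (at 0)"
  proof (rule Lim_transform_eventually)
    show "\<forall>\<^sub>F h in at 0. norm (f (x + h) - f x - h *\<^sub>R d) / norm h = norm ((f (x + h) - f x) /\<^sub>R h - d)"
    proof (rule eventually_at_filter[THEN iffD2, OF always_eventually], intro allI impI)
      fix h :: real assume "h \<noteq> 0"
      then have "(f (x + h) - f x) /\<^sub>R h - d = (f (x + h) - f x - h *\<^sub>R d) /\<^sub>R h"
        by (simp add: scaleR_diff_right)
      then show "norm (f (x + h) - f x - h *\<^sub>R d) / norm h = norm ((f (x + h) - f x) /\<^sub>R h - d)"
        by (simp add: divide_inverse mult.commute)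
    qed
  qed
  then show ?thesis using tendsto_norm_zero_iff LIM_zero_iff by blast
qed

text \<open>Let \<open>P\<close> project orthogonally onto K, the kernel of \<open>A 0\<close>, and
  let \<open>D s\<close> multiply K by \<open>s\<close> and fix its orthogonal complement. As t
  tends to 0, \<open>A t\<close> after \<open>D (1/t)\<close> tends to \<open>M\<close>, which is
  \<open>A'\<close> on K and \<open>A 0\<close> on the complement. The assumption \<open>inj\<close>
  makes \<open>M\<close> injective, so near 0 the sign of \<open>det (A t)\<close> is that of
  \<open>det M\<close> times that of \<open>det (D (1/t))\<close>. The latter changes with the sign
  of t because K has odd dimension.\<close>

lemma det_sign_change:
  fixes A :: "real \<Rightarrow> real^'n^'n" and A' :: "real^'n^'n"
  assumes der: "\<And>q. ((\<lambda>t. A t *v q) has_vector_derivative A' *v q) (at 0)"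
    and inj: "\<And>q r. A 0 *v q = 0 \<Longrightarrow> A' *v q = A 0 *v r \<Longrightarrow> q = 0"
    and odd: "odd (dim {q. A 0 *v q = 0})"
  shows "eventually (\<lambda>t. det (A t) * det (A (- t)) < 0) (at_right 0)"
proof -
  let ?K = "{q. A 0 *v q = 0}"
  have subK: "subspace ?K" unfolding subspace_def by (auto simp: matrix_vector_right_distrib matrix_vector_mult_scaleR)
  obtain B where B: "B \<subseteq> ?K" "pairwise orthogonal B" "\<And>b. b \<in> B \<Longrightarrow> norm b = 1" "independent B"
      "card B = dim ?K" "span B = ?K"
    using orthonormal_basis_subspace[OF subK] by metis
  have finB: "finite B" using B(4) independent_imp_finite by blast
  define P where "P = orthonormal_proj B"
  have linP: "linear P" unfolding P_def by (rule linear_orthonormal_proj)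
  have bb: "b \<bullet> b' = (if b = b' then 1 else 0)" if "b \<in> B" "b' \<in> B" for b b'
    using B(2,3) that unfolding pairwise_def orthogonal_def by (auto simp: dot_square_norm)
  have PB: "P x \<bullet> b = x \<bullet> b" if "b \<in> B" for x b
  proof -
    have "P x \<bullet> b = (\<Sum>b'\<in>B. if b' = b then x \<bullet> b' else 0)"
      unfolding P_def orthonormal_proj_def inner_sum_left by (rule sum.cong) (auto simp: bb that)
    also have "\<dots> = x \<bullet> b" using that finB by simp
    finally show ?thesis .
  qed
  have PP: "P (P x) = P x" for x
    unfolding P_def orthonormal_proj_def[of B "orthonormal_proj B x"] using PB[unfolded P_def] by (simp add: orthonormal_proj_def)
  have PK: "P x \<in> ?K" for x
    unfolding P_def orthonormal_proj_def using B(1) subK by (intro subspace_sum subspace_scale) auto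
  have Pid: "P x = x" if "x \<in> ?K" for x
  proof -
    have "x - P x \<in> span B" using that PK B(6) subK subspace_diff by blast
    moreover have "\<And>b. b \<in> B \<Longrightarrow> orthogonal (x - P x) b" by (simp add: orthogonal_def inner_diff_left PB)
    ultimately have "orthogonal (x - P x) (x - P x)" using orthogonal_to_span by blast
    then show ?thesis by (simp add: orthogonal_def)
  qed
  define D where "D s x = s *\<^sub>R P x + (x - P x)" for s x
  have linD: "linear (D s)" for s unfolding D_def
    using linP by (intro linear_compose_add linear_compose_sub linear_ident linear_compose_scale_right) auto
  have DD: "D s \<circ> D t = D (s * t)" for s t
    unfolding D_def by (auto simp: fun_eq_iff linear_add linear_diff linear_scale linP PP algebra_simps)
  have D1: "D 1 = id" by (auto simp: D_def)
  have detD: "det (matrix (D s)) * det (matrix (D t)) = det (matrix (D (s*t)))" for s t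
    by (metis DD det_mul matrix_compose linD)
  have detD1: "det (matrix (D 1)) = 1" by (simp add: D1 matrix_id_mat_1[unfolded id_def[symmetric]] flip: id_def)
  \<comment> \<open>Only the sign of this determinant matters. For positive \<open>s\<close>,
    \<open>D s\<close> is the square of \<open>D (sqrt s)\<close>; for negative \<open>s\<close> it
    is \<open>D (- s)\<close> after the reflection \<open>D (-1)\<close>.\<close>
  have detDpos: "det (matrix (D s)) > 0" if "s > 0" for s
  proof -
    have "det (matrix (D s)) = det (matrix (D (sqrt s))) ^ 2"
      using detD[of "sqrt s" "sqrt s"] that by (simp add: power2_eq_square)
    moreover have "det (matrix (D s)) \<noteq> 0" using detD[of s "inverse s"] detD1 that by auto
    ultimately show ?thesis by (simp add: zero_less_power2)
  qed
  have detDm1: "det (matrix (D (-1))) = -1"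
  proof -
    have "D (-1) = (\<lambda>x. x - 2 *\<^sub>R orthonormal_proj B x)" by (auto simp: D_def P_def algebra_simps scaleR_2)
    then show ?thesis using det_reflection_orthonormal[OF finB B(2,3)] odd B(5) by simp
  qed
  have detDneg: "det (matrix (D s)) < 0" if "s < 0" for s
    using detD[of "-1" "-s"] detDm1 detDpos[of "-s"] that by simp
  define M where "M x = A' *v P x + A 0 *v (x - P x)" for x
  have linM: "linear M" unfolding M_def
    by (rule linearI) (auto simp: linear_add linear_scale linP algebra_simps matrix_vector_mult_scaleR scaleR_diff_right matrix_vector_mult_diff_distrib)
  have injM: "x = 0" if "M x = 0" for x
  proof -
    have "A' *v P x = A 0 *v (- (x - P x))" using that unfolding M_def
      by (metis add_eq_0_iff2 linear_neg matrix_vector_mul_linear)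
    then have "P x = 0" using inj[of "P x"] PK by blast
    then have "A 0 *v x = 0" using that unfolding M_def by simp
    then show "x = 0" using Pid[of x] \<open>P x = 0\<close> by simp
  qed
  have detM: "det (matrix M) \<noteq> 0"
    using injM linM det_nz_iff_inj linear_injective_0 by blast
  \<comment> \<open>\<open>A 0\<close> annihilates \<open>P x\<close>, so dividing that component by
    t produces a difference quotient.\<close>
  have lim: "((\<lambda>t. A t *v D (inverse t) x) \<longlongrightarrow> M x) (at 0)" for x
  proof -
    have "((\<lambda>t. (A t *v P x - A 0 *v P x) /\<^sub>R t) \<longlongrightarrow> A' *v P x) (at 0)"
      using has_vector_derivative_quotient_tendsto[OF der[of "P x"]] by simp
    moreover have "((\<lambda>t. A t *v (x - P x)) \<longlongrightarrow> A 0 *v (x - P x)) (at 0)"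
      using der[of "x - P x"] has_vector_derivative_continuous isCont_def by blast
    ultimately have "((\<lambda>t. (A t *v P x - A 0 *v P x) /\<^sub>R t + A t *v (x - P x)) \<longlongrightarrow> M x) (at 0)"
      unfolding M_def by (rule tendsto_add)
    moreover have "A t *v D (inverse t) x = (A t *v P x - A 0 *v P x) /\<^sub>R t + A t *v (x - P x)" for t
      using PK[of x] by (simp add: D_def matrix_vector_right_distrib matrix_vector_mult_scaleR)
    ultimately show ?thesis by simp
  qed
  have "((\<lambda>t. det (A t ** matrix (D (inverse t)))) \<longlongrightarrow> det (matrix M)) (at 0)"
  proof (rule tendsto_det)
    fix i j
    have "((\<lambda>t. (A t *v D (inverse t) (axis j 1)) $ i) \<longlongrightarrow> M (axis j 1) $ i) (at 0)"
      by (intro tendsto_vec_nth lim)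
    moreover have "(A t ** matrix (D (inverse t))) $ i $ j = (A t *v D (inverse t) (axis j 1)) $ i" for t
      by (simp add: matrix_matrix_mult_def matrix_def matrix_vector_mult_def)
    ultimately show "((\<lambda>t. (A t ** matrix (D (inverse t))) $ i $ j) \<longlongrightarrow> matrix M $ i $ j) (at 0)"
      by (simp add: matrix_def)
  qed
  \<comment> \<open>The extra factor \<open>det (matrix M)\<close> turns the limit into a square,
    which is positive whatever the sign of \<open>det (matrix M)\<close>.\<close>
  then have *: "((\<lambda>t. det (A t) * det (matrix (D (inverse t))) * det (matrix M)) \<longlongrightarrow> det (matrix M) * det (matrix M)) (at 0)"
    unfolding det_mul by (intro tendsto_intros)
  have "det (matrix M) * det (matrix M) > 0" using detM by (metis not_real_square_gt_zero)
  from order_tendstoD(1)[OF * this]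
  have ev: "eventually (\<lambda>t. det (A t) * det (matrix (D (inverse t))) * det (matrix M) > 0) (at 0)" .
  then have r: "eventually (\<lambda>t. det (A t) * det (matrix (D (inverse t))) * det (matrix M) > 0) (at_right 0)"
    and "eventually (\<lambda>t. det (A t) * det (matrix (D (inverse t))) * det (matrix M) > 0) (at_left 0)"
    by (auto simp: eventually_at_split)
  then have l: "eventually (\<lambda>t. det (A (-t)) * det (matrix (D (inverse (-t)))) * det (matrix M) > 0) (at_right 0)"
    by (simp add: at_left_minus eventually_filtermap)
  have "eventually (\<lambda>t::real. t > 0) (at_right 0)" by (simp add: eventually_at_right_less)
  with r l show ?thesis
  proof eventually_elim
    case (elim t)
    then have "det (matrix (D (inverse t))) > 0" "det (matrix (D (inverse (-t)))) < 0"
      using detDpos detDneg by simp_all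
    with elim show ?case by (auto simp: zero_less_mult_iff mult_less_0_iff)
  qed
qed

subsection \<open>Brouwer degree of linear maps on the unit sphere\<close>

text \<open>Brouwer degrees are defined on \<open>nsphere\<close>, whose points are sequences
  \<open>nat \<Rightarrow> real\<close>. An arbitrary enumeration of the index type carries vectors
  to such sequences and back.\<close>

definition axis_enum :: "nat \<Rightarrow> 'n::finite" where
  "axis_enum = (SOME h. bij_betw h {..<CARD('n)} UNIV)"

lemma bij_axis_enum: "bij_betw (axis_enum :: nat \<Rightarrow> 'n::finite) {..<CARD('n)} UNIV"
proof -
  have "\<exists>h. bij_betw h {..<CARD('n)} (UNIV :: 'n set)"
    using ex_bij_betw_nat_finite[of "UNIV :: 'n set"] by (simp add: atLeast0LessThan)
  then show ?thesis unfolding axis_enum_def by (rule someI_ex)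
qed

definition vec_of_seq :: "(nat \<Rightarrow> real) \<Rightarrow> real^'n::finite" where
  "vec_of_seq x = (\<chi> j. x (inv_into {..<CARD('n)} axis_enum j))"

definition seq_of_vec :: "real^'n::finite \<Rightarrow> nat \<Rightarrow> real" where
  "seq_of_vec v = (\<lambda>i. if i < CARD('n) then v $ axis_enum i else 0)"

lemma vec_of_seq_of_vec: "vec_of_seq (seq_of_vec v) = (v :: real^'n::finite)"
proof -
  have "inv_into {..<CARD('n)} axis_enum j < CARD('n)" "axis_enum (inv_into {..<CARD('n)} axis_enum j) = j" for j :: 'n
    using bij_betwE[OF bij_betw_inv_into[OF bij_axis_enum], rule_format, of j] bij_betw_inv_into_right[OF bij_axis_enum, of j] by auto
  then show ?thesis by (simp add: vec_of_seq_def seq_of_vec_def vec_eq_iff)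
qed

lemma seq_of_vec_of_seq:
  assumes "\<And>i. i \<ge> CARD('n) \<Longrightarrow> x i = 0"
  shows "seq_of_vec (vec_of_seq x :: real^'n::finite) = x"
  using assms bij_betw_inv_into_left[OF bij_axis_enum[where 'n='n]] by (auto simp: vec_of_seq_def seq_of_vec_def fun_eq_iff)

lemma norm_vec_of_seq: "norm (vec_of_seq x :: real^'n::finite) ^ 2 = (\<Sum>i<CARD('n). (x i)\<^sup>2)"
proof -
  have "norm (vec_of_seq x :: real^'n) ^ 2 = (\<Sum>j\<in>(UNIV::'n set). (x (inv_into {..<CARD('n)} axis_enum j))\<^sup>2)"
    by (simp add: norm_vec_def L2_set_def vec_of_seq_def sum_nonneg)
  also have "\<dots> = (\<Sum>i<CARD('n). (x i)\<^sup>2)"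
    by (rule sum.reindex_bij_betw[OF bij_betw_inv_into[OF bij_axis_enum]])
  finally show ?thesis .
qed

lemma homeomorphic_maps_nsphere_vec:
  "homeomorphic_maps (nsphere (CARD('n) - 1)) (top_of_set (sphere 0 1)) (vec_of_seq :: _ \<Rightarrow> real^'n::finite) seq_of_vec"
proof -
  \<comment> \<open>The truncated subtraction is exact because an index type is nonempty.\<close>
  have S: "Suc (CARD('n) - 1) = CARD('n)" by simp
  have N: "{..CARD('n) - 1} = {..<CARD('n)}" using S lessThan_Suc_atMost by metis
  have nsph: "nsphere (CARD('n) - 1) = subtopology (powertop_real UNIV) {x. (\<forall>i\<ge>CARD('n). x i = 0) \<and> (\<Sum>i<CARD('n). (x i)\<^sup>2) = 1}"
    unfolding nsphere_def Euclidean_space_def subtopology_subtopology S N by (rule arg_cong[where f="subtopology _"]) auto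
  have "continuous_map (powertop_real UNIV) euclidean (vec_of_seq :: _ \<Rightarrow> real^'n)"
    unfolding euclidean_product_topology continuous_map_iff_continuous2 vec_of_seq_def
    by (intro continuous_on_vec_lambda continuous_on_product_coordinates)
  then have c1: "continuous_map (nsphere (CARD('n) - 1)) (top_of_set (sphere 0 1)) (vec_of_seq :: _ \<Rightarrow> real^'n)"
    unfolding nsph
    by (auto simp: continuous_map_in_subtopology norm_vec_of_seq[symmetric] power2_eq_1_iff
        intro!: continuous_map_from_subtopology) (smt (verit) norm_ge_zero)
  have "continuous_map (euclidean :: (real^'n) topology) (powertop_real UNIV) seq_of_vec"
    unfolding continuous_map_componentwise_UNIV seq_of_vec_def
    by (auto intro!: continuous_intros)
  then have c2: "continuous_map (top_of_set (sphere 0 1)) (nsphere (CARD('n) - 1)) (seq_of_vec :: real^'n \<Rightarrow> _)"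
    unfolding nsph
    apply (auto simp: continuous_map_in_subtopology norm_vec_of_seq[symmetric] 
        intro!: continuous_map_from_subtopology)
     apply (simp add: seq_of_vec_def)
    using norm_vec_of_seq[where 'n='n] vec_of_seq_of_vec by (metis one_power2)
  show ?thesis
    unfolding homeomorphic_maps_def
  proof (intro conjI c1 c2 ballI)
    show "seq_of_vec (vec_of_seq x :: real^'n) = x" if "x \<in> topspace (nsphere (CARD('n) - 1))" for x
      using that unfolding nsph by (intro seq_of_vec_of_seq) simp
  qed (rule vec_of_seq_of_vec)
qed

text \<open>\<open>sgn\<close> retracts the nonzero vectors radially onto the unit sphere, so the
  degree makes sense for every map of the sphere into the complement of 0.\<close>

definition sphere_degree :: "(real^'n::finite \<Rightarrow> real^'n) \<Rightarrow> int" where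
  "sphere_degree f = Brouwer_degree2 (CARD('n) - 1) (seq_of_vec \<circ> sgn \<circ> f \<circ> vec_of_seq)"

lemma continuous_map_vec_of_seq:
    "continuous_map (nsphere (CARD('n) - 1)) (top_of_set (sphere 0 1)) (vec_of_seq :: _ \<Rightarrow> real^'n::finite)"
  and continuous_map_seq_of_vec:
    "continuous_map (top_of_set (sphere 0 1)) (nsphere (CARD('n) - 1)) (seq_of_vec :: real^'n::finite \<Rightarrow> _)"
  using homeomorphic_maps_nsphere_vec unfolding homeomorphic_maps_def by blast+

lemma continuous_map_sgn: "continuous_map (top_of_set (- {0})) (top_of_set (sphere 0 1)) (sgn :: real^'n::finite \<Rightarrow> _)"
  by (auto simp: continuous_map_in_subtopology norm_sgn intro!: continuous_on_sgn continuous_intros)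

lemma sphere_degree_homotopic:
  fixes f g :: "real^'n::finite \<Rightarrow> real^'n"
  assumes "homotopic_with_canon (\<lambda>x. True) (sphere 0 1) (- {0}) f g"
  shows "sphere_degree f = sphere_degree g"
proof -
  have "homotopic_with (\<lambda>x. True) (top_of_set (sphere 0 1)) (nsphere (CARD('n) - 1)) ((seq_of_vec \<circ> sgn) \<circ> f) ((seq_of_vec \<circ> sgn) \<circ> g)"
    by (rule homotopic_with_compose_continuous_map_left[OF assms continuous_map_compose[OF continuous_map_sgn continuous_map_seq_of_vec]]) simp
  then have "homotopic_with (\<lambda>x. True) (nsphere (CARD('n) - 1)) (nsphere (CARD('n) - 1))
      ((seq_of_vec \<circ> sgn) \<circ> f \<circ> vec_of_seq) ((seq_of_vec \<circ> sgn) \<circ> g \<circ> vec_of_seq)"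
    by (rule homotopic_with_compose_continuous_map_right[OF _ continuous_map_vec_of_seq]) simp
  then show ?thesis unfolding sphere_degree_def by (rule Brouwer_degree2_homotopic)
qed

lemma continuous_map_sphere_degree:
  fixes f :: "real^'n::finite \<Rightarrow> real^'n"
  assumes "linear f" "\<And>x. f x = 0 \<Longrightarrow> x = 0"
  shows "continuous_map (nsphere (CARD('n) - 1)) (nsphere (CARD('n) - 1)) (seq_of_vec \<circ> sgn \<circ> f \<circ> vec_of_seq)"
proof -
  have "f x \<noteq> 0" if "norm x = 1" for x using assms(2)[of x] that by auto
  then have "continuous_map (top_of_set (sphere 0 1)) (top_of_set (- {0})) f"
    using assms(1) by (auto simp: continuous_map_in_subtopology linear_continuous_on linear_conv_bounded_linear)
  then show ?thesis
    by (rule continuous_map_compose[OF continuous_map_vec_of_seq continuous_map_compose[OF _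
          continuous_map_compose[OF continuous_map_sgn continuous_map_seq_of_vec]]])
qed

text \<open>The right-hand side normalizes once more, between \<open>g\<close> and \<open>f\<close>.
  As \<open>f\<close> is homogeneous, this does not change the direction of the result.\<close>

lemma sphere_degree_compose:
  fixes f g :: "real^'n::finite \<Rightarrow> real^'n"
  assumes f: "linear f" "\<And>x. f x = 0 \<Longrightarrow> x = 0" and g: "linear g" "\<And>x. g x = 0 \<Longrightarrow> x = 0"
  shows "sphere_degree (f \<circ> g) = sphere_degree f * sphere_degree g"
proof -
  have "sgn (f (g x)) = sgn (f (sgn (g x)))" if "g x \<noteq> 0" for x
    using that by (simp add: sgn_div_norm linear_scale[OF f(1)] f(2))
  moreover have "g (vec_of_seq x) \<noteq> 0" if "x \<in> topspace (nsphere (CARD('n) - 1))" for x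
    using continuous_map_image_subset_topspace[OF continuous_map_vec_of_seq] that g(2) by fastforce
  ultimately have "(seq_of_vec \<circ> sgn \<circ> (f \<circ> g) \<circ> vec_of_seq) x
      = ((seq_of_vec \<circ> sgn \<circ> f \<circ> vec_of_seq) \<circ> (seq_of_vec \<circ> sgn \<circ> g \<circ> vec_of_seq)) x"
    if "x \<in> topspace (nsphere (CARD('n) - 1))" for x
    using that by (simp add: vec_of_seq_of_vec)
  then have "sphere_degree (f \<circ> g) = Brouwer_degree2 (CARD('n) - 1)
     ((seq_of_vec \<circ> sgn \<circ> f \<circ> vec_of_seq) \<circ> (seq_of_vec \<circ> sgn \<circ> g \<circ> vec_of_seq))"
    unfolding sphere_degree_def by (rule Brouwer_degree2_eq)
  also have "\<dots> = sphere_degree f * sphere_degree g"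
    unfolding sphere_degree_def
    by (rule Brouwer_degree2_compose[OF continuous_map_sphere_degree[OF g] continuous_map_sphere_degree[OF f]])
  finally show ?thesis .
qed

lemma sgn_vec_of_seq:
  assumes "x \<in> topspace (nsphere (CARD('n) - 1))"
  shows "sgn (vec_of_seq x :: real^'n::finite) = vec_of_seq x" "seq_of_vec (vec_of_seq x :: real^'n::finite) = x"
proof -
  have "vec_of_seq x \<in> sphere (0::real^'n) 1"
    using continuous_map_image_subset_topspace[OF continuous_map_vec_of_seq[where 'n='n]] assms by auto
  then show "sgn (vec_of_seq x :: real^'n::finite) = vec_of_seq x" by (simp add: sgn_div_norm)
  show "seq_of_vec (vec_of_seq x :: real^'n::finite) = x"
    using homeomorphic_maps_nsphere_vec[where 'n='n] assms unfolding homeomorphic_maps_def by blast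
qed

lemma sphere_degree_id: "sphere_degree (id :: real^'n::finite \<Rightarrow> real^'n) = 1"
proof -
  have "sphere_degree (id :: real^'n \<Rightarrow> real^'n) = Brouwer_degree2 (CARD('n) - 1) id"
    unfolding sphere_degree_def
    by (rule Brouwer_degree2_eq) (simp add: sgn_vec_of_seq)
  then show ?thesis by simp
qed

section \<open>The degree of a linear isomorphism\<close>

definition flip_axes :: "'n::finite set \<Rightarrow> real^'n \<Rightarrow> real^'n" where
  "flip_axes T x = (\<chi> i. (if i \<in> T then -1 else 1) * x $ i)"

definition swap_axes :: "'n::finite \<Rightarrow> 'n \<Rightarrow> real^'n \<Rightarrow> real^'n" where
  "swap_axes m n x = (\<chi> i. x $ Transposition.transpose m n i)"

lemma linear_flip_axes: "linear (flip_axes T)"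
  unfolding flip_axes_def by (rule linearI) (auto simp: vec_eq_iff)

lemma linear_swap_axes: "linear (swap_axes m n)"
  unfolding swap_axes_def by (rule linearI) (auto simp: vec_eq_iff)

lemma flip_axes_eq_0: "flip_axes T x = 0 \<Longrightarrow> x = 0"
  unfolding flip_axes_def vec_eq_iff by (auto split: if_splits)

lemma swap_axes_swap_axes: "swap_axes m n \<circ> swap_axes m n = id"
  by (auto simp: swap_axes_def vec_eq_iff fun_eq_iff)

lemma swap_axes_eq_0: "swap_axes m n x = 0 \<Longrightarrow> x = 0"
  using swap_axes_swap_axes[of m n] linear_0[OF linear_swap_axes[of m n]] by (metis comp_apply id_apply)

text \<open>In sequence coordinates this flip is the reflection in coordinate 0, the one treated by
  \<open>Brouwer_degree2_reflection\<close>.\<close>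

lemma sphere_degree_flip_first: "sphere_degree (flip_axes {axis_enum 0 :: 'n::finite}) = -1"
proof -
  have *: "(seq_of_vec \<circ> sgn \<circ> flip_axes {axis_enum 0 :: 'n} \<circ> vec_of_seq) x = (\<lambda>i. if i = 0 then - x i else x i)"
    if x: "x \<in> topspace (nsphere (CARD('n) - 1))" for x
  proof -
    let ?v = "vec_of_seq x :: real^'n"
    have "?v \<in> sphere (0::real^'n) 1"
      using continuous_map_image_subset_topspace[OF continuous_map_vec_of_seq[where 'n='n]] x by auto
    moreover have "norm (flip_axes {axis_enum 0 :: 'n} ?v) = norm ?v"
      by (simp add: norm_vec_def L2_set_def flip_axes_def power_mult_distrib if_distrib cong: if_cong)
        (rule sum.cong, auto)
    ultimately have "sgn (flip_axes {axis_enum 0 :: 'n} ?v) = flip_axes {axis_enum 0 :: 'n} ?v"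
      by (simp add: sgn_div_norm)
    moreover have "seq_of_vec (flip_axes {axis_enum 0 :: 'n} ?v) i = (if i = 0 then - x i else x i)" for i
    proof -
      have xi: "x i = seq_of_vec ?v i" using sgn_vec_of_seq(2)[OF x] by simp
      have "axis_enum i = (axis_enum 0 :: 'n) \<longleftrightarrow> i = 0" if "i < CARD('n)"
        using that bij_axis_enum[where 'n='n] unfolding bij_betw_def inj_on_def
        by (metis lessThan_iff zero_less_card_finite)
      then show ?thesis unfolding xi by (auto simp: seq_of_vec_def flip_axes_def)
    qed
    ultimately show ?thesis by auto
  qed
  show ?thesis unfolding sphere_degree_def by (simp only: Brouwer_degree2_eq[OF *] Brouwer_degree2_reflection)
qed

lemma sphere_degree_swap_axes: "sphere_degree (swap_axes m n) * sphere_degree (swap_axes m n) = 1"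
  using sphere_degree_compose[OF linear_swap_axes[of m n] swap_axes_eq_0 linear_swap_axes[of m n] swap_axes_eq_0]
  by (simp add: swap_axes_swap_axes sphere_degree_id)

text \<open>Every flip is conjugate to the first one by a swap, and conjugation multiplies the
  degree by the square of the degree of the swap, which is 1.\<close>

lemma sphere_degree_flip_axis: "sphere_degree (flip_axes {k :: 'n::finite}) = -1"
proof -
  let ?S = "swap_axes k (axis_enum 0)" and ?R = "flip_axes {axis_enum 0 :: 'n}"
  have eq: "flip_axes {k} = ?S \<circ> (?R \<circ> ?S)"
    by (auto simp: fun_eq_iff vec_eq_iff flip_axes_def swap_axes_def Transposition.transpose_def)
  have "sphere_degree (flip_axes {k}) = sphere_degree ?S * sphere_degree (?R \<circ> ?S)"
    unfolding eq
    by (rule sphere_degree_compose)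
      (auto intro: linear_swap_axes linear_flip_axes linear_compose dest: swap_axes_eq_0 flip_axes_eq_0)
  also have "sphere_degree (?R \<circ> ?S) = sphere_degree ?R * sphere_degree ?S"
    by (rule sphere_degree_compose)
      (auto intro: linear_swap_axes linear_flip_axes dest: swap_axes_eq_0 flip_axes_eq_0)
  finally show ?thesis using sphere_degree_swap_axes[of k "axis_enum 0"] by (simp add: sphere_degree_flip_first)
qed

lemma sphere_degree_flip_axes: "sphere_degree (flip_axes (T :: 'n::finite set)) = (-1) ^ card T"
proof (induction T rule: infinite_finite_induct)
  case empty
  have "flip_axes ({} :: 'n set) = id" by (auto simp: fun_eq_iff vec_eq_iff flip_axes_def)
  then show ?case by (simp only: sphere_degree_id card.empty power_0)
next
  case (insert k T)
  have eq: "flip_axes (insert k T) = flip_axes {k} \<circ> flip_axes T"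
    using insert by (auto simp: fun_eq_iff vec_eq_iff flip_axes_def)
  have "sphere_degree (flip_axes {k} \<circ> flip_axes T) = sphere_degree (flip_axes {k}) * sphere_degree (flip_axes T)"
    by (rule sphere_degree_compose[OF linear_flip_axes _ linear_flip_axes]) (rule flip_axes_eq_0, assumption)+
  then show ?case unfolding eq using insert by (simp only: sphere_degree_flip_axis) simp
qed simp

lemma sphere_degree_segment:
  fixes f g :: "real^'n::finite \<Rightarrow> real^'n"
  assumes "linear f" "linear g" "\<And>t x. 0 \<le> t \<Longrightarrow> t \<le> 1 \<Longrightarrow> (1 - t) *\<^sub>R f x + t *\<^sub>R g x = 0 \<Longrightarrow> x = 0"
  shows "sphere_degree f = sphere_degree g"
proof (rule sphere_degree_homotopic, rule homotopic_with_linear)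
  show "continuous_on (sphere 0 1) f" "continuous_on (sphere 0 1) g"
    using assms(1,2) by (auto simp: linear_continuous_on linear_conv_bounded_linear)
  show "closed_segment (f x) (g x) \<subseteq> - {0}" if "x \<in> sphere 0 1" for x
  proof -
    have "x \<noteq> 0" using that by auto
    then show ?thesis unfolding closed_segment_def using assms(3)[of _ x] by fastforce
  qed
qed

text \<open>Both sides are multiplicative, so elementary matrices suffice. Each invertible one is
  joined, by a segment of invertible matrices, to a flip of some axes or to the identity.\<close>

lemma sphere_degree_linear:
  fixes f :: "real^'n::finite \<Rightarrow> real^'n"
  assumes "linear f" "det (matrix f) \<noteq> 0"
  shows "real_of_int (sphere_degree f) = sgn (det (matrix f))"
proof -
  \<comment> \<open>Stated as an implication because the generators of the induction include
    singular maps.\<close>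
  have "det (matrix f) \<noteq> 0 \<longrightarrow> real_of_int (sphere_degree f) = sgn (det (matrix f))"
  proof (rule induct_linear_elementary[OF assms(1)])
    fix f g :: "real^'n \<Rightarrow> real^'n"
    assume *: "linear f" "linear g" "det (matrix f) \<noteq> 0 \<longrightarrow> real_of_int (sphere_degree f) = sgn (det (matrix f))"
      "det (matrix g) \<noteq> 0 \<longrightarrow> real_of_int (sphere_degree g) = sgn (det (matrix g))"
    have dm: "det (matrix (f \<circ> g)) = det (matrix f) * det (matrix g)"
      by (simp only: matrix_compose[OF *(2,1)] det_mul)
    show "det (matrix (f \<circ> g)) \<noteq> 0 \<longrightarrow> real_of_int (sphere_degree (f \<circ> g)) = sgn (det (matrix (f \<circ> g)))"
    proof
      assume "det (matrix (f \<circ> g)) \<noteq> 0"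
      then have nz: "det (matrix f) \<noteq> 0" "det (matrix g) \<noteq> 0" unfolding dm by auto
      then have "sphere_degree (f \<circ> g) = sphere_degree f * sphere_degree g"
        using *(1,2) by (intro sphere_degree_compose) (metis det_nz_iff_inj linear_injective_0)+
      then show "real_of_int (sphere_degree (f \<circ> g)) = sgn (det (matrix (f \<circ> g)))"
        using * nz unfolding dm sgn_mult by simp
    qed
  next
    fix f :: "real^'n \<Rightarrow> real^'n" and i
    assume *: "linear f" "\<And>x. f x $ i = 0"
    have "det (matrix f) = 0"
      by (rule det_zero_row(1)[of i]) (simp add: row_def matrix_def vec_eq_iff *(2))
    then show "det (matrix f) \<noteq> 0 \<longrightarrow> real_of_int (sphere_degree f) = sgn (det (matrix f))" by simp
  next
    fix c :: "'n \<Rightarrow> real"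
    let ?f = "\<lambda>x::real^'n. \<chi> i. c i * x $ i"
    have lin: "linear ?f" by (rule linearI) (auto simp: vec_eq_iff algebra_simps)
    have "det (matrix ?f) = (\<Prod>i\<in>UNIV. matrix ?f $ i $ i)"
      by (rule det_diagonal) (simp add: matrix_def axis_def)
    then have det: "det (matrix ?f) = (\<Prod>i\<in>UNIV. c i)" by (simp add: matrix_def axis_def)
    show "det (matrix ?f) \<noteq> 0 \<longrightarrow> real_of_int (sphere_degree ?f) = sgn (det (matrix ?f))"
    proof
      assume "det (matrix ?f) \<noteq> 0"
      then have c: "c i \<noteq> 0" for i unfolding det by simp
      let ?T = "{i. c i < 0}"
      \<comment> \<open>Each diagonal entry moves to its own sign without crossing 0.\<close>
      have "sphere_degree ?f = sphere_degree (flip_axes ?T)"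
      proof (rule sphere_degree_segment[OF lin linear_flip_axes])
        fix t :: real and x :: "real^'n"
        assume t: "0 \<le> t" "t \<le> 1" and eq: "(1 - t) *\<^sub>R ?f x + t *\<^sub>R flip_axes ?T x = 0"
        have "x $ i = 0" for i
        proof -
          have e: "((1 - t) * c i + t * sgn (c i)) * x $ i = 0"
            using arg_cong[OF eq, of "\<lambda>v. v $ i"] c[of i] by (auto simp: flip_axes_def algebra_simps sgn_if split: if_splits)
          have "(1 - t) * c i + t * sgn (c i) = ((1 - t) * \<bar>c i\<bar> + t) * sgn (c i)"
            by (simp add: algebra_simps abs_mult_sgn)
          moreover have "(1 - t) * \<bar>c i\<bar> + t > 0" 
            using t c[of i] by (cases "t = 0") (auto intro: add_nonneg_pos)
          ultimately show ?thesis using e c[of i] by (auto simp: sgn_zero_iff)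
        qed
        then show "x = 0" by (simp add: vec_eq_iff)
      qed
      also have "real_of_int \<dots> = (\<Prod>i\<in>UNIV. sgn (c i))"
      proof -
        have "(\<Prod>i\<in>UNIV. sgn (c i)) = (\<Prod>i\<in>UNIV. if i \<in> ?T then -1 else 1)"
          using c by (intro prod.cong) (auto simp: sgn_if)
        also have "\<dots> = (-1) ^ card ?T" by (simp add: prod.If_cases)
        finally show ?thesis by (simp add: sphere_degree_flip_axes)
      qed
      also have "\<dots> = sgn (det (matrix ?f))"
      proof -
        have "(\<Prod>i\<in>A. sgn (c i)) = sgn (\<Prod>i\<in>A. c i)" for A
          by (induction A rule: infinite_finite_induct) (auto simp: sgn_mult)
        then show ?thesis unfolding det .
      qed
      finally show "real_of_int (sphere_degree ?f) = sgn (det (matrix ?f))" .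
    qed
  next
    fix m n :: 'n assume mn: "m \<noteq> n"
    let ?f = "\<lambda>x::real^'n. \<chi> i. x $ Transposition.transpose m n i"
    have f: "?f = swap_axes m n" by (simp add: swap_axes_def fun_eq_iff)
    have "matrix ?f = (\<chi> i. mat 1 $ Transposition.transpose m n i)"
      by (auto simp: matrix_def axis_def mat_def vec_eq_iff)
    then have "det (matrix ?f) = of_int (sign (Transposition.transpose m n)) * det (mat 1 :: real^'n^'n)"
      using det_permute_rows[of "Transposition.transpose m n" "mat 1 :: real^'n^'n"] permutes_swap_id by (metis UNIV_I)
    then have det: "det (matrix ?f) = -1" using mn by (simp add: sign_swap_id)
    \<comment> \<open>Swap and flip are both reflections of the plane of the axes m and n. On it the
      segment has rows (-t, 1-t) and (1-t, t), with determinant -(t^2 + (1-t)^2), which never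
      vanishes.\<close>
    have "sphere_degree ?f = sphere_degree (flip_axes {m})"
      unfolding f
    proof (rule sphere_degree_segment[OF linear_swap_axes linear_flip_axes])
      fix t :: real and x :: "real^'n"
      assume t: "0 \<le> t" "t \<le> 1" and eq: "(1 - t) *\<^sub>R swap_axes m n x + t *\<^sub>R flip_axes {m} x = 0"
      have m: "(1 - t) * x $ n - t * x $ m = 0"
        using arg_cong[OF eq, of "\<lambda>v. v $ m"] by (simp add: flip_axes_def swap_axes_def)
      have n: "(1 - t) * x $ m + t * x $ n = 0"
        using arg_cong[OF eq, of "\<lambda>v. v $ n"] mn by (simp add: flip_axes_def swap_axes_def)
      have "(1 - t) * ((x $ m)^2 + (x $ n)^2) = x $ n * ((1 - t) * x $ n - t * x $ m) + x $ m * ((1 - t) * x $ m + t * x $ n)"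
        by (simp add: algebra_simps power2_eq_square)
      then have "t = 1 \<or> (x $ m = 0 \<and> x $ n = 0)" unfolding m n by (auto simp: sum_power2_eq_zero_iff)
      then have mn0: "x $ m = 0" "x $ n = 0" using m n by auto
      have "x $ i = 0" for i
      proof (cases "i = m \<or> i = n")
        case False
        then show ?thesis using arg_cong[OF eq, of "\<lambda>v. v $ i"]
          by (simp add: flip_axes_def swap_axes_def algebra_simps)
      qed (use mn0 in auto)
      then show "x = 0" by (simp add: vec_eq_iff)
    qed
    then show "det (matrix ?f) \<noteq> 0 \<longrightarrow> real_of_int (sphere_degree ?f) = sgn (det (matrix ?f))"
      by (simp add: sphere_degree_flip_axes det)
  next
    fix m n :: 'n assume mn: "m \<noteq> n"
    let ?f = "\<lambda>x::real^'n. \<chi> i. if i = m then x $ m + x $ n else x $ i"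
    have lin: "linear ?f" by (rule linearI) (auto simp: vec_eq_iff algebra_simps)
    have "matrix ?f = (\<chi> i. if i = m then row m (mat 1) + 1 *s row n (mat 1) else row i (mat 1))"
      by (auto simp: matrix_def axis_def mat_def row_def vec_eq_iff)
    then have det: "det (matrix ?f) = 1" using det_row_operation[OF mn, of "mat 1 :: real^'n^'n" 1] by simp
    \<comment> \<open>Along the segment the diagonal entries stay 1 while the off-diagonal entry
      shrinks to 0.\<close>
    have "sphere_degree ?f = sphere_degree (id :: real^'n \<Rightarrow> _)"
    proof (rule sphere_degree_segment[OF lin linear_id])
      fix t :: real and x :: "real^'n"
      assume t: "0 \<le> t" "t \<le> 1" and eq: "(1 - t) *\<^sub>R ?f x + t *\<^sub>R id x = 0"
      have i: "x $ i = 0" if "i \<noteq> m" for i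
        using arg_cong[OF eq, of "\<lambda>v. v $ i"] that by (simp add: algebra_simps)
      moreover have "x $ m = 0"
        using arg_cong[OF eq, of "\<lambda>v. v $ m"] i[of n] mn by (simp add: algebra_simps)
      ultimately show "x = 0" by (metis vec_eq_iff zero_index)
    qed
    then show "det (matrix ?f) \<noteq> 0 \<longrightarrow> real_of_int (sphere_degree ?f) = sgn (det (matrix ?f))"
      by (simp add: sphere_degree_id det)
  qed
  then show ?thesis using assms(2) by blast
qed

lemma homotopic_linear_imp_det_same_sign:
  fixes f g :: "real^'n::finite \<Rightarrow> real^'n"
  assumes "linear f" "linear g" "det (matrix f) \<noteq> 0" "det (matrix g) \<noteq> 0"
    and "homotopic_with_canon (\<lambda>x. True) (sphere 0 1) (- {0}) f g"
  shows "sgn (det (matrix f)) = sgn (det (matrix g))"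
  using sphere_degree_linear[OF assms(1,3)] sphere_degree_linear[OF assms(2,4)] sphere_degree_homotopic[OF assms(5)]
  by simp

subsection \<open>Demand\<close>

definition gradient :: "(real^'n::finite \<Rightarrow> real) \<Rightarrow> real^'n \<Rightarrow> real^'n" where
  "gradient u x = (\<chi> j. frechet_derivative u (at x) (axis j 1))"

lemma frechet_derivative_eq_gradient:
  assumes "u differentiable (at x)"
  shows "frechet_derivative u (at x) h = gradient u x \<bullet> h"
proof -
  have lin: "linear (frechet_derivative u (at x))"
    using assms by (simp add: linear_frechet_derivative)
  have "frechet_derivative u (at x) h = frechet_derivative u (at x) (\<Sum>j\<in>UNIV. h $ j *\<^sub>R axis j 1)"
    by (rule arg_cong[where f = "frechet_derivative u (at x)"]) (simp add: vec_eq_iff axis_def if_distrib cong: if_cong)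
  also have "\<dots> = gradient u x \<bullet> h"
    by (simp add: linear_sum[OF lin] linear_scale[OF lin] gradient_def inner_vec_def mult.commute)
  finally show ?thesis .
qed

lemma Ck_on_gradient:
  fixes u :: "real^'n::finite \<Rightarrow> real"
  assumes "open U" "Ck_on (Suc k) U u"
  shows "Ck_on k U (gradient u)"
proof -
  have "Ck_on k U (\<lambda>x. \<chi> j. frechet_derivative u (at x) (axis j 1))"
    using assms by (intro Ck_on_vec_lambda) auto
  moreover have "gradient u = (\<lambda>x. \<chi> j. frechet_derivative u (at x) (axis j 1))"
    by (simp add: fun_eq_iff gradient_def)
  ultimately show ?thesis by simp
qed

text \<open>The shape shared by \<open>price_income\<close>, \<open>normalize_price\<close> and
  \<open>Z\<close>, each of which alters only the coordinate \<open>n\<close>.\<close>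

lemma Ck_on_axis_update:
  fixes f :: "'a::euclidean_space \<Rightarrow> real^'n::finite"
  assumes "open U" "Ck_on k U f" "Ck_on k U r"
  shows "Ck_on k U (\<lambda>x. f x + r x *\<^sub>R axis n 1)"
  using assms by (intro Ck_on_add Ck_on_scaleR Ck_on_const)

text \<open>Strict quasi-concavity speaks of velocities of curves in an indifference surface; this
  makes it available for every \<open>v\<close> in the kernel of the derivative. Replacing the
  coordinate \<open>n\<close> by the value of \<open>u\<close> is a local diffeomorphism \<Phi> that
  straightens the level sets, and lines in the straightened picture pull back to the required
  curves.\<close>

lemma mem_tangent_space_level_set:
  fixes u :: "real^'n::finite \<Rightarrow> real"
  assumes U: "open U" "\<And>k. Ck_on k U u" "x \<in> U" and gn: "gradient u x $ n \<noteq> 0"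
    and v: "frechet_derivative u (at x) v = 0"
  shows "v \<in> tangent_space {y \<in> U. u y = u x} x"
proof -
  define \<Phi> where "\<Phi> y = y + (u y - y $ n) *\<^sub>R axis n 1" for y
  have smooth: "Ck_on k U \<Phi>" for k
    unfolding \<Phi>_def using U by (intro Ck_on_axis_update Ck_on_diff Ck_on_id Ck_on_vec_nth)
  have du: "(u has_derivative frechet_derivative u (at x)) (at x)"
    by (rule Ck_on_has_derivative[OF U(2,3)])
  have d\<Phi>: "(\<Phi> has_derivative (\<lambda>h. h + (frechet_derivative u (at x) h - h $ n) *\<^sub>R axis n 1)) (at x)"
    unfolding \<Phi>_def
    by (auto intro!: derivative_eq_intros du bounded_linear.has_derivative[OF bounded_linear_vec_nth])
  have fd\<Phi>: "frechet_derivative \<Phi> (at x) h = h + (frechet_derivative u (at x) h - h $ n) *\<^sub>R axis n 1" for h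
    by (rule fun_cong[OF frechet_derivative_at[OF d\<Phi>, symmetric]])
  have inj: "h = 0" if "frechet_derivative \<Phi> (at x) h = 0" for h
  proof -
    have eq: "h + (gradient u x \<bullet> h - h $ n) *\<^sub>R axis n 1 = 0"
      using that fd\<Phi>[of h] frechet_derivative_eq_gradient[OF differentiableI[OF du], of h] by simp
    have "h $ j = 0" if "j \<noteq> n" for j
      using arg_cong[OF eq, of "\<lambda>v. v $ j"] that by (simp add: axis_def)
    then have h: "h = h $ n *\<^sub>R axis n 1" by (simp add: vec_eq_iff axis_def)
    have "gradient u x \<bullet> h = 0"
      using arg_cong[OF eq, of "\<lambda>v. v $ n"] by (simp add: axis_def)
    then have "h $ n * gradient u x $ n = 0"
      by (subst (asm) h) (simp add: inner_axis)
    then show "h = 0" using h gn by simp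
  qed
  obtain U' V G where *: "open U'" "open V" "U' \<subseteq> U" "x \<in> U'" "homeomorphism U' V \<Phi> G"
    and inj': "\<And>x h. x \<in> U' \<Longrightarrow> frechet_derivative \<Phi> (at x) h = 0 \<Longrightarrow> h = 0"
    using Ck_on_local_inverse[OF U(1) smooth U(3) inj] by blast
  have GV: "G ` V = U'" and G\<Phi>: "\<And>y. y \<in> U' \<Longrightarrow> G (\<Phi> y) = y" and \<Phi>G: "\<And>y. y \<in> V \<Longrightarrow> \<Phi> (G y) = y"
    and xV: "\<Phi> x \<in> V"
    using *(4,5) unfolding homeomorphism_def by auto
  have G: "Ck_on k V G" for k
    by (rule Ck_on_inverse_function[OF *(1,2) Ck_on_subset[OF smooth *(3)]]) (use GV G\<Phi> \<Phi>G inj' in auto)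
  \<comment> \<open>The image of \<open>v\<close> under the derivative of \<Phi>: its coordinate
    \<open>n\<close> becomes the derivative of \<open>u\<close> along \<open>v\<close>, which is
    0.\<close>
  define d where "d = v + (0 - v $ n) *\<^sub>R axis n 1"
  define c where "c t = G (\<Phi> x + t *\<^sub>R d)" for t
  have "open ((\<lambda>t. \<Phi> x + t *\<^sub>R d) -` V)"
    using *(2) by (intro open_vimage continuous_intros)
  moreover have "0 \<in> (\<lambda>t. \<Phi> x + t *\<^sub>R d) -` V" using xV by simp
  ultimately obtain \<epsilon> where \<epsilon>: "\<epsilon> > 0" "ball 0 \<epsilon> \<subseteq> (\<lambda>t. \<Phi> x + t *\<^sub>R d) -` V"
    using open_contains_ball by blast
  have inV: "\<Phi> x + t *\<^sub>R d \<in> V" if "t \<in> {-\<epsilon><..<\<epsilon>}" for t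
    using \<epsilon>(2) that by (auto simp: subset_iff dist_norm)
  have "Ck_on k {-\<epsilon><..<\<epsilon>} (\<lambda>t. \<Phi> x + t *\<^sub>R d)" for k
    by (intro Ck_on_add Ck_on_scaleR Ck_on_const Ck_on_id) auto
  then have "Ck_on k {-\<epsilon><..<\<epsilon>} c" for k
    unfolding c_def by (intro Ck_on_compose[OF _ *(2) _ _ G]) (use inV in auto)
  then have "smooth_on {-\<epsilon><..<\<epsilon>} c" by (simp add: smooth_on_def)
  moreover have "c ` {-\<epsilon><..<\<epsilon>} \<subseteq> {y \<in> U. u y = u x}"
  proof clarify
    fix t assume t: "t \<in> {-\<epsilon><..<\<epsilon>}"
    have cU: "c t \<in> U" unfolding c_def using inV[OF t] GV *(3) by auto
    have "u (c t) = \<Phi> (c t) $ n" by (simp add: \<Phi>_def)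
    also have "\<dots> = u x" unfolding c_def \<Phi>G[OF inV[OF t]] by (simp add: \<Phi>_def d_def)
    finally show "c t \<in> U \<and> u (c t) = u x" using cU by simp
  qed
  moreover have "c 0 = x" using G\<Phi> *(4) by (simp add: c_def)
  moreover have "(c has_vector_derivative v) (at 0)"
  proof -
    let ?G' = "frechet_derivative G (at (\<Phi> x))"
    have dG: "(G has_derivative ?G') (at (\<Phi> x))"
      by (rule Ck_on_has_derivative[OF G xV])
    have "((\<lambda>y. G (\<Phi> y)) has_derivative (\<lambda>h. ?G' (frechet_derivative \<Phi> (at x) h))) (at x)"
      using has_derivative_compose[OF Ck_on_has_derivative[OF smooth U(3)] dG] by simp
    then have "((\<lambda>y. y) has_derivative (\<lambda>h. ?G' (frechet_derivative \<Phi> (at x) h))) (at x)"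
      by (rule has_derivative_transform_within_open[OF _ *(1,4)]) (rule G\<Phi>)
    then have "(\<lambda>h. ?G' (frechet_derivative \<Phi> (at x) h)) = (\<lambda>h. h)"
      using has_derivative_unique[OF _ has_derivative_ident] by blast
    then have G'd: "?G' d = v" unfolding d_def using fd\<Phi>[of v] v by metis
    have "((\<lambda>t. \<Phi> x + t *\<^sub>R d) has_derivative (\<lambda>t. t *\<^sub>R d)) (at 0)"
      by (auto intro!: derivative_eq_intros)
    from has_derivative_compose[OF this, of G ?G'] dG
    have "(c has_derivative (\<lambda>t. ?G' (t *\<^sub>R d))) (at 0)" unfolding c_def by simp
    then show ?thesis unfolding has_vector_derivative_def
      by (simp add: linear_scale[OF has_derivative_linear[OF dG]] G'd)
  qed
  ultimately show ?thesis unfolding tangent_space_def using \<epsilon>(1) by blast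
qed

text \<open>With a negative derivative at each of its zeros, \<psi> can cross 0 only downward, so
  once negative it cannot come back.\<close>

lemma zero_crossing_downward:
  fixes \<psi> :: "real \<Rightarrow> real"
  assumes cont: "continuous_on {0..1} \<psi>" and "\<psi> 0 \<le> 0"
    and der: "\<And>t. t \<in> {0..1} \<Longrightarrow> \<psi> t = 0 \<Longrightarrow> \<exists>d<0. (\<psi> has_real_derivative d) (at t)"
    and t1: "t1 \<in> {0<..1}"
  shows "\<psi> t1 < 0"
proof (rule ccontr)
  assume "\<not> \<psi> t1 < 0"
  then have p1: "\<psi> t1 \<ge> 0" by simp
  \<comment> \<open>If \<psi> starts at 0, its negative derivative there gives a negative value
    immediately to the right.\<close>
  obtain s where s: "0 \<le> s" "s < t1" "\<psi> s < 0"
  proof (cases "\<psi> 0 < 0")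
    case True
    then show thesis using that[of 0] t1 by simp
  next
    case False
    then have z: "\<psi> 0 = 0" using assms(2) by simp
    then obtain d where "d < 0" "(\<psi> has_real_derivative d) (at 0)" using der[of 0] by auto
    then obtain e where e: "e > 0" "\<And>h. 0 < h \<Longrightarrow> h < e \<Longrightarrow> \<psi> (0 + h) < \<psi> 0"
      using DERIV_neg_dec_right by blast
    show thesis using that[of "min e t1 / 2"] e(1) e(2)[of "min e t1 / 2"] z t1 by auto
  qed
  have cont': "continuous_on {a..b} \<psi>" if "s \<le> a" "b \<le> t1" for a b
    using continuous_on_subset[OF cont] that s(1) t1 by auto
  let ?T = "{s..t1} \<inter> \<psi> -` {0}"
  have "?T \<noteq> {}"
    using IVT'[of \<psi> s 0 t1] s p1 cont'[of s t1] by fastforce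
  moreover have "closed ?T"
    using continuous_closed_preimage[OF cont'[of s t1] _ closed_singleton[of 0]] by simp
  moreover have "bdd_below ?T" by (rule bdd_belowI[of _ s]) auto
  ultimately have IT: "Inf ?T \<in> ?T" by (intro closed_contains_Inf)
  \<comment> \<open>The first zero after \<open>s\<close>. The negative derivative makes \<psi>
    positive just before it, and the intermediate value theorem then yields an earlier zero.\<close>
  define t0 where "t0 = Inf ?T"
  have t0: "s \<le> t0" "t0 \<le> t1" "\<psi> t0 = 0" using IT unfolding t0_def by auto
  then have st0: "s < t0" using s(3) by (metis less_irrefl order_le_less)
  obtain d where "d < 0" "(\<psi> has_real_derivative d) (at t0)" using der[of t0] t0 s t1 by auto
  then obtain e where e: "e > 0" "\<And>h. 0 < h \<Longrightarrow> h < e \<Longrightarrow> \<psi> t0 < \<psi> (t0 - h)"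
    using DERIV_neg_dec_left by blast
  define h where "h = min e (t0 - s) / 2"
  have h: "0 < h" "h < e" "s < t0 - h" using e(1) st0 by (auto simp: h_def min_def field_simps)
  have "\<psi> (t0 - h) > 0" using e(2)[OF h(1,2)] t0 by simp
  then obtain z where z: "s \<le> z" "z \<le> t0 - h" "\<psi> z = 0"
    using IVT'[of \<psi> s 0 "t0 - h"] s(3) h t0 cont'[of s "t0 - h"] by auto
  then have "z \<in> ?T" using h t0 by auto
  then have "t0 \<le> z" unfolding t0_def by (intro cInf_lower) auto
  then show False using z h by simp
qed

lemma open_orthant: "open (orthant :: (real^'l::finite) set)"
proof -
  have eq: "orthant = (\<Inter>j\<in>UNIV. {x :: real^'l. 0 < x $ j})" by (auto simp: orthant_def)
  show ?thesis
    unfolding eq by (intro open_INT ballI open_Collect_less continuous_intros) simp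
qed

lemma convex_orthant: "convex (orthant :: (real^'l::finite) set)"
  unfolding convex_alt orthant_def
proof clarsimp
  fix x y :: "real^'l" and t :: real and j
  assume *: "\<forall>j. 0 < x $ j" "\<forall>j. 0 < y $ j" "0 \<le> t" "t \<le> 1"
  show "0 < (1 - t) * x $ j + t * y $ j"
  proof (cases "t = 0")
    case False
    with * have "0 \<le> (1 - t) * x $ j" "0 < t * y $ j" by (simp_all add: less_imp_le)
    then show ?thesis by simp
  qed (use * in simp)
qed

lemma inner_orthant_pos:
  assumes "p \<in> orthant" "x \<in> orthant"
  shows "0 < p \<bullet> (x :: real^'l::finite)"
  unfolding inner_vec_def using assms by (intro sum_pos) (auto simp: orthant_def)

lemma inner_orthant_nonneg:
  assumes "p \<in> orthant" "\<And>j. 0 \<le> x $ j"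
  shows "0 \<le> p \<bullet> (x :: real^'l::finite)"
  unfolding inner_vec_def using assms by (intro sum_nonneg) (auto simp: orthant_def less_imp_le)

text \<open>The normalized price vector at which \<open>x\<close> satisfies the first order
  condition of utility maximization.\<close>

definition price_of :: "'l \<Rightarrow> (real^'l::finite \<Rightarrow> real) \<Rightarrow> real^'l \<Rightarrow> real^'l" where
  "price_of n u x = inverse (gradient u x $ n) *\<^sub>R gradient u x"

text \<open>The price vector with its redundant \<open>n\<close>-th coordinate \<open>1\<close> replaced by the income \<open>w\<close>.\<close>

definition price_income :: "'l \<Rightarrow> real^'l::finite \<Rightarrow> real \<Rightarrow> real^'l" where
  "price_income n p w = p + (w - 1) *\<^sub>R axis n 1"

section \<open>Strict quasi-concavity and utility maximization\<close>

locale smooth_consumer =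
  fixes u :: "real^'l::finite \<Rightarrow> real"
  assumes utility: "smooth_utility u"
begin

lemma Ck_u: "Ck_on k orthant u"
  using utility by (simp add: smooth_utility_def smooth_on_def)

lemma u_has_derivative: "x \<in> orthant \<Longrightarrow> (u has_derivative (\<lambda>h. gradient u x \<bullet> h)) (at x)"
proof -
  assume x: "x \<in> orthant"
  have d: "(u has_derivative frechet_derivative u (at x)) (at x)"
    by (rule Ck_on_has_derivative[OF Ck_u x])
  then have "frechet_derivative u (at x) = (\<lambda>h. gradient u x \<bullet> h)"
    using frechet_derivative_eq_gradient[of u x] by (auto simp: differentiable_def)
  with d show ?thesis by simp
qed

lemma frechet_u: "x \<in> orthant \<Longrightarrow> frechet_derivative u (at x) h = gradient u x \<bullet> h"
  by (rule fun_cong[OF frechet_derivative_at[OF u_has_derivative, symmetric]])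

lemma Ck_gradient: "Ck_on k orthant (gradient u)"
  by (rule Ck_on_gradient[OF open_orthant Ck_u])

lemma gradient_pos: "x \<in> orthant \<Longrightarrow> gradient u x \<in> orthant"
proof -
  assume x: "x \<in> orthant"
  then obtain g where g: "g \<in> orthant" "(u has_derivative (\<lambda>h. h \<bullet> g)) (at x)"
    using utility unfolding smooth_utility_def gderiv_def by blast
  have "axis j 1 \<bullet> g = gradient u x \<bullet> axis j 1" for j
    by (rule fun_cong[OF has_derivative_unique[OF g(2) u_has_derivative[OF x]]])
  then have "gradient u x = g" by (simp add: vec_eq_iff inner_axis inner_axis')
  with g show ?thesis by simp
qed

lemma gradient_nonzero: "x \<in> orthant \<Longrightarrow> gradient u x $ j \<noteq> 0"
  using gradient_pos[of x] by (simp add: orthant_def) (metis less_irrefl)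

lemma gradient_derivative_neg:
  assumes x: "x \<in> orthant" and v: "gradient u x \<bullet> v = 0" "v \<noteq> 0"
  shows "frechet_derivative (gradient u) (at x) v \<bullet> v < 0"
proof -
  have "v \<in> tangent_space (indifference_surface u (u x)) x"
    unfolding indifference_surface_def
    by (rule mem_tangent_space_level_set[OF open_orthant Ck_u x gradient_nonzero[OF x]]) (simp add: frechet_u[OF x] v)
  then have neg: "frechet_derivative (\<lambda>y. frechet_derivative u (at y) v) (at x) v < 0"
    using utility x v(2) unfolding smooth_utility_def by blast
  have "((\<lambda>y. gradient u y \<bullet> v) has_derivative (\<lambda>h. frechet_derivative (gradient u) (at x) h \<bullet> v)) (at x)"
    by (intro has_derivative_inner_left Ck_on_has_derivative[OF Ck_gradient x])
  then have "((\<lambda>y. frechet_derivative u (at y) v) has_derivative (\<lambda>h. frechet_derivative (gradient u) (at x) h \<bullet> v)) (at x)"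
    by (rule has_derivative_transform_within_open[OF _ open_orthant x]) (simp add: frechet_u)
  from fun_cong[OF frechet_derivative_at[OF this], of v] neg show ?thesis by simp
qed

lemma segment_in_orthant:
  assumes "x \<in> orthant" "y \<in> orthant" "0 \<le> t" "t \<le> 1"
  shows "x + t *\<^sub>R (y - x) \<in> orthant"
  using convex_orthant assms unfolding convex_alt by (auto simp: algebra_simps)

lemma u_along_line:
  assumes "x + t *\<^sub>R d \<in> orthant"
  shows "((\<lambda>t. u (x + t *\<^sub>R d)) has_real_derivative gradient u (x + t *\<^sub>R d) \<bullet> d) (at t)"
proof -
  have "((\<lambda>t. x + t *\<^sub>R d) has_derivative (\<lambda>s. s *\<^sub>R d)) (at t)"
    by (auto intro!: derivative_eq_intros)
  from has_derivative_compose[OF this u_has_derivative[OF assms]]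
  show ?thesis by (simp add: has_field_derivative_def mult_commute_abs mult.commute)
qed

lemma u_mean_value:
  assumes "x \<in> orthant" "y \<in> orthant"
  obtains t where "0 < t" "t < 1" "u y - u x = gradient u (x + t *\<^sub>R (y - x)) \<bullet> (y - x)"
proof -
  have "((\<lambda>t. u (x + t *\<^sub>R (y - x))) has_real_derivative gradient u (x + t *\<^sub>R (y - x)) \<bullet> (y - x)) (at t)"
    if "0 \<le> t" "t \<le> 1" for t
    by (rule u_along_line[OF segment_in_orthant[OF assms that]])
  from MVT2[of 0 1 "\<lambda>t. u (x + t *\<^sub>R (y - x))", OF _ this] that show thesis by auto
qed

text \<open>Passes from the infinitesimal to the global form of strict quasi-concavity. Where the
  slope of \<open>u\<close> along the segment vanishes, the segment is tangent to an indifference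
  surface, so the slope is decreasing there. Hence it is negative after the starting point.\<close>

lemma u_less_if_gradient_le:
  assumes x: "x \<in> orthant" and y: "y \<in> orthant" and "x \<noteq> y" and le: "gradient u x \<bullet> (y - x) \<le> 0"
  shows "u y < u x"
proof -
  let ?d = "y - x"
  let ?\<psi> = "\<lambda>t. gradient u (x + t *\<^sub>R ?d) \<bullet> ?d"
  have der: "(?\<psi> has_real_derivative frechet_derivative (gradient u) (at (x + t *\<^sub>R ?d)) ?d \<bullet> ?d) (at t)"
    if "0 \<le> t" "t \<le> 1" for t
  proof -
    let ?g' = "frechet_derivative (gradient u) (at (x + t *\<^sub>R ?d))"
    have d: "(gradient u has_derivative ?g') (at (x + t *\<^sub>R ?d))"
      by (rule Ck_on_has_derivative[OF Ck_gradient segment_in_orthant[OF x y that]])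
    have "((\<lambda>t. x + t *\<^sub>R ?d) has_derivative (\<lambda>s. s *\<^sub>R ?d)) (at t)"
      by (auto intro!: derivative_eq_intros)
    from has_derivative_inner_left[OF has_derivative_compose[OF this d], of ?d]
    have "(?\<psi> has_derivative (\<lambda>s. ?g' (s *\<^sub>R ?d) \<bullet> ?d)) (at t)" .
    then show ?thesis
      by (simp add: has_field_derivative_def linear_scale[OF has_derivative_linear[OF d]] mult_commute_abs)
  qed
  have neg: "?\<psi> t < 0" if "t \<in> {0<..1}" for t
  proof (rule zero_crossing_downward[OF _ _ _ that])
    show "continuous_on {0..1} ?\<psi>"
      using der by (intro DERIV_continuous_on[of "{0..1}" ?\<psi>]) (auto intro: has_field_derivative_at_within)
    show "gradient u (x + 0 *\<^sub>R ?d) \<bullet> ?d \<le> 0" using le by simp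
    fix t :: real assume t: "t \<in> {0..1}" "?\<psi> t = 0"
    then have "frechet_derivative (gradient u) (at (x + t *\<^sub>R ?d)) ?d \<bullet> ?d < 0"
      using assms by (intro gradient_derivative_neg segment_in_orthant) auto
    then show "\<exists>d<0. (?\<psi> has_real_derivative d) (at t)" using der t by auto
  qed
  obtain t where "0 < t" "t < 1" "u y - u x = ?\<psi> t" using u_mean_value[OF x y] .
  then show ?thesis using neg[of t] by simp
qed

lemma u_mono:
  assumes "x \<in> orthant" "y \<in> orthant" "\<And>j. x $ j \<le> y $ j"
  shows "u x \<le> u y"
proof -
  obtain t where t: "0 < t" "t < 1" "u y - u x = gradient u (x + t *\<^sub>R (y - x)) \<bullet> (y - x)"
    using u_mean_value[OF assms(1,2)] .
  moreover have "0 \<le> gradient u (x + t *\<^sub>R (y - x)) \<bullet> (y - x)"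
    using assms t by (intro inner_orthant_nonneg gradient_pos segment_in_orthant) auto
  ultimately show ?thesis by simp
qed

lemma continuous_u: "continuous_on orthant u"
  by (rule Ck_on_imp_continuous_on[OF Ck_u])

text \<open>Were a sequence of bundles at least as good as \<open>w\<close> to approach the boundary, then so would
  points of the indifference surface of \<open>w\<close> found between these bundles and their
  componentwise minima with \<open>w\<close>.\<close>

lemma closed_upper_contour:
  assumes w: "w \<in> orthant"
  shows "closed {x \<in> orthant. u w \<le> u x}"
proof (rule closed_sequential_limits[THEN iffD2], intro allI impI, elim conjE)
  fix X :: "nat \<Rightarrow> real^'l" and x
  assume X: "\<forall>k. X k \<in> {x \<in> orthant. u w \<le> u x}" and lim: "X \<longlonglongrightarrow> x"
  have limj: "(\<lambda>k. X k $ j) \<longlonglongrightarrow> x $ j" for j using lim by (rule tendsto_vec_nth)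
  show "x \<in> {x \<in> orthant. u w \<le> u x}"
  proof (cases "x \<in> orthant")
    case True
    then have "isCont u x" using continuous_u open_orthant continuous_on_eq_continuous_at by blast
    then have "(\<lambda>k. u (X k)) \<longlonglongrightarrow> u x" using isCont_tendsto_compose lim by blast
    then have "u w \<le> u x" using X by (intro LIMSEQ_le_const) auto
    with True show ?thesis by simp
  next
    case False
    then obtain j where j: "x $ j \<le> 0" by (auto simp: orthant_def not_less)
    have "\<exists>q. q \<in> orthant \<and> u q = u w \<and> (\<forall>j. q $ j \<le> X k $ j)" for k
    proof -
      have Xk: "X k \<in> orthant" "u w \<le> u (X k)" using X by auto
      define m where "m = (\<chi> j. min (X k $ j) (w $ j))"
      have m: "m \<in> orthant" "\<And>j. m $ j \<le> X k $ j" "\<And>j. m $ j \<le> w $ j"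
        using Xk w by (auto simp: m_def orthant_def)
      have "continuous_on {0..1} (\<lambda>t. u (m + t *\<^sub>R (X k - m)))"
        by (rule continuous_on_compose2[OF continuous_u])
          (use segment_in_orthant[OF m(1) Xk(1)] in \<open>auto intro!: continuous_intros\<close>)
      moreover have "u m \<le> u w" by (rule u_mono[OF m(1) w m(3)])
      ultimately obtain t where t: "0 \<le> t" "t \<le> 1" "u (m + t *\<^sub>R (X k - m)) = u w"
        using IVT'[of "\<lambda>t. u (m + t *\<^sub>R (X k - m))" 0 "u w" 1] Xk(2) by auto
      have "(m + t *\<^sub>R (X k - m)) $ j \<le> X k $ j" for j
        using mult_left_le_one_le[of "X k $ j - m $ j" t] t(1,2) m(2)[of j] by simp
      then show ?thesis using t segment_in_orthant[OF m(1) Xk(1)] by blast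
    qed
    then obtain q where q: "\<And>k. q k \<in> orthant" "\<And>k. u (q k) = u w" "\<And>k j. q k $ j \<le> X k $ j"
      by metis
    have "bounded (range X)" using lim convergent_imp_bounded by blast
    then obtain B where B: "\<And>k. norm (X k) \<le> B" by (auto simp: bounded_iff)
    have "norm (q k) \<le> B" for k
    proof -
      have "norm (q k) \<le> norm (X k)"
        by (rule norm_le_componentwise_cart) (use q(1,3) in \<open>auto simp: orthant_def intro!: order_trans[OF _ abs_ge_self] simp: less_imp_le\<close>)
      then show ?thesis using B order_trans by blast
    qed
    then have "bounded (range q)" by (auto simp: bounded_iff)
    then obtain z r where r: "strict_mono (r :: nat \<Rightarrow> nat)" "(q \<circ> r) \<longlonglongrightarrow> z"
      using bounded_imp_convergent_subsequence by blast
    have "closed (indifference_surface u (u w))" using utility by (simp add: smooth_utility_def)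
    moreover have "(q \<circ> r) k \<in> indifference_surface u (u w)" for k
      using q by (simp add: indifference_surface_def)
    ultimately have "z \<in> indifference_surface u (u w)" using r(2) closed_sequentially by blast
    then have "0 < z $ j" by (simp add: indifference_surface_def orthant_def)
    moreover have "z $ j \<le> x $ j"
    proof (rule LIMSEQ_le)
      show "(\<lambda>k. (q \<circ> r) k $ j) \<longlonglongrightarrow> z $ j" using r(2) by (rule tendsto_vec_nth)
      show "(\<lambda>k. X (r k) $ j) \<longlonglongrightarrow> x $ j"
        using LIMSEQ_subseq_LIMSEQ[OF limj r(1)] by (simp add: o_def)
    qed (use q(3) in auto)
    ultimately show ?thesis using j by simp
  qed
qed

text \<open>The budget set is not closed, as bundles must be strictly positive. Its part at least as
  good as \<open>w\<close> is closed by \<open>closed_upper_contour\<close> and bounded because all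
  prices are positive, and a maximizer there is a maximizer overall.\<close>

lemma budget_maximizer_exists:
  assumes p: "p \<in> orthant" and w: "w \<in> orthant"
  obtains x where "x \<in> orthant" "p \<bullet> x \<le> p \<bullet> w" "\<And>y. y \<in> orthant \<Longrightarrow> p \<bullet> y \<le> p \<bullet> w \<Longrightarrow> u y \<le> u x"
proof -
  let ?K = "{x \<in> orthant. u w \<le> u x} \<inter> {x. p \<bullet> x \<le> p \<bullet> w}"
  have "closed ?K"
    by (intro closed_Int closed_upper_contour w closed_Collect_le continuous_intros)
  moreover have "bounded ?K"
  proof -
    have "norm x \<le> (\<Sum>j\<in>UNIV. p \<bullet> w / p $ j)" if "x \<in> ?K" for x
    proof -
      have "\<bar>x $ j\<bar> \<le> p \<bullet> w / p $ j" for j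
      proof -
        have x: "0 < x $ i" "0 < p $ i" for i using that p by (auto simp: orthant_def)
        have "p $ j * x $ j \<le> p \<bullet> x"
          unfolding inner_vec_def using x by (auto intro!: member_le_sum simp: less_imp_le)
        then show ?thesis using that x[of j] by (simp add: field_simps)
      qed
      then show ?thesis using norm_le_l1_cart[of x] sum_mono order_trans by meson
    qed
    then show ?thesis unfolding bounded_iff by blast
  qed
  moreover have "w \<in> ?K" using w by simp
  moreover have "continuous_on ?K u" using continuous_u by (rule continuous_on_subset) auto
  ultimately obtain x where x: "x \<in> ?K" "\<And>y. y \<in> ?K \<Longrightarrow> u y \<le> u x"
    using continuous_attains_sup[of ?K u] compact_eq_bounded_closed by blast
  show thesis
  proof (rule that[of x])
    fix y assume "y \<in> orthant" "p \<bullet> y \<le> p \<bullet> w"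
    then show "u y \<le> u x" using x(1) x(2)[of y] by (cases "u w \<le> u y") auto
  qed (use x in auto)
qed

lemma budget_maximizer_first_order:
  assumes p: "p \<in> orthant" and x: "x \<in> orthant" "p \<bullet> x \<le> r"
    and max: "\<And>y. y \<in> orthant \<Longrightarrow> p \<bullet> y \<le> r \<Longrightarrow> u y \<le> u x"
  shows "p \<bullet> x = r" "gradient u x = (gradient u x $ n / p $ n) *\<^sub>R p"
proof -
  \<comment> \<open>At a maximizer \<open>u\<close> cannot increase in a direction that stays
    affordable for small positive t; positivity of the bundle is automatic since the orthant is
    open.\<close>
  have dir: "gradient u x \<bullet> d \<le> 0" if "eventually (\<lambda>t. p \<bullet> (x + t *\<^sub>R d) \<le> r) (at_right 0)" for d
  proof (rule ccontr)
    assume "\<not> gradient u x \<bullet> d \<le> 0"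
    then have "gradient u (x + 0 *\<^sub>R d) \<bullet> d > 0" by simp
    moreover have "((\<lambda>t. u (x + t *\<^sub>R d)) has_real_derivative gradient u (x + 0 *\<^sub>R d) \<bullet> d) (at 0)"
      by (rule u_along_line) (simp add: x)
    ultimately obtain e where e: "e > 0" "\<And>h. 0 < h \<Longrightarrow> h < e \<Longrightarrow> u (x + 0 *\<^sub>R d) < u (x + (0 + h) *\<^sub>R d)"
      using DERIV_pos_inc_right[of "\<lambda>t. u (x + t *\<^sub>R d)"] by blast
    have "((\<lambda>t. x + t *\<^sub>R d) \<longlongrightarrow> x + 0 *\<^sub>R d) (at_right 0)" by (intro tendsto_intros)
    then have "eventually (\<lambda>t. x + t *\<^sub>R d \<in> orthant) (at_right 0)"
      using topological_tendstoD[OF _ open_orthant] x by simp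
    moreover have "eventually (\<lambda>t. 0 < t \<and> t < e) (at_right 0)"
      unfolding eventually_at_right_field using e(1) by blast
    ultimately have "eventually (\<lambda>t. False) (at_right (0::real))"
      using that
    proof eventually_elim
      case (elim t)
      then show ?case using e(2)[of t] max[of "x + t *\<^sub>R d"] by auto
    qed
    then show False by simp
  qed
  show "p \<bullet> x = r"
  proof (rule ccontr)
    assume "p \<bullet> x \<noteq> r"
    then have lt: "p \<bullet> x < r" using x by simp
    have "((\<lambda>t. p \<bullet> (x + t *\<^sub>R p)) \<longlongrightarrow> p \<bullet> (x + 0 *\<^sub>R p)) (at_right 0)" by (intro tendsto_intros)
    then have "eventually (\<lambda>t. p \<bullet> (x + t *\<^sub>R p) < r) (at_right 0)"
      using order_tendstoD(2)[of _ "p \<bullet> x"] lt by simp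
    then have "gradient u x \<bullet> p \<le> 0" by (intro dir) (auto elim: eventually_mono)
    then show False using inner_orthant_pos[OF gradient_pos[OF x(1)] p] by simp
  qed
  have "gradient u x $ j * p $ n = gradient u x $ n * p $ j" for j
  proof -
    \<comment> \<open>A trade of good j against good n at market value 0, affordable in both
      directions.\<close>
    define d where "d = p $ n *\<^sub>R axis j 1 - p $ j *\<^sub>R (axis n 1 :: real^'l)"
    have pd: "p \<bullet> d = 0" by (simp add: d_def inner_diff_right inner_axis)
    have "gradient u x \<bullet> d' \<le> 0" if "p \<bullet> d' = 0" for d'
      by (rule dir) (simp add: inner_add_right that x)
    from this[of d] this[of "- d"] have "gradient u x \<bullet> d = 0" using pd by simp
    then show ?thesis by (simp add: d_def inner_diff_right inner_axis mult.commute)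
  qed
  moreover have "p $ n \<noteq> 0" using p by (auto simp: orthant_def dest: spec[of _ n])
  ultimately show "gradient u x = (gradient u x $ n / p $ n) *\<^sub>R p"
    by (simp add: vec_eq_iff field_simps)
qed

section \<open>Demand as the inverse of the price-income map\<close>

lemma price_of_nth: "x \<in> orthant \<Longrightarrow> price_of n u x $ n = 1"
  using gradient_nonzero by (simp add: price_of_def)

lemma price_of_orthant: "x \<in> orthant \<Longrightarrow> price_of n u x \<in> orthant"
  using gradient_pos[of x] by (auto simp: price_of_def orthant_def)

lemma gradient_eq: "x \<in> orthant \<Longrightarrow> gradient u x = gradient u x $ n *\<^sub>R price_of n u x"
  using gradient_nonzero by (simp add: price_of_def)

lemma u_less_in_budget:
  assumes "x \<in> orthant" "y \<in> orthant" "x \<noteq> y" "price_of n u x \<bullet> y \<le> price_of n u x \<bullet> x"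
  shows "u y < u x"
proof (rule u_less_if_gradient_le[OF assms(1-3)])
  have "gradient u x \<bullet> (y - x) = gradient u x $ n * (price_of n u x \<bullet> (y - x))"
    by (subst gradient_eq[OF assms(1), of n]) simp
  also have "\<dots> \<le> 0"
    using assms(4) gradient_pos[OF assms(1)]
    by (intro mult_nonneg_nonpos) (auto simp: orthant_def inner_diff_right less_imp_le)
  finally show "gradient u x \<bullet> (y - x) \<le> 0" .
qed

text \<open>At its own supporting price \<open>x\<close> is strictly better than every other
  affordable bundle, so it is the object that the definite description in \<open>demand\<close>
  denotes.\<close>

lemma demand_eqI:
  assumes x: "x \<in> orthant" and pr: "price_of n u x \<bullet> x = price_of n u x \<bullet> w"
  shows "demand u (price_of n u x) w = x"
  unfolding demand_def
proof (rule the_equality)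
  show "is_arg_max u (\<lambda>y. y \<in> orthant \<and> price_of n u x \<bullet> y \<le> price_of n u x \<bullet> w) x"
    unfolding is_arg_max_def using x pr u_less_in_budget[OF x, of _ n] by (metis less_irrefl less_trans order_refl)
  fix y assume y: "is_arg_max u (\<lambda>y. y \<in> orthant \<and> price_of n u x \<bullet> y \<le> price_of n u x \<bullet> w) y"
  show "y = x"
  proof (rule ccontr)
    assume "y \<noteq> x"
    then have "u y < u x" using y x pr u_less_in_budget[OF x, of y n] unfolding is_arg_max_def by auto
    then show False using y x pr unfolding is_arg_max_def by auto
  qed
qed

text \<open>Inverse demand: the price and the income at which \<open>x\<close> is demanded, packed
  into one vector so that domain and range have equal dimension.\<close>

abbreviation "dual n x \<equiv> price_income n (price_of n u x) (price_of n u x \<bullet> x)"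

lemma dual_in_orthant:
  assumes "x \<in> orthant"
  shows "dual n x \<in> orthant"
proof -
  have "0 < dual n x $ j" for j
    using price_of_orthant[OF assms, of n] price_of_nth[OF assms, of n] inner_orthant_pos[OF price_of_orthant[OF assms, of n] assms]
    by (cases "j = n") (auto simp: price_income_def orthant_def axis_def)
  then show ?thesis by (simp add: orthant_def)
qed

lemma dual_surj:
  assumes p: "p \<in> prices n" and r: "0 < r"
  obtains x where "x \<in> orthant" "price_of n u x = p" "p \<bullet> x = r"
proof -
  have p': "p \<in> orthant" "p $ n = 1" using p by (auto simp: prices_def)
  \<comment> \<open>Some endowment of market value \<open>r\<close>; the maximizer exists for
    endowments, whereas \<open>dual\<close> records only their value.\<close>
  define w where "w = (r / (p \<bullet> 1)) *\<^sub>R (1 :: real^'l)"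
  have p1: "p \<bullet> 1 > 0" using inner_orthant_pos[OF p'(1), of 1] by (simp add: orthant_def)
  have w: "w \<in> orthant" "p \<bullet> w = r" using r p1 by (auto simp: w_def orthant_def)
  obtain x where x: "x \<in> orthant" "p \<bullet> x \<le> p \<bullet> w" "\<And>y. y \<in> orthant \<Longrightarrow> p \<bullet> y \<le> p \<bullet> w \<Longrightarrow> u y \<le> u x"
    using budget_maximizer_exists[OF p'(1) w(1)] by blast
  note fo = budget_maximizer_first_order(1)[OF p'(1) x] budget_maximizer_first_order(2)[OF p'(1) x, of n]
  have "price_of n u x $ j = p $ j" for j
  proof -
    have "gradient u x $ j = gradient u x $ n * p $ j"
      using arg_cong[OF fo(2), of "\<lambda>v. v $ j"] p'(2) by simp
    then show ?thesis using gradient_nonzero[OF x(1), of n] by (simp add: price_of_def)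
  qed
  then have "price_of n u x = p" by (simp add: vec_eq_iff)
  with x(1) fo(1) w(2) show thesis by (intro that[of x]) auto
qed

text \<open>Two different bundles sharing price and income would each be strictly better than the
  other.\<close>

lemma dual_inj:
  assumes x: "x \<in> orthant" "y \<in> orthant" "dual n x = dual n y"
  shows "x = y"
proof -
  let ?px = "price_of n u x" and ?py = "price_of n u y"
  have comp: "?px $ j + (?px \<bullet> x - 1) * axis n 1 $ j = ?py $ j + (?py \<bullet> y - 1) * axis n 1 $ j" for j
    using arg_cong[OF x(3), of "\<lambda>v. v $ j"] by (simp add: price_income_def)
  have "?px $ j = ?py $ j" for j
    using comp[of j] price_of_nth[OF x(1), of n] price_of_nth[OF x(2), of n] by (cases "j = n") (auto simp: axis_def)
  then have p: "?px = ?py" by (simp add: vec_eq_iff)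
  have e: "?px \<bullet> x = ?py \<bullet> y" using comp[of n] p by (simp add: axis_def)
  show ?thesis
  proof (rule ccontr)
    assume "x \<noteq> y"
    then have "u y < u x" "u x < u y"
      using u_less_in_budget[OF x(1,2), of n] u_less_in_budget[OF x(2,1), of n] p e by auto
    then show False by simp
  qed
qed

lemma Ck_price_of: "Ck_on k orthant (price_of n u)"
proof -
  have "Ck_on k orthant (\<lambda>x. inverse (gradient u x $ n) *\<^sub>R gradient u x)"
    by (intro Ck_on_scaleR Ck_on_inverse Ck_on_vec_nth Ck_gradient open_orthant gradient_nonzero)
  then show ?thesis by (simp add: price_of_def[abs_def])
qed

lemma Ck_dual: "Ck_on k orthant (dual n)"
  unfolding price_income_def
  by (intro Ck_on_axis_update Ck_on_diff Ck_on_inner Ck_on_const Ck_on_id Ck_price_of open_orthant)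

text \<open>If \<open>h\<close> changes neither price nor income to first order, then
  \<open>h\<close> is orthogonal to the gradient, and the derivative of the gradient along
  \<open>h\<close> is a multiple of the price. The second derivative of \<open>u\<close> along the
  tangent vector \<open>h\<close> is then 0, against strict quasi-concavity unless \<open>h\<close>
  is 0.\<close>

lemma dual_derivative_inj:
  assumes x: "x \<in> orthant" and h: "frechet_derivative (dual n) (at x) h = 0"
  shows "h = 0"
proof (rule ccontr)
  assume "h \<noteq> 0"
  let ?a = "price_of n u" and ?g = "gradient u"
  let ?a' = "frechet_derivative ?a (at x)" and ?g' = "frechet_derivative ?g (at x)"
  have a': "(?a has_derivative ?a') (at x)" by (rule Ck_on_has_derivative[OF Ck_price_of x])
  have g': "(?g has_derivative ?g') (at x)" by (rule Ck_on_has_derivative[OF Ck_gradient x])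
  have "(dual n has_derivative (\<lambda>h. ?a' h + (?a x \<bullet> h + ?a' h \<bullet> x) *\<^sub>R axis n 1)) (at x)"
    unfolding price_income_def by (auto intro!: derivative_eq_intros a')
  from fun_cong[OF frechet_derivative_at[OF this], of h]
  have eq: "?a' h + (?a x \<bullet> h + ?a' h \<bullet> x) *\<^sub>R axis n 1 = 0" using h by simp
  have "((\<lambda>y. ?a y $ n) has_derivative (\<lambda>h. ?a' h $ n)) (at x)"
    by (rule bounded_linear.has_derivative[OF bounded_linear_vec_nth a'])
  then have "((\<lambda>y. 1) has_derivative (\<lambda>h. ?a' h $ n)) (at x)"
    by (rule has_derivative_transform_within_open[OF _ open_orthant x]) (simp add: price_of_nth)
  \<comment> \<open>Coordinate \<open>n\<close> of \<open>dual\<close> carries the income alone,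
    because the price there is constantly 1; this lets \<open>eq\<close> be split into its price
    part and its income part.\<close>
  then have an: "?a' h $ n = 0"
    using has_derivative_unique[OF _ has_derivative_const] by metis
  have "?a' h $ j = 0" for j
    using arg_cong[OF eq, of "\<lambda>v. v $ j"] an by (cases "j = n") (auto simp: axis_def)
  then have a0: "?a' h = 0" by (simp add: vec_eq_iff)
  then have ah: "?a x \<bullet> h = 0" using arg_cong[OF eq, of "\<lambda>v. v $ n"] by (simp add: axis_def)
  have "((\<lambda>y. ?g y $ n *\<^sub>R ?a y) has_derivative (\<lambda>h. ?g x $ n *\<^sub>R ?a' h + ?g' h $ n *\<^sub>R ?a x)) (at x)"
    by (intro has_derivative_scaleR a' bounded_linear.has_derivative[OF bounded_linear_vec_nth g'])
  then have "(?g has_derivative (\<lambda>h. ?g x $ n *\<^sub>R ?a' h + ?g' h $ n *\<^sub>R ?a x)) (at x)"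
    by (rule has_derivative_transform_within_open[OF _ open_orthant x]) (metis gradient_eq)
  from fun_cong[OF frechet_derivative_at[OF this], of h]
  have "?g' h = ?g' h $ n *\<^sub>R ?a x" using a0 by simp
  from arg_cong[OF this, of "\<lambda>v. v \<bullet> h"] have "?g' h \<bullet> h = 0" using ah by simp
  moreover have "?g x \<bullet> h = 0" by (subst gradient_eq[OF x, of n]) (simp add: ah)
  ultimately show False using gradient_derivative_neg[OF x _ \<open>h \<noteq> 0\<close>] by simp
qed

lemma price_income_recover:
  assumes "q \<in> (orthant :: (real^'l) set)"
  shows "q - (q $ n - 1) *\<^sub>R axis n 1 \<in> prices n" "price_income n (q - (q $ n - 1) *\<^sub>R axis n 1) (q $ n) = q"
  using assms by (auto simp: prices_def orthant_def axis_def price_income_def)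

text \<open>\<open>G\<close> inverts \<open>dual\<close>, a smooth bijection of the orthant onto
  itself with injective derivative. Demand depends on the endowment only through its value.\<close>

lemma smooth_demand:
  obtains G where "smooth_on orthant G" "G ` orthant \<subseteq> orthant"
    "\<And>p r. p \<in> prices n \<Longrightarrow> 0 < r \<Longrightarrow> p \<bullet> G (price_income n p r) = r"
    "\<And>p w. p \<in> prices n \<Longrightarrow> w \<in> orthant \<Longrightarrow> demand u p w = G (price_income n p (p \<bullet> w))"
proof -
  define G where "G = inv_into orthant (dual n)"
  have inj: "inj_on (dual n) orthant" using dual_inj by (auto intro: inj_onI)
  have im: "dual n ` orthant = orthant"
  proof
    show "dual n ` orthant \<subseteq> orthant" using dual_in_orthant by auto
    show "orthant \<subseteq> dual n ` orthant"
    proof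
      fix q :: "real^'l" assume q: "q \<in> orthant"
      then have "0 < q $ n" by (simp add: orthant_def)
      then obtain x where "x \<in> orthant" "price_of n u x = q - (q $ n - 1) *\<^sub>R axis n 1" "price_of n u x \<bullet> x = q $ n"
        using dual_surj[OF price_income_recover(1)[OF q]] by metis
      then show "q \<in> dual n ` orthant" using price_income_recover(2)[OF q] by (intro image_eqI[of _ _ x]) auto
    qed
  qed
  have G1: "G (dual n x) = x" if "x \<in> orthant" for x unfolding G_def by (rule inv_into_f_f[OF inj that])
  have G2: "dual n (G q) = q" "G q \<in> orthant" if "q \<in> orthant" for q
    unfolding G_def using im that f_inv_into_f[of q "dual n" orthant] inv_into_into[of q "dual n" orthant] by auto
  have Gx: "p \<bullet> G (price_income n p r) = r" "price_of n u (G (price_income n p r)) = p" "G (price_income n p r) \<in> orthant"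
    if pr: "p \<in> prices n" "0 < r" for p r
  proof -
    obtain x where x: "x \<in> orthant" "price_of n u x = p" "p \<bullet> x = r" using dual_surj[OF pr] .
    then have "G (price_income n p r) = x" using G1[of x] by simp
    then show "p \<bullet> G (price_income n p r) = r" "price_of n u (G (price_income n p r)) = p" "G (price_income n p r) \<in> orthant"
      using x by auto
  qed
  have "Ck_on k orthant G" for k
    by (rule Ck_on_inverse_function[OF open_orthant open_orthant Ck_dual])
      (use G1 G2 dual_derivative_inj in auto)
  then have "smooth_on orthant G" by (simp add: smooth_on_def)
  moreover have "demand u p w = G (price_income n p (p \<bullet> w))" if "p \<in> prices n" "w \<in> orthant" for p w
  proof -
    have "0 < p \<bullet> w" using that inner_orthant_pos by (auto simp: prices_def)
    note g = Gx[OF that(1) this]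
    show ?thesis using demand_eqI[OF g(3), of n w] g(1,2) by simp
  qed
  ultimately show thesis using that[of G] G2(2) Gx(1) by auto
qed

end

subsection \<open>The equilibrium manifold\<close>

lemma open_economies: "open (economies :: (real^'l::finite^'m::finite) set)"
proof -
  have eq: "(economies :: (real^'l^'m) set) = (\<Inter>i\<in>UNIV. (\<lambda>\<omega>. \<omega> $ i) -` orthant)" by (auto simp: economies_def)
  show ?thesis unfolding eq
    by (intro open_INT ballI open_vimage open_orthant continuous_intros) simp
qed

lemma bounded_linear_axis: "bounded_linear (axis i :: 'a::euclidean_space \<Rightarrow> 'a^'m::finite)"
  unfolding linear_conv_bounded_linear[symmetric]
  by (rule linearI) (auto simp: axis_def vec_eq_iff)

lemma frechet_derivative_natural_projection: "frechet_derivative natural_projection (at e) = snd"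
  unfolding natural_projection_def
  by (rule frechet_derivative_at[symmetric]) (simp add: bounded_linear_imp_has_derivative bounded_linear_snd)

lemma Ck_on_affine_line: "open I \<Longrightarrow> Ck_on k I (\<lambda>t::real. x + t *\<^sub>R v)"
  by (intro Ck_on_add Ck_on_scaleR Ck_on_const Ck_on_id)

lemma has_vector_derivative_affine_line: "((\<lambda>t::real. x + t *\<^sub>R v) has_vector_derivative v) (at t)"
  by (auto intro!: derivative_eq_intros)

lemma tangent_space_open:
  fixes S :: "'a::euclidean_space set"
  assumes "open S" "x \<in> S"
  shows "tangent_space S x = UNIV"
proof -
  have "v \<in> tangent_space S x" for v
  proof -
    have "open ((\<lambda>t. x + t *\<^sub>R v) -` S)" by (intro open_vimage assms(1) continuous_intros)
    moreover have "0 \<in> (\<lambda>t::real. x + t *\<^sub>R v) -` S" using assms(2) by simp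
    ultimately obtain \<epsilon> where "\<epsilon> > 0" "ball 0 \<epsilon> \<subseteq> (\<lambda>t. x + t *\<^sub>R v) -` S"
      using open_contains_ball by blast
    moreover have "{-\<epsilon><..<\<epsilon>} = ball 0 \<epsilon>" by (auto simp: dist_norm)
    ultimately have "0 < \<epsilon> \<and> smooth_on {-\<epsilon><..<\<epsilon>} (\<lambda>t. x + t *\<^sub>R v) \<and> (\<lambda>t. x + t *\<^sub>R v) ` {-\<epsilon><..<\<epsilon>} \<subseteq> S
        \<and> x + 0 *\<^sub>R v = x \<and> ((\<lambda>t. x + t *\<^sub>R v) has_vector_derivative v) (at 0)"
      using has_vector_derivative_affine_line[of x v 0] by (auto simp: smooth_on_def intro!: Ck_on_affine_line)
    then show ?thesis unfolding tangent_space_def by blast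
  qed
  then show ?thesis by blast
qed

lemma homotopic_with_canonI:
  fixes h :: "real \<times> 'a::topological_space \<Rightarrow> 'b::topological_space"
  assumes "continuous_on ({0..1} \<times> S) h" "\<And>t x. t \<in> {0..1} \<Longrightarrow> x \<in> S \<Longrightarrow> h (t, x) \<in> T"
    "\<And>x. x \<in> S \<Longrightarrow> h (0, x) = f x" "\<And>x. x \<in> S \<Longrightarrow> h (1, x) = g x"
  shows "homotopic_with_canon (\<lambda>x. True) S T f g"
  by (subst homotopic_with)
    (use assms in \<open>auto intro!: exI[of _ h] simp: continuous_map_in_subtopology\<close>)

section \<open>Walras' law and a square system for E\<close>

text \<open>\<open>G\<close> is demand as a function of price and income. Utilities enter from here
  on only through these three properties of it.\<close>

locale smooth_economy =
  fixes u :: "'m::finite \<Rightarrow> real^'l::finite \<Rightarrow> real" and n :: 'l and G :: "'m \<Rightarrow> real^'l \<Rightarrow> real^'l"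
  assumes Ck_G: "\<And>i k. Ck_on k orthant (G i)"
    and G_budget: "\<And>i p r. p \<in> prices n \<Longrightarrow> 0 < r \<Longrightarrow> p \<bullet> G i (price_income n p r) = r"
    and demand_G: "\<And>i p w. p \<in> prices n \<Longrightarrow> w \<in> orthant \<Longrightarrow> demand (u i) p w = G i (price_income n p (p \<bullet> w))"
begin

abbreviation "E \<equiv> equilibrium_manifold n u"

definition Dom :: "((real^'l) \<times> (real^'l^'m)) set" where
  "Dom = orthant \<times> economies"

text \<open>Lets \<open>agg\<close> be defined for all positive prices, an open set on which
  derivatives can be taken, while demand is evaluated at normalized prices only.\<close>

definition normalize_price :: "real^'l \<Rightarrow> real^'l" where
  "normalize_price p = p + (1 - p $ n) *\<^sub>R axis n 1"

definition agg :: "(real^'l) \<times> (real^'l^'m) \<Rightarrow> real^'l" where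
  "agg y = (\<Sum>i\<in>UNIV. G i (price_income n (normalize_price (fst y)) (normalize_price (fst y) \<bullet> snd y $ i)) - snd y $ i)"

text \<open>By Walras' law the equations \<open>Z y = 0\<close> are equivalent to \<open>p\<^sub>n = 1\<close> together with the
  market clearing conditions, so that a square system defines \<open>E\<close>.\<close>

definition Z :: "(real^'l) \<times> (real^'l^'m) \<Rightarrow> real^'l" where
  "Z y = agg y + (fst y $ n - 1) *\<^sub>R axis n 1"

lemma open_Dom: "open Dom"
  unfolding Dom_def by (intro open_Times open_orthant open_economies)

lemma normalize_price_in_prices: "p \<in> orthant \<Longrightarrow> normalize_price p \<in> prices n"
  by (auto simp: normalize_price_def prices_def orthant_def axis_def)

lemma normalize_price_id: "p $ n = 1 \<Longrightarrow> normalize_price p = p"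
  by (simp add: normalize_price_def)

lemma income_pos: "p \<in> prices n \<Longrightarrow> \<omega> \<in> economies \<Longrightarrow> 0 < p \<bullet> \<omega> $ i"
  by (intro inner_orthant_pos) (auto simp: prices_def economies_def)

lemma price_income_in_orthant:
  assumes "p \<in> prices n" "0 < r"
  shows "price_income n p r \<in> orthant"
proof -
  have "0 < price_income n p r $ j" for j
    using assms by (cases "j = n") (auto simp: price_income_def orthant_def axis_def prices_def)
  then show ?thesis by (simp add: orthant_def)
qed

lemma walras_agg:
  assumes "y \<in> Dom"
  shows "normalize_price (fst y) \<bullet> agg y = 0"
proof -
  have p: "normalize_price (fst y) \<in> prices n" using assms by (auto simp: Dom_def normalize_price_in_prices)
  have "snd y \<in> economies" using assms by (auto simp: Dom_def)
  then have "normalize_price (fst y) \<bullet> G i (price_income n (normalize_price (fst y)) (normalize_price (fst y) \<bullet> snd y $ i))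
      = normalize_price (fst y) \<bullet> snd y $ i" for i
    by (intro G_budget p income_pos)
  then show ?thesis by (simp add: agg_def inner_sum_right inner_diff_right)
qed

lemma walras_Z:
  assumes "y \<in> Dom"
  shows "normalize_price (fst y) \<bullet> Z y = fst y $ n - 1"
  using walras_agg[OF assms] by (simp add: Z_def inner_add_right inner_axis normalize_price_def)

lemma E_eq: "E = {y \<in> Dom. Z y = 0}"
proof -
  have "y \<in> E \<longleftrightarrow> y \<in> {y \<in> Dom. Z y = 0}" for y :: "(real^'l) \<times> (real^'l^'m)"
  proof -
    obtain p \<omega> where y: "y = (p, \<omega>)" by fastforce
    have ex: "excess_demand u p \<omega> = agg y" if "p \<in> prices n" "\<omega> \<in> economies"
      using that normalize_price_id[of p] unfolding excess_demand_def agg_def y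
      by (auto simp: demand_G economies_def prices_def)
    show "y \<in> E \<longleftrightarrow> y \<in> {y \<in> Dom. Z y = 0}"
    proof
      assume "y \<in> E"
      then have "p \<in> prices n" "\<omega> \<in> economies" "excess_demand u p \<omega> = 0"
        unfolding y equilibrium_manifold_def by auto
      then show "y \<in> {y \<in> Dom. Z y = 0}" using ex by (auto simp: Z_def y Dom_def prices_def)
    next
      assume *: "y \<in> {y \<in> Dom. Z y = 0}"
      then have "p $ n = 1" using walras_Z[of y] y by auto
      with * have "p \<in> prices n" "\<omega> \<in> economies" "agg y = 0" by (auto simp: y Dom_def prices_def Z_def)
      then show "y \<in> E" using ex by (simp add: y equilibrium_manifold_def)
    qed
  qed
  then show ?thesis by blast
qed

lemma E_subset_Dom: "y \<in> E \<Longrightarrow> y \<in> Dom"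
  by (simp add: E_eq)

lemma E_price: "y \<in> E \<Longrightarrow> fst y $ n = 1"
  by (auto simp: equilibrium_manifold_def prices_def)

lemma Ck_fst: "open U \<Longrightarrow> Ck_on k U fst"
  by (rule Ck_on_linear[OF bounded_linear_fst])

lemma Ck_snd: "open U \<Longrightarrow> Ck_on k U snd"
  by (rule Ck_on_linear[OF bounded_linear_snd])

lemma Ck_normalize_price: "Ck_on k Dom (\<lambda>y. normalize_price (fst y))"
  unfolding normalize_price_def
  by (intro Ck_on_axis_update Ck_on_diff Ck_on_const Ck_on_vec_nth Ck_fst open_Dom)

lemma Ck_agg: "Ck_on k Dom agg"
proof -
  have "Ck_on k Dom (\<lambda>y. G i (price_income n (normalize_price (fst y)) (normalize_price (fst y) \<bullet> snd y $ i)))" for i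
  proof (rule Ck_on_compose[OF open_Dom open_orthant _ _ Ck_G])
    show "(\<lambda>y. price_income n (normalize_price (fst y)) (normalize_price (fst y) \<bullet> snd y $ i)) ` Dom \<subseteq> orthant"
      by (auto simp: Dom_def intro!: price_income_in_orthant normalize_price_in_prices income_pos)
    show "Ck_on k Dom (\<lambda>y. price_income n (normalize_price (fst y)) (normalize_price (fst y) \<bullet> snd y $ i))"
      unfolding price_income_def
      by (intro Ck_on_axis_update Ck_on_diff Ck_on_const Ck_on_inner Ck_on_vec_nth Ck_snd Ck_normalize_price open_Dom)
  qed
  then have "Ck_on k Dom (\<lambda>y. \<Sum>i\<in>UNIV. G i (price_income n (normalize_price (fst y)) (normalize_price (fst y) \<bullet> snd y $ i)) - snd y $ i)"
    by (intro Ck_on_sum Ck_on_diff Ck_on_vec_nth Ck_snd open_Dom)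
  then show ?thesis by (simp add: agg_def[abs_def])
qed

lemma Ck_Z: "Ck_on k Dom Z"
proof -
  have "Ck_on k Dom (\<lambda>y. agg y + (fst y $ n - 1) *\<^sub>R axis n 1)"
    by (intro Ck_on_axis_update Ck_on_diff Ck_on_const Ck_on_vec_nth Ck_fst Ck_agg open_Dom)
  then show ?thesis by (simp add: Z_def[abs_def])
qed

abbreviation "DZ y \<equiv> frechet_derivative Z (at y)"

lemma Z_has_derivative: "y \<in> Dom \<Longrightarrow> (Z has_derivative DZ y) (at y)"
  by (rule Ck_on_has_derivative[OF Ck_Z])

lemma linear_DZ: "y \<in> Dom \<Longrightarrow> linear (DZ y)"
  by (rule has_derivative_linear[OF Z_has_derivative])

text \<open>Giving one consumer the aggregate excess demand leaves all incomes, hence all demands,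
  unchanged; this retracts a neighbourhood of \<open>E\<close> smoothly onto \<open>E\<close>.\<close>

definition retr :: "'m \<Rightarrow> (real^'l) \<times> (real^'l^'m) \<Rightarrow> (real^'l) \<times> (real^'l^'m)" where
  "retr k y = (normalize_price (fst y), snd y + axis k (agg y))"

lemma retr_in_E:
  assumes y: "y \<in> Dom" and pos: "snd (retr k y) \<in> economies"
  shows "retr k y \<in> E"
proof -
  let ?p = "normalize_price (fst y)"
  have p: "?p \<in> prices n" using y by (auto simp: Dom_def normalize_price_in_prices)
  then have pp: "normalize_price ?p = ?p" by (simp add: normalize_price_id prices_def)
  have income: "?p \<bullet> (snd y + axis k (agg y)) $ i = ?p \<bullet> snd y $ i" for i
    using walras_agg[OF y] by (auto simp: axis_def inner_add_right)
  have fs: "fst (retr k y) = ?p" "snd (retr k y) = snd y + axis k (agg y)" by (simp_all add: retr_def)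
  have "(\<Sum>i\<in>UNIV. axis k (agg y) $ i) = agg y"
    by (simp add: axis_def)
  then have S1: "(\<Sum>i\<in>UNIV. (snd y + axis k (agg y)) $ i) = (\<Sum>i\<in>UNIV. snd y $ i) + agg y"
    by (simp add: sum.distrib)
  have S2: "(\<Sum>i\<in>UNIV. G i (price_income n ?p (?p \<bullet> snd y $ i))) = (\<Sum>i\<in>UNIV. snd y $ i) + agg y"
    by (simp add: agg_def sum_subtractf)
  have "agg (retr k y) = (\<Sum>i\<in>UNIV. G i (price_income n ?p (?p \<bullet> snd y $ i))) - (\<Sum>i\<in>UNIV. (snd y + axis k (agg y)) $ i)"
    unfolding agg_def[of "retr k y"] fs pp income by (simp only: sum_subtractf)
  also have "\<dots> = 0" unfolding S1 S2 by simp
  finally have "agg (retr k y) = 0" .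
  then show ?thesis using p pos by (auto simp: E_eq Z_def Dom_def retr_def prices_def)
qed

section \<open>Tangent spaces of E\<close>

text \<open>Differentiating Walras' law \<open>walras_Z\<close> at a zero of \<open>Z\<close>, where
  the term with the derivative of the price drops out, gives the first claim; the definition of
  \<open>Z\<close> then gives the second.\<close>

lemma Z_derivative_zeroD:
  assumes y: "y \<in> E" and v: "DZ y v = 0"
  shows "fst v $ n = 0" "frechet_derivative agg (at y) v = 0"
proof -
  have yD: "y \<in> Dom" and Zy: "Z y = 0" using y by (auto simp: E_eq)
  let ?np' = "frechet_derivative (\<lambda>y. normalize_price (fst y)) (at y)"
  have np: "((\<lambda>y. normalize_price (fst y)) has_derivative ?np') (at y)"
    by (rule Ck_on_has_derivative[OF Ck_normalize_price yD])
  have nth: "((\<lambda>y::(real^'l) \<times> (real^'l^'m). fst y $ n) has_derivative (\<lambda>v. fst v $ n)) (at y)"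
    by (intro bounded_linear.has_derivative[OF bounded_linear_vec_nth] has_derivative_fst has_derivative_ident)
  have "((\<lambda>y. normalize_price (fst y) \<bullet> Z y) has_derivative
      (\<lambda>v. normalize_price (fst y) \<bullet> DZ y v + ?np' v \<bullet> Z y)) (at y)"
    by (intro has_derivative_inner np Z_has_derivative yD)
  then have "((\<lambda>y. fst y $ n - 1) has_derivative (\<lambda>v. normalize_price (fst y) \<bullet> DZ y v + ?np' v \<bullet> Z y)) (at y)"
    by (rule has_derivative_transform_within_open[OF _ open_Dom yD]) (rule walras_Z)
  moreover have "((\<lambda>y::(real^'l) \<times> (real^'l^'m). fst y $ n - 1) has_derivative (\<lambda>v. fst v $ n)) (at y)"
    using has_derivative_diff[OF nth has_derivative_const[of 1]] by simp
  ultimately have "(\<lambda>v. normalize_price (fst y) \<bullet> DZ y v + ?np' v \<bullet> Z y) = (\<lambda>v. fst v $ n)"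
    by (rule has_derivative_unique)
  from fun_cong[OF this, of v] show vn: "fst v $ n = 0" using v Zy by simp
  have "((\<lambda>y. agg y + (fst y $ n - 1) *\<^sub>R axis n 1) has_derivative
      (\<lambda>v. frechet_derivative agg (at y) v + fst v $ n *\<^sub>R axis n 1)) (at y)"
    by (intro has_derivative_add Ck_on_has_derivative[OF Ck_agg yD] has_derivative_scaleR_left)
      (use has_derivative_diff[OF nth has_derivative_const[of 1]] in simp)
  then have "(Z has_derivative (\<lambda>v. frechet_derivative agg (at y) v + fst v $ n *\<^sub>R axis n 1)) (at y)"
    by (simp add: Z_def[abs_def])
  from fun_cong[OF has_derivative_unique[OF this Z_has_derivative[OF yD]], of v] v vn
  show "frechet_derivative agg (at y) v = 0" by simp
qed

text \<open>\<open>Z\<close> is constant along curves in E, which gives one inclusion. For the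
  other, the line through \<open>y\<close> with velocity \<open>v\<close> is pushed into E by
  \<open>retr k\<close>, whose derivative at \<open>y\<close> fixes the kernel of
  \<open>DZ y\<close> pointwise.\<close>

lemma tangent_space_E:
  assumes y: "y \<in> E"
  shows "tangent_space E y = {v. DZ y v = 0}"
proof (intro subset_antisym subsetI)
  have yD: "y \<in> Dom" using y by (rule E_subset_Dom)
  fix v assume "v \<in> tangent_space E y"
  then obtain c \<epsilon> where c: "0 < \<epsilon>" "c ` {-\<epsilon><..<\<epsilon>} \<subseteq> E" "c 0 = y" "(c has_vector_derivative v) (at 0)"
    unfolding tangent_space_def by blast
  have dZc: "((\<lambda>t. Z (c t)) has_derivative (\<lambda>s. DZ y (s *\<^sub>R v))) (at 0)"
    using has_derivative_compose[OF c(4)[unfolded has_vector_derivative_def]] Z_has_derivative[OF yD] c(3) by blast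
  have "Z (c t) = 0" if "t \<in> {-\<epsilon><..<\<epsilon>}" for t
    using c(2) that by (auto simp: image_subset_iff E_eq)
  then have "((\<lambda>t. 0) has_derivative (\<lambda>s. DZ y (s *\<^sub>R v))) (at (0::real))"
    by (intro has_derivative_transform_within_open[OF dZc, of "{-\<epsilon><..<\<epsilon>}"]) (use c(1) in auto)
  from fun_cong[OF has_derivative_unique[OF this has_derivative_const], of 1]
  show "v \<in> {v. DZ y v = 0}" by simp
next
  have yD: "y \<in> Dom" using y by (rule E_subset_Dom)
  fix v assume "v \<in> {v. DZ y v = 0}"
  then have v: "DZ y v = 0" by simp
  note vn = Z_derivative_zeroD[OF y v]
  fix k :: 'm
  have Ck_retr2: "Ck_on j Dom (\<lambda>y. snd y + axis k (agg y))" for j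
    by (rule Ck_on_add[OF open_Dom Ck_snd[OF open_Dom]
          Ck_on_bounded_linear[OF bounded_linear_axis open_Dom Ck_agg]])
  have inl: "bounded_linear (\<lambda>p. (p, 0) :: (real^'l) \<times> (real^'l^'m))"
    and inr: "bounded_linear (\<lambda>p. (0, p) :: (real^'l) \<times> (real^'l^'m))"
    by (intro bounded_linear_Pair bounded_linear_ident bounded_linear_zero)+
  have retr_eq: "retr k = (\<lambda>y. (normalize_price (fst y), 0) + (0, snd y + axis k (agg y)))"
    by (simp add: retr_def[abs_def])
  have Ck_retr: "Ck_on j Dom (retr k)" for j
    unfolding retr_eq
    by (intro Ck_on_add Ck_on_bounded_linear[OF inl] Ck_on_bounded_linear[OF inr] Ck_normalize_price Ck_retr2 open_Dom)
  have retr_y: "retr k y = y"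
    using y E_price[OF y] by (auto simp: retr_def normalize_price_id E_eq Z_def prod_eq_iff axis_def vec_eq_iff)
  \<comment> \<open>On this set the endowments adjusted by \<open>retr k\<close> are still positive,
    so \<open>retr k\<close> has its values in E.\<close>
  let ?O = "Dom \<inter> (\<lambda>y. snd y + axis k (agg y)) -` economies"
  have openO: "open ?O"
    using continuous_open_preimage[OF Ck_on_imp_continuous_on[OF Ck_retr2] open_Dom open_economies] .
  have "snd y + axis k (agg y) = snd y" using arg_cong[OF retr_y, of snd] by (simp only: retr_def snd_conv)
  then have "snd y + axis k (agg y) \<in> economies" using yD by (simp only: Dom_def mem_Times_iff)
  then have "y \<in> ?O" using yD by (simp only: Int_iff vimage_eq simp_thms)
  then have 0: "0 \<in> (\<lambda>t::real. y + t *\<^sub>R v) -` ?O" by simp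
  have "open ((\<lambda>t::real. y + t *\<^sub>R v) -` ?O)" by (intro open_vimage openO continuous_intros)
  then obtain \<epsilon> where \<epsilon>: "\<epsilon> > 0" "ball 0 \<epsilon> \<subseteq> (\<lambda>t. y + t *\<^sub>R v) -` ?O"
    using open_contains_ball 0 by blast
  have inO: "y + t *\<^sub>R v \<in> ?O" if "t \<in> {-\<epsilon><..<\<epsilon>}" for t
    using \<epsilon>(2) that by (auto simp: subset_iff dist_norm)
  define c where "c t = retr k (y + t *\<^sub>R v)" for t
  have "smooth_on {-\<epsilon><..<\<epsilon>} c"
    unfolding smooth_on_def c_def
  proof
    show "Ck_on j {-\<epsilon><..<\<epsilon>} (\<lambda>t. retr k (y + t *\<^sub>R v))" for j
      by (rule Ck_on_compose[OF _ open_Dom _ Ck_on_affine_line Ck_retr]) (use inO in auto)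
  qed
  moreover have "c ` {-\<epsilon><..<\<epsilon>} \<subseteq> E"
  proof (rule image_subsetI)
    fix t assume "t \<in> {-\<epsilon><..<\<epsilon>}"
    from inO[OF this] show "c t \<in> E"
      unfolding c_def by (intro retr_in_E) (simp_all add: retr_def)
  qed
  moreover have "c 0 = y" by (simp add: c_def retr_y)
  moreover have "(c has_vector_derivative v) (at 0)"
  proof -
    have n': "((\<lambda>y::(real^'l) \<times> (real^'l^'m). normalize_price (fst y)) has_derivative (\<lambda>v. fst v + (- fst v $ n) *\<^sub>R axis n 1)) (at y)"
      unfolding normalize_price_def
      by (auto intro!: derivative_eq_intros bounded_linear.has_derivative[OF bounded_linear_vec_nth])
    have "(retr k has_derivative (\<lambda>v. (fst v + (- fst v $ n) *\<^sub>R axis n 1,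
        snd v + axis k (frechet_derivative agg (at y) v)))) (at y)"
      unfolding retr_def[abs_def]
      by (intro has_derivative_Pair n' has_derivative_add has_derivative_snd has_derivative_ident
          bounded_linear.has_derivative[OF bounded_linear_axis]
          Ck_on_has_derivative[OF Ck_agg yD])
    then have r: "(retr k has_derivative (\<lambda>v. (fst v + (- fst v $ n) *\<^sub>R axis n 1,
        snd v + axis k (frechet_derivative agg (at y) v)))) (at (y + 0 *\<^sub>R v))" (is "(_ has_derivative ?R) _") by simp
    have lin: "linear ?R" using has_derivative_linear[OF r] .
    have Rv: "?R v = v" using vn by (simp add: axis_def vec_eq_iff prod_eq_iff)
    have "(c has_derivative (\<lambda>t. ?R (t *\<^sub>R v))) (at 0)"
      unfolding c_def using has_derivative_compose[OF has_vector_derivative_affine_line[unfolded has_vector_derivative_def] r] .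
    moreover have "?R (t *\<^sub>R v) = t *\<^sub>R v" for t
      by (rule trans[OF linear_scale[OF lin, of t v] arg_cong[OF Rv, of "\<lambda>x. t *\<^sub>R x"]])
    ultimately show ?thesis unfolding has_vector_derivative_def by simp
  qed
  ultimately show "v \<in> tangent_space E y" unfolding tangent_space_def using \<epsilon>(1) by blast
qed

lemma tangent_space_economies: "y \<in> Dom \<Longrightarrow> tangent_space economies (snd y) = (UNIV :: (real^'l^'m) set)"
  by (intro tangent_space_open open_economies) (auto simp: Dom_def)

section \<open>Regular equilibria\<close>

text \<open>All coordinates of the price are varied, including coordinate \<open>n\<close>; the
  matrix is square because \<open>Z\<close> contains the normalization of the price.\<close>

definition price_jacobian :: "(real^'l) \<times> (real^'l^'m) \<Rightarrow> real^'l^'l" where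
  "price_jacobian y = matrix (\<lambda>q. DZ y (q, 0))"

lemma linear_DZ_price: "y \<in> Dom \<Longrightarrow> linear (\<lambda>q. DZ y (q, 0))"
proof -
  assume "y \<in> Dom"
  have "linear (\<lambda>q::real^'l. (q, 0::real^'l^'m))" by (rule linearI) auto
  from linear_compose[OF this linear_DZ[OF \<open>y \<in> Dom\<close>]] show ?thesis by (simp add: o_def)
qed

lemma price_jacobian_works: "y \<in> Dom \<Longrightarrow> price_jacobian y *v q = DZ y (q, 0)"
  unfolding price_jacobian_def using linear_DZ_price by (simp add: matrix_works)

lemma DZ_split: "y \<in> Dom \<Longrightarrow> DZ y (q, \<eta>) = DZ y (q, 0) + DZ y (0, \<eta>)"
  using linear_add[OF linear_DZ, of y "(q, 0)" "(0, \<eta>)"] by simp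

lemma price_jacobian_inj:
  assumes "y \<in> Dom" "det (price_jacobian y) \<noteq> 0" "DZ y (q, 0) = 0"
  shows "q = 0"
  using assms det_nz_iff_inj[OF linear_DZ_price[OF assms(1)]] linear_injective_0[OF linear_DZ_price[OF assms(1)]]
  unfolding price_jacobian_def by blast

text \<open>When the price part of \<open>DZ y\<close> is invertible, every variation of endowments
  determines exactly one variation of the price that keeps \<open>DZ y\<close> at 0.\<close>

lemma regular_equilibriumI:
  assumes y: "y \<in> E" and det: "det (price_jacobian y) \<noteq> 0"
  shows "regular_equilibrium n u y"
proof -
  have yD: "y \<in> Dom" using y by (rule E_subset_Dom)
  have "inj_on snd {v. DZ y v = 0}"
  proof (rule inj_onI)
    fix v w assume "v \<in> {v. DZ y v = 0}" "w \<in> {v. DZ y v = 0}" "snd v = snd w"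
    then have "DZ y (fst v - fst w, 0) = 0"
      using linear_diff[OF linear_DZ[OF yD], of v w] by (simp add: minus_prod_def)
    then show "v = w" using price_jacobian_inj[OF yD det, of "fst v - fst w"] \<open>snd v = snd w\<close> by (simp add: prod_eq_iff)
  qed
  moreover have "snd ` {v. DZ y v = 0} = (UNIV :: (real^'l^'m) set)"
  proof -
    have "\<eta> \<in> snd ` {v. DZ y v = 0}" for \<eta> :: "real^'l^'m"
    proof -
      have "surj (\<lambda>q. DZ y (q, 0))"
        using det det_nz_iff_inj[OF linear_DZ_price[OF yD]] linear_injective_imp_surjective[OF linear_DZ_price[OF yD]]
        unfolding price_jacobian_def by blast
      then obtain q where "- DZ y (0, \<eta>) = DZ y (q, 0)" by (rule surjE)
      then have "DZ y (q, \<eta>) = 0" using DZ_split[OF yD, of q \<eta>] by (metis add.left_inverse)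
      then show ?thesis by force
    qed
    then show ?thesis by blast
  qed
  ultimately show ?thesis
    unfolding regular_equilibrium_def frechet_derivative_natural_projection
    using y by (simp add: natural_projection_def bij_betw_def tangent_space_E[OF y] tangent_space_economies[OF yD])
qed

text \<open>The map \<Psi> with components \<open>Z\<close> and \<omega> is locally invertible at
  \<open>y\<close>, and its inverse restricted to the points with first component 0 is a continuous
  selection of equilibria.\<close>

lemma not_crisis_if_regular:
  assumes y: "y \<in> E" and det: "det (price_jacobian y) \<noteq> 0"
  shows "y \<notin> crisis_transitions n u"
proof -
  have yD: "y \<in> Dom" using y by (rule E_subset_Dom)
  define \<Psi> where "\<Psi> y = (Z y, snd y)" for y
  have d\<Psi>: "(\<Psi> has_derivative (\<lambda>v. (DZ x v, snd v))) (at x)" if "x \<in> Dom" for x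
    unfolding \<Psi>_def by (intro has_derivative_Pair Z_has_derivative that has_derivative_snd has_derivative_ident)
  have Ck\<Psi>: "Ck_on (Suc 0) Dom \<Psi>"
  proof (rule Ck_on_SucI[OF open_Dom d\<Psi>])
    fix v
    have "continuous_on Dom (\<lambda>x. DZ x v)" using Ck_Z[of "Suc 0"] by (simp del: split_paired_All)
    then show "Ck_on 0 Dom (\<lambda>x. (DZ x v, snd v))" by (auto intro!: continuous_intros)
  qed
  have inj: "h = 0" if h: "frechet_derivative \<Psi> (at y) h = 0" for h
  proof -
    have "(DZ y h, snd h) = 0" using fun_cong[OF frechet_derivative_at[OF d\<Psi>[OF yD]], of h] h by simp
    then have h0: "DZ y h = 0" "snd h = 0" by (simp_all add: zero_prod_def)
    then have "h = (fst h, 0)" by (simp add: prod_eq_iff)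
    then have "DZ y (fst h, 0) = 0" using h0(1) by simp
    then show ?thesis using price_jacobian_inj[OF yD det] h0(2) by (simp add: prod_eq_iff)
  qed
  obtain U' V g where *: "open U'" "open V" "U' \<subseteq> Dom" "y \<in> U'" "homeomorphism U' V \<Psi> g"
    by (rule Ck_on_local_inverse[OF open_Dom Ck\<Psi> yD], erule inj) (rule that; assumption)
  define U where "U = {\<omega>. (0, \<omega>) \<in> V}"
  define p where "p \<omega> = fst (g (0, \<omega>))" for \<omega>
  have gV: "g ` V = U'" "\<And>x. x \<in> U' \<Longrightarrow> g (\<Psi> x) = x" "\<And>z. z \<in> V \<Longrightarrow> \<Psi> (g z) = z" "continuous_on V g" "\<Psi> y \<in> V"
    using *(4,5) unfolding homeomorphism_def by auto
  have \<Psi>y: "\<Psi> y = (0, snd y)" using y by (simp add: \<Psi>_def E_eq)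
  have eq: "(p \<omega>, \<omega>) \<in> E" if "\<omega> \<in> U" for \<omega>
  proof -
    have V: "(0, \<omega>) \<in> V" using that by (simp add: U_def)
    have g: "g (0, \<omega>) \<in> Dom" using gV(1) V *(3) by blast
    have "\<Psi> (g (0, \<omega>)) = (0, \<omega>)" using gV(3)[OF V] .
    then have "Z (g (0, \<omega>)) = 0" "g (0, \<omega>) = (p \<omega>, \<omega>)" by (auto simp: \<Psi>_def p_def prod_eq_iff)
    with g show ?thesis by (simp add: E_eq)
  qed
  have "open ((\<lambda>\<omega>. (0, \<omega>)) -` V)" by (intro open_vimage *(2) continuous_intros)
  then have "open U" by (simp add: U_def vimage_def)
  moreover have "snd y \<in> U" using gV(5) \<Psi>y by (simp add: U_def)
  moreover have "U \<subseteq> economies" using eq by (auto simp: equilibrium_manifold_def)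
  moreover have "continuous_on U p"
    unfolding p_def
    by (intro continuous_on_fst continuous_on_compose2[OF gV(4)] continuous_intros) (auto simp: U_def)
  moreover have "p (snd y) = fst y" using gV(2)[OF *(4)] \<Psi>y by (simp add: p_def)
  ultimately show ?thesis using eq unfolding crisis_transitions_def by (auto simp: case_prod_beta)
qed

section \<open>Local structure of E away from the crises\<close>

text \<open>\<open>coords k\<close> is injective on \<open>E\<close>: it determines prices and incomes, hence demands, and the
  endowment of the remaining consumer \<open>k\<close> by market clearing.\<close>

definition coords :: "'m \<Rightarrow> (real^'l) \<times> (real^'l^'m) \<Rightarrow> real^'l^'m" where
  "coords k y = (\<chi> i. (if i = k then fst y else snd y $ i)
     + (fst y \<bullet> snd y $ i - (if i = k then fst y else snd y $ i) $ n) *\<^sub>R axis n 1)"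

lemma inj_on_coords: "inj_on (coords k) E"
proof (rule inj_onI)
  fix y z assume y: "y \<in> E" and z: "z \<in> E" and eq: "coords k y = coords k z"
  have yn: "fst y $ n = 1" "fst z $ n = 1" using y z E_price by auto
  have comp: "(if i = k then fst y else snd y $ i) $ j
     + (fst y \<bullet> snd y $ i - (if i = k then fst y else snd y $ i) $ n) * axis n 1 $ j
     = (if i = k then fst z else snd z $ i) $ j
     + (fst z \<bullet> snd z $ i - (if i = k then fst z else snd z $ i) $ n) * axis n 1 $ j" for i j
    using arg_cong[OF eq, of "\<lambda>v. v $ i $ j"] by (simp add: coords_def)
  have "fst y $ j = fst z $ j" for j
    using comp[of k j] yn by (cases "j = n") (auto simp: axis_def)
  then have p: "fst y = fst z" by (simp add: vec_eq_iff)
  have inc: "fst y \<bullet> snd y $ i = fst y \<bullet> snd z $ i" for i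
    using comp[of i n] p by (auto simp: axis_def)
  have rest: "snd y $ i = snd z $ i" if "i \<noteq> k" for i
  proof -
    define d where "d = snd y $ i - snd z $ i"
    have dj: "d $ j = 0" if "j \<noteq> n" for j using comp[of i j] \<open>i \<noteq> k\<close> that by (simp add: d_def axis_def)
    then have "d = d $ n *\<^sub>R axis n 1" by (simp add: vec_eq_iff axis_def)
    moreover have "fst y \<bullet> d = 0" using inc[of i] by (simp add: d_def inner_diff_right)
    ultimately have "d $ n * fst y $ n = 0" by (metis inner_axis inner_real_def inner_scaleR_right mult.right_neutral)
    then have "d $ n = 0" using yn by simp
    then have "d = 0" using dj by (metis vec_eq_iff zero_index)
    then show ?thesis by (simp add: d_def)
  qed
  have "agg y = 0" "agg z = 0" using y z yn by (auto simp: E_eq Z_def)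
  then have "(\<Sum>i\<in>UNIV. snd y $ i) = (\<Sum>i\<in>UNIV. snd z $ i)"
    using p inc unfolding agg_def normalize_price_id[OF yn(1)] normalize_price_id[OF yn(2)] sum_subtractf by simp
  then have "snd y $ k = snd z $ k"
    using rest by (simp add: sum.remove[of UNIV k])
  then have "snd y = snd z" using rest by (metis vec_eq_iff)
  with p show "y = z" by (simp add: prod_eq_iff)
qed

lemma continuous_on_coords: "continuous_on S (coords k)"
proof -
  have "continuous_on S (\<lambda>y. (if i = k then fst y else snd y $ i)
     + (fst y \<bullet> snd y $ i - (if i = k then fst y else snd y $ i) $ n) *\<^sub>R axis n 1)" for i
    by (cases "i = k") (auto intro!: continuous_intros)
  then show ?thesis unfolding coords_def by (rule continuous_on_vec_lambda)
qed

text \<open>The new point is that the graph of the selection is open in E. Following the selection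
  by \<open>coords k\<close> gives a continuous injection of an open set of economies into the same
  Euclidean space, with open image by invariance of domain; injectivity of \<open>coords k\<close>
  on E pulls this back to E.\<close>

lemma not_crisisD:
  assumes y: "y \<in> E - crisis_transitions n u"
  obtains U p where "open U" "snd y \<in> U" "continuous_on U p" "p (snd y) = fst y"
    "\<And>\<omega>. \<omega> \<in> U \<Longrightarrow> (p \<omega>, \<omega>) \<in> E" "openin (top_of_set E) ((\<lambda>\<omega>. (p \<omega>, \<omega>)) ` U)"
proof -
  obtain U p where U: "open U" "snd y \<in> U" "continuous_on U p" "p (snd y) = fst y"
    "\<And>\<omega>. \<omega> \<in> U \<Longrightarrow> (p \<omega>, \<omega>) \<in> E"
    using y unfolding crisis_transitions_def by (auto simp: case_prod_beta)
  \<comment> \<open>Any consumer may be the one whose endowment \<open>coords\<close> leaves to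
    market clearing.\<close>
  fix k :: 'm
  let ?s = "\<lambda>\<omega>. (p \<omega>, \<omega>)"
  have "open ((\<lambda>\<omega>. coords k (?s \<omega>)) ` U)"
  proof (rule invariance_of_domain)
    show "continuous_on U (\<lambda>\<omega>. coords k (?s \<omega>))"
      by (rule continuous_on_compose2[OF continuous_on_coords[of UNIV]]) (auto intro!: continuous_intros U(3))
    show "inj_on (\<lambda>\<omega>. coords k (?s \<omega>)) U"
      using inj_on_coords[of k] U(5) by (auto simp: inj_on_def)
  qed (rule U(1))
  then have "openin (top_of_set E) (E \<inter> coords k -` ((\<lambda>\<omega>. coords k (?s \<omega>)) ` U))"
    by (intro continuous_openin_preimage_gen continuous_on_coords)
  moreover have "E \<inter> coords k -` ((\<lambda>\<omega>. coords k (?s \<omega>)) ` U) = ?s ` U"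
    using inj_on_coords[of k] U(5) unfolding inj_on_def by blast
  ultimately have "openin (top_of_set E) (?s ` U)" by simp
  with U show thesis by (intro that[of U p]) auto
qed

lemma selection_not_crisis:
  assumes U: "open U" "continuous_on U p" "\<And>\<omega>. \<omega> \<in> U \<Longrightarrow> (p \<omega>, \<omega>) \<in> E" and "\<omega> \<in> U"
  shows "(p \<omega>, \<omega>) \<in> E - crisis_transitions n u"
proof -
  have "U \<subseteq> economies" using U(3) by (auto simp: equilibrium_manifold_def)
  then have "\<exists>V q. open V \<and> \<omega> \<in> V \<and> V \<subseteq> economies \<and> continuous_on V q \<and> q \<omega> = p \<omega> \<and> (\<forall>\<omega>\<in>V. (q \<omega>, \<omega>) \<in> E)"
    using assms by (intro exI[of _ U] exI[of _ p]) simp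
  with U(3)[OF \<open>\<omega> \<in> U\<close>] show ?thesis
    unfolding crisis_transitions_def Diff_iff mem_Collect_eq case_prod_conv by blast
qed

text \<open>\<open>W\<close> is the graph of the selection over a ball, and the same selection shows
  that no point of it is a crisis.\<close>

lemma not_crisis_locally_path_connected:
  assumes y: "y \<in> E - crisis_transitions n u"
  obtains W where "openin (top_of_set E) W" "y \<in> W" "\<And>e1 e2. e1 \<in> W \<Longrightarrow> e2 \<in> W \<Longrightarrow>
    path_component (E - crisis_transitions n u) e1 e2"
proof -
  obtain U p where U: "open U" "snd y \<in> U" "continuous_on U p" "p (snd y) = fst y"
    "\<And>\<omega>. \<omega> \<in> U \<Longrightarrow> (p \<omega>, \<omega>) \<in> E" "openin (top_of_set E) ((\<lambda>\<omega>. (p \<omega>, \<omega>)) ` U)"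
    using not_crisisD[OF y] by blast
  let ?s = "\<lambda>\<omega>. (p \<omega>, \<omega>)"
  obtain r where r: "r > 0" "ball (snd y) r \<subseteq> U" using U(1,2) open_contains_ball by blast
  have im: "?s ` ball (snd y) r \<subseteq> E - crisis_transitions n u"
    using r(2) selection_not_crisis[OF U(1,3,5)] by auto
  have pcon: "path_connected (?s ` ball (snd y) r)"
    by (intro path_connected_continuous_image continuous_intros convex_imp_path_connected convex_ball
        continuous_on_subset[OF U(3) r(2)])
  have pc: "path_component (E - crisis_transitions n u) e1 e2" if "e1 \<in> ?s ` ball (snd y) r" "e2 \<in> ?s ` ball (snd y) r" for e1 e2
    by (rule path_component_of_subset[OF im]) (use pcon that in \<open>auto simp: path_connected_component\<close>)
  have "openin (top_of_set (?s ` U)) (?s ` U \<inter> snd -` ball (snd y) r)"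
    by (intro continuous_openin_preimage_gen continuous_intros open_ball)
  moreover have "?s ` U \<inter> snd -` ball (snd y) r = ?s ` ball (snd y) r" using r(2) by auto
  ultimately have "openin (top_of_set (?s ` U)) (?s ` ball (snd y) r)" by simp
  then have "openin (top_of_set E) (?s ` ball (snd y) r)" by (rule openin_trans[OF _ U(6)])
  moreover have "y \<in> ?s ` ball (snd y) r" using r(1) U(4) by (intro image_eqI[of _ _ "snd y"]) (auto simp: prod_eq_iff)
  ultimately show thesis using pc that by blast
qed

text \<open>Near \<open>y\<close> the manifold coincides with the graph of the selection. This
  isolates the price \<open>fst y\<close> among the zeros of \<open>Z\<close> at the economy
  \<open>snd y\<close>, at points with singular Jacobian too.\<close>

lemma not_crisis_locally_injective:
  assumes y: "y \<in> E - crisis_transitions n u"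
  obtains N where "open N" "y \<in> N" "N \<subseteq> Dom" "inj_on snd (E \<inter> N)"
proof -
  obtain U p where U: "open U" "snd y \<in> U" "continuous_on U p" "p (snd y) = fst y"
    "\<And>\<omega>. \<omega> \<in> U \<Longrightarrow> (p \<omega>, \<omega>) \<in> E" "openin (top_of_set E) ((\<lambda>\<omega>. (p \<omega>, \<omega>)) ` U)"
    using not_crisisD[OF y] by blast
  obtain N where N: "open N" "(\<lambda>\<omega>. (p \<omega>, \<omega>)) ` U = E \<inter> N"
    using U(6) by (auto simp: openin_open)
  have "y \<in> E \<inter> N" unfolding N(2)[symmetric] using U(2,4) by (intro image_eqI[of _ _ "snd y"]) (simp_all add: prod_eq_iff)
  then have "y \<in> N \<inter> Dom" using E_subset_Dom by blast
  moreover have "inj_on snd (E \<inter> N)" unfolding N(2)[symmetric] by (auto simp: inj_on_def)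
  then have "inj_on snd (E \<inter> (N \<inter> Dom))" by (rule inj_on_subset) auto
  ultimately show thesis using that[of "N \<inter> Dom"] N(1) open_Dom by (simp add: open_Int)
qed

section \<open>Constancy of the index along paths\<close>

lemma Z_sphere_nonzero:
  assumes y: "y \<in> E" and b: "ball y e \<subseteq> Dom" "inj_on snd (E \<inter> ball y e)"
    and r: "0 < r" "r < e" and s: "norm s = 1"
  shows "(fst y + r *\<^sub>R s, snd y) \<in> Dom" "Z (fst y + r *\<^sub>R s, snd y) \<noteq> 0"
proof -
  let ?z = "(fst y + r *\<^sub>R s, snd y)"
  have "dist y ?z = r" using r s by (cases y) (simp add: dist_Pair_Pair dist_norm)
  then have z: "?z \<in> ball y e" using r by simp
  then show zD: "?z \<in> Dom" using b by blast
  show "Z ?z \<noteq> 0"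
  proof
    assume "Z ?z = 0"
    then have "?z \<in> E \<inter> ball y e" using z zD by (simp add: E_eq)
    moreover have "y \<in> E \<inter> ball y e" using y r by simp
    ultimately have "?z = y" using b(2) by (metis inj_onD snd_conv)
    then have "r *\<^sub>R s = 0" by (cases y) simp
    then show False using r s by auto
  qed
qed

text \<open>The sphere is first shrunk, without meeting a zero of \<open>Z\<close>, to a radius
  \<delta> at which the error of linearization is smaller than the linear part; then a segment leads
  to the linear part.\<close>

lemma homotopic_sphere_jacobian:
  assumes y: "y \<in> E" and b: "ball y e \<subseteq> Dom" "inj_on snd (E \<inter> ball y e)"
    and r: "0 < r" "r < e" and det: "det (price_jacobian y) \<noteq> 0"
  shows "homotopic_with_canon (\<lambda>x. True) (sphere 0 1) (- {0})
    (\<lambda>s. Z (fst y + r *\<^sub>R s, snd y)) (\<lambda>s. DZ y (s, 0))"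
proof -
  have yD: "y \<in> Dom" and Zy: "Z y = 0" using y by (auto simp: E_eq)
  let ?A = "\<lambda>s. DZ y (s, 0)"
  have linA: "linear ?A" using linear_DZ_price[OF yD] .
  have injA: "inj ?A" using price_jacobian_inj[OF yD det] linear_injective_0[OF linA] by blast
  obtain B where B: "B > 0" "\<And>x. B * norm x \<le> norm (?A x)"
    using linear_inj_bounded_below_pos[OF linA injA] by blast
  obtain d where d: "d > 0" "\<And>h. norm h < d \<Longrightarrow> norm (Z (y + h) - Z y - DZ y h) \<le> (B/2) * norm h"
    using Z_has_derivative[OF yD] B(1) unfolding has_derivative_at_alt
    by (metis add_diff_cancel_left' half_gt_zero)
  \<comment> \<open>At most \<open>r\<close>, so that the shrinking spheres stay in the isolating
    ball, and below \<open>d\<close>, so that the estimate of the error applies.\<close>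
  define \<delta> where "\<delta> = min r (d/2)"
  have \<delta>: "0 < \<delta>" "\<delta> \<le> r" "\<delta> < d" using r d by (auto simp: \<delta>_def)
  have err: "norm (Z (fst y + \<delta> *\<^sub>R s, snd y) - \<delta> *\<^sub>R ?A s) < \<delta> * norm (?A s)" if s: "norm s = 1" for s
  proof -
    have eq: "y + (\<delta> *\<^sub>R s, 0) = (fst y + \<delta> *\<^sub>R s, snd y)" by (cases y) simp
    have nrm: "norm (\<delta> *\<^sub>R s, 0 :: real^'l^'m) = \<delta>" using \<delta> s by (simp add: norm_Pair)
    have "norm (Z (fst y + \<delta> *\<^sub>R s, snd y) - DZ y (\<delta> *\<^sub>R s, 0)) \<le> (B/2) * \<delta>"
      using d(2)[of "(\<delta> *\<^sub>R s, 0)"] \<delta> Zy unfolding eq nrm by simp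
    moreover have "DZ y (\<delta> *\<^sub>R s, 0) = \<delta> *\<^sub>R ?A s" using linear_scale[OF linA] .
    moreover have "(B/2) * \<delta> < \<delta> * norm (?A s)"
      using B(2)[of s] s B(1) \<delta>(1) by simp
    ultimately show ?thesis by simp
  qed
  have cont: "continuous_on T (\<lambda>s. Z (f s))" if "continuous_on T f" "f ` T \<subseteq> Dom" for T :: "'z::topological_space set" and f
    using continuous_on_compose2[OF Ck_on_imp_continuous_on[OF Ck_Z] that] .
  have 1: "homotopic_with_canon (\<lambda>x. True) (sphere 0 1) (- {0})
    (\<lambda>s. Z (fst y + r *\<^sub>R s, snd y)) (\<lambda>s. Z (fst y + \<delta> *\<^sub>R s, snd y))"
  proof (rule homotopic_with_canonI)
    let ?r = "\<lambda>t. (1 - t) * r + t * \<delta>"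
    have r': "0 < ?r t" "?r t < e" if "t \<in> {0..1}" for t
    proof -
      have "?r t = r - t * (r - \<delta>)" by (simp add: algebra_simps)
      moreover have "0 \<le> t * (r - \<delta>)" "t * (r - \<delta>) \<le> r - \<delta>"
        using that \<delta> by (auto intro: mult_left_le_one_le)
      ultimately show "0 < ?r t" "?r t < e" using \<delta> r by auto
    qed
    note nz = Z_sphere_nonzero[OF y b r']
    show "continuous_on ({0..1} \<times> sphere 0 1) (\<lambda>x. Z (fst y + ?r (fst x) *\<^sub>R snd x, snd y))"
      by (rule cont) (auto intro!: continuous_intros nz(1))
    show "Z (fst y + ?r (fst (t, s)) *\<^sub>R snd (t, s), snd y) \<in> - {0}" if "t \<in> {0..1}" "s \<in> sphere 0 1" for t s
      using nz(2)[OF that(1) that(1), of s] that(2) by simp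
  qed auto
  have 2: "homotopic_with_canon (\<lambda>x. True) (sphere 0 1) (- {0}) (\<lambda>s. Z (fst y + \<delta> *\<^sub>R s, snd y)) ?A"
  proof (rule homotopic_with_linear)
    have \<delta>e: "\<delta> < e" using \<delta> r by simp
    show "continuous_on (sphere 0 1) (\<lambda>s. Z (fst y + \<delta> *\<^sub>R s, snd y))"
      by (rule cont) (auto intro!: continuous_intros Z_sphere_nonzero(1)[OF y b \<delta>(1) \<delta>e])
    show "continuous_on (sphere 0 1) ?A"
      using linA by (simp add: linear_continuous_on linear_conv_bounded_linear)
    fix s :: "real^'l" assume "s \<in> sphere 0 1"
    then have s: "norm s = 1" by simp
    have "B \<le> norm (?A s)" using B(2)[of s] s by simp
    then have As: "norm (?A s) > 0" using B(1) by linarith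
    \<comment> \<open>At a zero, (1-t) times the error balances ((1-t) \<delta> + t) times
      \<open>?A s\<close>. The bound on the error forces t = 0, and there the two sides cannot
      balance.\<close>
    have "(1 - t) *\<^sub>R Z (fst y + \<delta> *\<^sub>R s, snd y) + t *\<^sub>R ?A s \<noteq> 0" if t: "0 \<le> t" "t \<le> 1" for t
    proof
      let ?e = "Z (fst y + \<delta> *\<^sub>R s, snd y) - \<delta> *\<^sub>R ?A s"
      assume "(1 - t) *\<^sub>R Z (fst y + \<delta> *\<^sub>R s, snd y) + t *\<^sub>R ?A s = 0"
      then have "((1 - t) * \<delta> + t) *\<^sub>R ?A s = - (1 - t) *\<^sub>R ?e"
        by (simp add: algebra_simps)
      then have "norm (((1 - t) * \<delta> + t) *\<^sub>R ?A s) = norm (- (1 - t) *\<^sub>R ?e)" by (rule arg_cong)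
      moreover have "0 \<le> (1 - t) * \<delta>" using t \<delta> by simp
      ultimately have "((1 - t) * \<delta> + t) * norm (?A s) = (1 - t) * norm ?e" using t by simp
      moreover have "(1 - t) * norm ?e \<le> (1 - t) * (\<delta> * norm (?A s))"
        using err[OF s] t by (intro mult_left_mono) auto
      ultimately have "t * norm (?A s) \<le> 0" by (simp add: algebra_simps)
      then have "t = 0" using t As by (simp add: mult_le_0_iff)
      then have "\<delta> * norm (?A s) = norm ?e" using \<open>((1 - t) * \<delta> + t) * norm (?A s) = (1 - t) * norm ?e\<close> by simp
      then show False using err[OF s] by simp
    qed
    then show "closed_segment (Z (fst y + \<delta> *\<^sub>R s, snd y)) (?A s) \<subseteq> - {0}"
      by (auto simp: closed_segment_def)
  qed
  show ?thesis using homotopic_with_trans[OF 1 2] .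
qed

text \<open>Moving the centre of a sphere of fixed radius along the path is a homotopy as long as
  all these spheres avoid the zeros of \<open>Z\<close>. Jacobians are compared at the two end
  points only, since they may be singular in between.\<close>

lemma path_component_same_sign:
  assumes pc: "path_component (E - crisis_transitions n u) e1 e2"
    and det: "det (price_jacobian e1) \<noteq> 0" "det (price_jacobian e2) \<noteq> 0"
  shows "sgn (det (price_jacobian e1)) = sgn (det (price_jacobian e2))"
proof -
  obtain g where g: "path g" "path_image g \<subseteq> E - crisis_transitions n u" "g 0 = e1" "g 1 = e2"
    using pc unfolding path_component_def pathstart_def pathfinish_def by blast
  have gE: "g t \<in> E - crisis_transitions n u" if "t \<in> {0..1}" for t
    using g(2) that unfolding path_image_def by blast
  let ?\<N> = "{N. open N \<and> N \<subseteq> Dom \<and> inj_on snd (E \<inter> N)}"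
  have "path_image g \<subseteq> \<Union> ?\<N>"
  proof
    fix y assume "y \<in> path_image g"
    then have "y \<in> E - crisis_transitions n u" using g(2) by blast
    then obtain N where "open N" "y \<in> N" "N \<subseteq> Dom" "inj_on snd (E \<inter> N)"
      by (rule not_crisis_locally_injective)
    then show "y \<in> \<Union> ?\<N>" by blast
  qed
  \<comment> \<open>A Lebesgue number of the cover of the compact path: one radius of isolation
    valid at all its points.\<close>
  then obtain e where e: "e > 0" "\<And>y. y \<in> path_image g \<Longrightarrow> \<exists>N\<in>?\<N>. ball y e \<subseteq> N"
    using Heine_Borel_lemma[OF compact_path_image[OF g(1)], of ?\<N>] by blast
  have ball: "ball (g t) e \<subseteq> Dom" "inj_on snd (E \<inter> ball (g t) e)" if t: "t \<in> {0..1}" for t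
  proof -
    have "g t \<in> path_image g" using t unfolding path_image_def by blast
    then obtain N where N: "N \<subseteq> Dom" "inj_on snd (E \<inter> N)" "ball (g t) e \<subseteq> N" using e(2) by blast
    then show "ball (g t) e \<subseteq> Dom" "inj_on snd (E \<inter> ball (g t) e)" by (auto intro: inj_on_subset)
  qed
  define r where "r = e / 2"
  have r: "0 < r" "r < e" using e(1) by (auto simp: r_def)
  have gE': "g t \<in> E" if "t \<in> {0..1}" for t using gE[OF that] by blast
  note nz = Z_sphere_nonzero[OF gE' ball r]
  have cg: "continuous_on {0..1} g" using g(1) by (simp add: path_def)
  have mid: "homotopic_with_canon (\<lambda>x. True) (sphere 0 1) (- {0})
    (\<lambda>s. Z (fst e1 + r *\<^sub>R s, snd e1)) (\<lambda>s. Z (fst e2 + r *\<^sub>R s, snd e2))"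
  proof (rule homotopic_with_canonI)
    show "continuous_on ({0..1} \<times> sphere 0 1) (\<lambda>x. Z (fst (g (fst x)) + r *\<^sub>R snd x, snd (g (fst x))))"
    proof (rule continuous_on_compose2[OF Ck_on_imp_continuous_on[OF Ck_Z]])
      have "continuous_on ({0..1} \<times> sphere (0::real^'l) 1) (\<lambda>x. g (fst x))"
        by (rule continuous_on_compose2[OF cg]) (auto intro!: continuous_intros)
      then show "continuous_on ({0..1} \<times> sphere (0::real^'l) 1) (\<lambda>x. (fst (g (fst x)) + r *\<^sub>R snd x, snd (g (fst x))))"
        by (intro continuous_intros)
    qed (use nz(1) in auto)
    show "Z (fst (g (fst (t, s))) + r *\<^sub>R snd (t, s), snd (g (fst (t, s)))) \<in> - {0}"
      if "t \<in> {0..1}" "s \<in> sphere 0 1" for t s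
      using nz(2)[OF that(1) that(1) that(1), of s] that(2) by simp
  qed (auto simp: g)
  have e12: "e1 \<in> E" "e2 \<in> E" "ball e1 e \<subseteq> Dom" "inj_on snd (E \<inter> ball e1 e)" "ball e2 e \<subseteq> Dom" "inj_on snd (E \<inter> ball e2 e)"
    using gE'[of 0] gE'[of 1] ball[of 0] ball[of 1] g(3,4) by auto
  note h1 = homotopic_sphere_jacobian[OF e12(1,3,4) r det(1)]
  note h2 = homotopic_sphere_jacobian[OF e12(2,5,6) r det(2)]
  have "homotopic_with_canon (\<lambda>x. True) (sphere 0 1) (- {0}) (\<lambda>s. DZ e1 (s, 0)) (\<lambda>s. DZ e2 (s, 0))"
    using homotopic_with_trans[OF homotopic_with_trans[OF homotopic_with_symD[OF h1] mid] h2] .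
  then show ?thesis
    unfolding price_jacobian_def
    by (intro homotopic_linear_imp_det_same_sign linear_DZ_price E_subset_Dom e12 det[unfolded price_jacobian_def])
qed

section \<open>The second intrinsic derivative\<close>

lemma kernel_dim:
  assumes y: "y \<in> E"
  shows "dim (kernel_on (tangent_space E y) (frechet_derivative natural_projection (at y)))
    = dim {q. price_jacobian y *v q = 0}"
proof -
  have yD: "y \<in> Dom" using y by (rule E_subset_Dom)
  have lin: "linear (\<lambda>q::real^'l. (q, 0::real^'l^'m))" by (rule linearI) auto
  have "kernel_on (tangent_space E y) (frechet_derivative natural_projection (at y))
    = (\<lambda>q. (q, 0)) ` {q. price_jacobian y *v q = 0}"
    by (auto simp: kernel_on_def tangent_space_E[OF y] frechet_derivative_natural_projection price_jacobian_works[OF yD])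
  then show ?thesis using dim_image_eq[OF lin] by (simp add: inj_on_def)
qed

text \<open>For \<open>w = (q, 0)\<close> in the kernel, \<open>\<tau> (c t) w\<close> is tangent to
  E at \<open>c t\<close>. If \<kappa> is its velocity at 0, then \<open>DZ e \<kappa>\<close> is
  minus \<open>A'\<close> applied to \<open>q\<close>, and the economy component of \<kappa> equals
  \<open>l' w\<close>. If \<open>A'\<close> sends \<open>q\<close> into the image of
  \<open>price_jacobian e\<close>, a correction of the price component makes \<kappa> tangent to E,
  so \<open>l' w\<close> lies in the image of D\<pi>; then \<open>D w\<close> is the zero coset and
  \<open>w\<close> is 0.\<close>

lemma intrinsic_derivative_curve:
  assumes e: "e \<in> E" and v: "v \<in> tangent_space E e"
    and D: "has_intrinsic_second_derivative E economies natural_projection e v D"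
    and iso: "ker_coker_isomorphism (tangent_space E e) (tangent_space economies (natural_projection e))
      (frechet_derivative natural_projection (at e)) D"
  obtains c A' where "c 0 = e" "isCont c (0::real)" "eventually (\<lambda>t. c t \<in> E) (nhds 0)"
    "\<And>q. ((\<lambda>t. price_jacobian (c t) *v q) has_vector_derivative A' *v q) (at 0)"
    "\<And>q r. price_jacobian e *v q = 0 \<Longrightarrow> A' *v q = price_jacobian e *v r \<Longrightarrow> q = 0"
proof -
  have eD: "e \<in> Dom" using e by (rule E_subset_Dom)
  let ?T = "tangent_space E e"
  have T: "?T = {v. DZ e v = 0}" using tangent_space_E[OF e] .
  have subT: "subspace ?T" unfolding T subspace_def
    by (simp add: linear_0 linear_add linear_scale linear_DZ[OF eD])
  have eco: "tangent_space economies (natural_projection y) = (UNIV :: (real^'l^'m) set)" if "y \<in> E" for y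
    using tangent_space_economies[OF E_subset_Dom[OF that]] by (simp add: natural_projection_def)
  obtain U \<tau> \<tau>' ex l' where
    tr: "local_trivialization E (tangent_space E) e U \<tau>"
    and tr': "local_trivialization E (\<lambda>y. tangent_space economies (natural_projection y)) e U \<tau>'"
    and ex: "exponential_map_at E e ex"
    and l': "\<And>w. w \<in> ?T \<Longrightarrow> ((\<lambda>t. inv_into UNIV (\<tau>' (ex (t *\<^sub>R v))) (snd (\<tau> (ex (t *\<^sub>R v)) w)))
        has_vector_derivative l' w) (at 0)"
    and Dl': "\<And>w. w \<in> kernel_on ?T snd \<Longrightarrow> D w = coker_proj ?T snd (l' w)"
    using D unfolding has_intrinsic_second_derivative_def has_intrinsic_derivative_def Let_def
      frechet_derivative_natural_projection eco[OF e] by blast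
  have openU: "open U" "e \<in> U" using tr by (auto simp: local_trivialization_def)
  obtain V where V: "open V" "0 \<in> V" "ex ` (?T \<inter> V) \<subseteq> E" "ex 0 = e"
      "\<And>w. w \<in> ?T \<Longrightarrow> ((\<lambda>t::real. ex (t *\<^sub>R w)) has_vector_derivative w) (at 0)"
    using ex unfolding exponential_map_at_def by blast
  define c where "c t = ex (t *\<^sub>R v)" for t
  have c0: "c 0 = e" by (simp add: c_def V(4))
  have dc: "(c has_vector_derivative v) (at 0)" unfolding c_def by (rule V(5)[OF v])
  have cc: "isCont c 0" using has_vector_derivative_continuous[OF dc] .
  have lim: "(c \<longlongrightarrow> e) (nhds 0)"
    using cc c0 by (metis continuous_at tendsto_at_iff_tendsto_nhds)
  have "eventually (\<lambda>t. t *\<^sub>R v \<in> V) (nhds (0::real))"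
  proof -
    have "open ((\<lambda>t::real. t *\<^sub>R v) -` V)" by (intro open_vimage V(1) continuous_intros)
    from eventually_nhds_in_open[OF this, of 0] show ?thesis using V(2) by simp
  qed
  then have cE: "eventually (\<lambda>t. c t \<in> E) (nhds 0)"
    by (rule eventually_mono) (use V(3) subspace_scale[OF subT v] in \<open>auto simp: c_def\<close>)
  have cU: "eventually (\<lambda>t. c t \<in> U) (nhds 0)"
    using topological_tendstoD[OF lim openU] .
  define S where "S b = frechet_derivative (\<lambda>y. DZ y b) (at e) v" for b
  have S: "((\<lambda>t. DZ (c t) b) has_vector_derivative S b) (at 0)" for b
  proof -
    have "Ck_on (Suc 0) Dom (\<lambda>y. DZ y b)" using Ck_Z[of "Suc (Suc 0)"] unfolding Ck_on.simps(2)[of "Suc 0"] by blast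
    from Ck_on_has_derivative[OF this eD]
    have d: "((\<lambda>y. DZ y b) has_derivative frechet_derivative (\<lambda>y. DZ y b) (at e)) (at (c 0))"
      by (simp add: c0)
    have "((\<lambda>t. DZ (c t) b) has_derivative (\<lambda>t. frechet_derivative (\<lambda>y. DZ y b) (at e) (t *\<^sub>R v))) (at 0)"
      using has_derivative_compose[OF dc[unfolded has_vector_derivative_def] d] .
    then show ?thesis unfolding has_vector_derivative_def S_def
      by (simp add: linear_scale[OF has_derivative_linear[OF d]])
  qed
  define A' where "A' = matrix (\<lambda>q. S (q, 0))"
  have matrix_sum: "matrix f *v q = (\<Sum>j\<in>UNIV. q $ j *\<^sub>R f (axis j 1))" for f :: "real^'l \<Rightarrow> real^'l" and q
    by (simp add: matrix_def matrix_vector_mult_def vec_eq_iff mult.commute)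
  have A': "((\<lambda>t. price_jacobian (c t) *v q) has_vector_derivative A' *v q) (at 0)" for q
    unfolding price_jacobian_def A'_def matrix_sum
    by (intro has_vector_derivative_sum bounded_linear.has_vector_derivative[OF bounded_linear_scaleR_right S])
  have "q = 0" if q: "price_jacobian e *v q = 0" and qr: "A' *v q = price_jacobian e *v r" for q r
  proof -
    define w :: "(real^'l) \<times> (real^'l^'m)" where "w = (q, 0)"
    have snd_w: "snd w = 0" by (simp add: w_def)
    have DZw: "DZ e w = 0" using q price_jacobian_works[OF eD] by (simp add: w_def)
    then have wT: "w \<in> ?T" by (simp add: T)
    have \<tau>0: "\<tau> e w = w" using tr wT by (auto simp: local_trivialization_def)
    have \<tau>T: "eventually (\<lambda>t. DZ (c t) (\<tau> (c t) w) = 0) (nhds 0)"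
      using cE cU
    proof eventually_elim
      case (elim t)
      then have "bij_betw (\<tau> (c t)) ?T (tangent_space E (c t))" using tr by (auto simp: local_trivialization_def)
      then have "\<tau> (c t) w \<in> tangent_space E (c t)" using wT by (rule bij_betw_apply)
      then show ?case using tangent_space_E[OF elim(1)] by simp
    qed
    \<comment> \<open>Smoothness of a trivialization means local extensions to open sets of the
      ambient space; the curve is inserted into such an extension \<open>g\<close>.\<close>
    obtain \<kappa> where \<kappa>: "((\<lambda>t. \<tau> (c t) w) has_vector_derivative \<kappa>) (at 0)"
    proof -
      have "smooth_map_on ((E \<inter> U) \<times> ?T) (\<lambda>(y, w). \<tau> y w)" using tr by (simp add: local_trivialization_def)
      then have "\<exists>N g. open N \<and> (e, w) \<in> N \<and> smooth_on N g \<and> (\<forall>z\<in>((E \<inter> U) \<times> ?T) \<inter> N. g z = (\<lambda>(y, w). \<tau> y w) z)"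
        unfolding smooth_map_on_def by (rule bspec) (use e openU wT in simp)
      then obtain N g where g: "open N" "(e, w) \<in> N" "smooth_on N g"
          "\<And>z. z \<in> ((E \<inter> U) \<times> ?T) \<inter> N \<Longrightarrow> g z = (\<lambda>(y, w). \<tau> y w) z"
        by auto
      have "Ck_on (Suc 0) N g" using g(3) by (simp only: smooth_on_def)
      from Ck_on_has_derivative[OF this g(2)]
      have dg: "(g has_derivative frechet_derivative g (at (e, w))) (at (c 0, w))" by (simp add: c0)
      have "((\<lambda>t. (c t, w)) has_derivative (\<lambda>t. (t *\<^sub>R v, 0))) (at 0)"
        using has_derivative_Pair[OF dc[unfolded has_vector_derivative_def] has_derivative_const] .
      from has_derivative_compose[OF this dg]
      have d: "((\<lambda>t. g (c t, w)) has_derivative (\<lambda>t. frechet_derivative g (at (e, w)) (t *\<^sub>R v, 0))) (at 0)" .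
      have "((\<lambda>t. (c t, w)) \<longlongrightarrow> (e, w)) (nhds 0)" using lim by (intro tendsto_intros)
      then have "eventually (\<lambda>t. (c t, w) \<in> N) (nhds 0)" using topological_tendstoD g(1,2) by blast
      with cE cU have ev: "eventually (\<lambda>t. g (c t, w) = \<tau> (c t) w) (nhds 0)"
      proof eventually_elim
        case (elim t)
        then show ?case using g(4)[of "(c t, w)"] wT by simp
      qed
      have "((\<lambda>t. \<tau> (c t) w) has_derivative (\<lambda>t. frechet_derivative g (at (e, w)) (t *\<^sub>R v, 0))) (at 0)"
        by (rule has_derivative_transform_eventually[OF d])
          (use ev in \<open>auto simp: eventually_at_filter dest: eventually_nhds_x_imp_x elim: eventually_mono\<close>)
      moreover have "frechet_derivative g (at (e, w)) (t *\<^sub>R v, 0) = t *\<^sub>R frechet_derivative g (at (e, w)) (v, 0)" for t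
        using linear_scale[OF has_derivative_linear[OF dg], of t "(v, 0)"] by simp
      ultimately show thesis using that unfolding has_vector_derivative_def by simp
    qed
    \<comment> \<open>Both the linear map \<open>DZ (c t)\<close> and its argument vary with t, so
      the product rule is applied to each term of the expansion over \<open>Basis\<close>.\<close>
    have expand: "DZ y z = (\<Sum>b\<in>Basis. (z \<bullet> b) *\<^sub>R DZ y b)" if "y \<in> Dom" for y z
      by (subst (1) euclidean_representation[of z, symmetric])
        (simp only: linear_sum[OF linear_DZ[OF that]] linear_scale[OF linear_DZ[OF that]])
    text \<open>Differentiating \<open>DZ (c t) (\<tau> (c t) w) = 0\<close> at \<open>t = 0\<close>.\<close>
    have key: "DZ e \<kappa> + A' *v q = 0"
    proof -
      have "((\<lambda>t. \<Sum>b\<in>Basis. (\<tau> (c t) w \<bullet> b) *\<^sub>R DZ (c t) b) has_vector_derivative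
          (\<Sum>b\<in>Basis. (\<tau> (c 0) w \<bullet> b) *\<^sub>R S b + (\<kappa> \<bullet> b) *\<^sub>R DZ (c 0) b)) (at 0)"
      proof (intro has_vector_derivative_sum)
        fix b :: "(real^'l) \<times> (real^'l^'m)"
        have "((\<lambda>t. \<tau> (c t) w \<bullet> b) has_real_derivative \<kappa> \<bullet> b) (at 0)"
          using bounded_linear.has_vector_derivative[OF bounded_linear_inner_left \<kappa>]
          by (simp add: has_real_derivative_iff_has_vector_derivative)
        from has_vector_derivative_scaleR[OF this S]
        show "((\<lambda>t. (\<tau> (c t) w \<bullet> b) *\<^sub>R DZ (c t) b) has_vector_derivative
          (\<tau> (c 0) w \<bullet> b) *\<^sub>R S b + (\<kappa> \<bullet> b) *\<^sub>R DZ (c 0) b) (at 0)" .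
      qed
      moreover have "eventually (\<lambda>t. (\<Sum>b\<in>Basis. (\<tau> (c t) w \<bullet> b) *\<^sub>R DZ (c t) b) = 0) (nhds 0)"
        using \<tau>T cE by eventually_elim (simp add: expand[symmetric] E_subset_Dom)
      ultimately have "((\<lambda>t. 0) has_vector_derivative
          (\<Sum>b\<in>Basis. (\<tau> (c 0) w \<bullet> b) *\<^sub>R S b + (\<kappa> \<bullet> b) *\<^sub>R DZ (c 0) b)) (at (0::real))"
        unfolding has_vector_derivative_def
        by (elim has_derivative_transform_eventually)
          (auto simp: eventually_at_filter dest: eventually_nhds_x_imp_x elim: eventually_mono)
      then have "(\<Sum>b\<in>Basis. (\<tau> (c 0) w \<bullet> b) *\<^sub>R S b + (\<kappa> \<bullet> b) *\<^sub>R DZ (c 0) b) = 0"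
        using has_vector_derivative_const vector_derivative_unique_at by blast
      then have 1: "(\<Sum>b\<in>Basis. (w \<bullet> b) *\<^sub>R S b) + DZ e \<kappa> = 0"
        by (simp add: sum.distrib expand[OF eD, of \<kappa>] c0 \<tau>0)
      \<comment> \<open>With the argument frozen at \<open>w\<close>, the sum is
        \<open>price_jacobian (c t)\<close> applied to \<open>q\<close>; uniqueness of derivatives
        identifies the first term of \<open>1\<close>.\<close>
      have "((\<lambda>t. \<Sum>b\<in>Basis. (w \<bullet> b) *\<^sub>R DZ (c t) b) has_vector_derivative (\<Sum>b\<in>Basis. (w \<bullet> b) *\<^sub>R S b)) (at 0)"
        by (intro has_vector_derivative_sum bounded_linear.has_vector_derivative[OF bounded_linear_scaleR_right S])
      moreover have "eventually (\<lambda>t. (\<Sum>b\<in>Basis. (w \<bullet> b) *\<^sub>R DZ (c t) b) = price_jacobian (c t) *v q) (nhds 0)"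
        using cE by eventually_elim (simp add: expand[symmetric] E_subset_Dom price_jacobian_works w_def)
      ultimately have "((\<lambda>t. price_jacobian (c t) *v q) has_vector_derivative (\<Sum>b\<in>Basis. (w \<bullet> b) *\<^sub>R S b)) (at 0)"
        unfolding has_vector_derivative_def
        by (elim has_derivative_transform_eventually)
          (auto simp: eventually_at_filter dest: eventually_nhds_x_imp_x elim: eventually_mono)
      then have "(\<Sum>b\<in>Basis. (w \<bullet> b) *\<^sub>R S b) = A' *v q"
        using A' vector_derivative_unique_at by blast
      with 1 show ?thesis by (simp add: add.commute)
    qed
    define L where "L t = inv_into UNIV (\<tau>' (c t)) (snd (\<tau> (c t) w))" for t
    have dL: "(L has_vector_derivative l' w) (at 0)" using l'[OF wT] unfolding L_def c_def .
    have bij': "linear (\<tau>' y) \<and> bij (\<tau>' y)" if "y \<in> E \<inter> U" for y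
      using tr' that eco e by (auto simp: local_trivialization_def)
    have \<tau>'0: "\<tau>' e x = x" for x using tr' eco e by (auto simp: local_trivialization_def)
    have L: "\<tau>' (c t) (L t) = snd (\<tau> (c t) w)" if "c t \<in> E \<inter> U" for t
      unfolding L_def using bij'[OF that] bij_is_surj surj_f_inv_f by metis
    have L0: "L 0 = 0"
      using L[of 0] \<tau>'0 \<tau>0 e openU by (simp add: c0 w_def)
    have limL: "((\<lambda>t. L t /\<^sub>R t) \<longlongrightarrow> l' w) (at 0)"
      using has_vector_derivative_quotient_tendsto[OF dL] L0 by simp
    have lim\<kappa>: "((\<lambda>t. snd (\<tau> (c t) w) /\<^sub>R t) \<longlongrightarrow> snd \<kappa>) (at 0)"
      using tendsto_snd[OF has_vector_derivative_quotient_tendsto[OF \<kappa>]] snd_w by (simp add: c0 \<tau>0)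
    \<comment> \<open>Since \<open>L\<close> vanishes at 0, the variation of \<open>\<tau>'\<close>
      contributes nothing: \<open>\<tau>' (c t)\<close> maps \<open>L t / t\<close> to
      \<open>snd (\<tau> (c t) w) / t\<close>, and continuity at \<open>(e, l' w)\<close>, where
      \<open>\<tau>' e\<close> is the identity, equates the limits.\<close>
    have "snd \<kappa> = l' w"
    proof -
      have "smooth_map_on ((E \<inter> U) \<times> UNIV) (\<lambda>(y, w). \<tau>' y w)"
        using tr' eco e by (simp add: local_trivialization_def)
      then have "\<exists>N g. open N \<and> (e, l' w) \<in> N \<and> smooth_on N g \<and> (\<forall>z\<in>((E \<inter> U) \<times> UNIV) \<inter> N. g z = (\<lambda>(y, w). \<tau>' y w) z)"
        unfolding smooth_map_on_def by (rule bspec) (use e openU in simp)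
      then obtain N g where g: "open N" "(e, l' w) \<in> N" "smooth_on N g"
          "\<And>z. z \<in> ((E \<inter> U) \<times> UNIV) \<inter> N \<Longrightarrow> g z = (\<lambda>(y, w). \<tau>' y w) z"
        by auto
      have "continuous_on N g" using g(3) Ck_on.simps(1) unfolding smooth_on_def by blast
      then have cg: "isCont g (e, l' w)" using g(1,2) continuous_on_eq_continuous_at by blast
      have lim2: "((\<lambda>t. (c t, L t /\<^sub>R t)) \<longlongrightarrow> (e, l' w)) (at 0)"
        using cc c0 limL by (intro tendsto_Pair) (auto simp: isCont_def)
      have gl: "((\<lambda>t. g (c t, L t /\<^sub>R t)) \<longlongrightarrow> g (e, l' w)) (at 0)"
        by (rule isCont_tendsto_compose[OF cg lim2])
      have geq: "g (e, l' w) = l' w" using g(4)[of "(e, l' w)"] g(2) e openU \<tau>'0 by simp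
      have ev: "eventually (\<lambda>t. g (c t, L t /\<^sub>R t) = snd (\<tau> (c t) w) /\<^sub>R t) (at 0)"
      proof -
        have "eventually (\<lambda>t. (c t, L t /\<^sub>R t) \<in> N) (at 0)" using topological_tendstoD[OF lim2 g(1,2)] .
        moreover have "eventually (\<lambda>t. c t \<in> E) (at 0)" "eventually (\<lambda>t. c t \<in> U) (at 0)"
          using cE cU by (auto simp: eventually_at_filter elim: eventually_mono)
        ultimately show ?thesis
        proof eventually_elim
          case (elim t)
          then have "g (c t, L t /\<^sub>R t) = \<tau>' (c t) (L t /\<^sub>R t)" using g(4)[of "(c t, L t /\<^sub>R t)"] by simp
          also have "\<dots> = \<tau>' (c t) (L t) /\<^sub>R t" using bij'[of "c t"] elim by (simp add: linear_scale)
          finally show ?case using L elim by simp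
        qed
      qed
      from Lim_transform_eventually[OF gl ev] geq
      have "((\<lambda>t. snd (\<tau> (c t) w) /\<^sub>R t) \<longlongrightarrow> l' w) (at 0)" by simp
      then show ?thesis using tendsto_unique[OF _ lim\<kappa>] by simp
    qed
    then have "DZ e (fst \<kappa> + r, l' w) = 0"
      using key qr price_jacobian_works[OF eD] linear_add[OF linear_DZ[OF eD], of \<kappa> "(r, 0)"]
      by (cases \<kappa>) simp
    then have "l' w \<in> snd ` ?T" unfolding T by force
    have kerw: "w \<in> kernel_on ?T snd" "0 \<in> kernel_on ?T snd"
      using wT subspace_0[OF subT] by (auto simp: kernel_on_def w_def)
    \<comment> \<open>A vector of the image represents the zero coset. Thus \<open>D w\<close> and
      \<open>D 0\<close> coincide, and injectivity of \<open>D\<close> applies.\<close>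
    have coset: "coker_proj ?T snd x = snd ` ?T" if "x \<in> snd ` ?T" for x
    proof -
      have sub: "subspace (snd ` ?T)" using linear_subspace_image[OF linear_snd subT] .
      show ?thesis unfolding coker_proj_def
      proof (intro subset_antisym subsetI)
        fix z assume "z \<in> (+) x ` snd ` ?T"
        then show "z \<in> snd ` ?T" using subspace_add[OF sub that] by blast
      next
        fix z assume "z \<in> snd ` ?T"
        then have "z - x \<in> snd ` ?T" using subspace_diff[OF sub _ that] by blast
        then show "z \<in> (+) x ` snd ` ?T" by (intro image_eqI[of _ _ "z - x"]) auto
      qed
    qed
    obtain A where A: "linear A" "\<forall>w\<in>kernel_on ?T snd. D w = coker_proj ?T snd (A w)"
      and bij: "bij_betw D (kernel_on ?T snd) (cokernel_on ?T (tangent_space economies (natural_projection e)) snd)"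
      using iso unfolding ker_coker_isomorphism_def frechet_derivative_natural_projection by blast
    have "D w = snd ` ?T" using Dl'[OF kerw(1)] coset[OF \<open>l' w \<in> snd ` ?T\<close>] by simp
    moreover have "D 0 = snd ` ?T"
    proof -
      have "0 \<in> snd ` ?T" using subspace_0[OF subT] by force
      then show ?thesis using A kerw(2) coset linear_0[OF A(1)] by simp
    qed
    ultimately have "w = 0" using bij kerw by (auto simp: bij_betw_def inj_on_def)
    then show "q = 0" by (simp add: w_def zero_prod_def)
  qed
  then show thesis using that[of c A'] c0 cc cE A' by blast
qed

text \<open>The two equilibria lie on the curve just found, at parameters t and -t so small that
  both points belong to \<open>W\<close>.\<close>

lemma regular_equilibria_of_opposite_sign:
  assumes e: "e \<in> E"
    and odd: "odd (dim (kernel_on (tangent_space E e) (frechet_derivative natural_projection (at e))))"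
    and D: "v \<in> tangent_space E e" "has_intrinsic_second_derivative E economies natural_projection e v D"
      "ker_coker_isomorphism (tangent_space E e) (tangent_space economies (natural_projection e))
        (frechet_derivative natural_projection (at e)) D"
    and W: "openin (top_of_set E) W" "e \<in> W"
  obtains e1 e2 where "e1 \<in> W" "e2 \<in> W" "det (price_jacobian e1) * det (price_jacobian e2) < 0"
proof -
  obtain c A' where c: "c 0 = e" "isCont c (0::real)" "eventually (\<lambda>t. c t \<in> E) (nhds 0)"
    "\<And>q. ((\<lambda>t. price_jacobian (c t) *v q) has_vector_derivative A' *v q) (at 0)"
    "\<And>q r. price_jacobian e *v q = 0 \<Longrightarrow> A' *v q = price_jacobian e *v r \<Longrightarrow> q = 0"
    using intrinsic_derivative_curve[OF e D] by blast
  have sign: "eventually (\<lambda>t. det (price_jacobian (c t)) * det (price_jacobian (c (- t))) < 0) (at_right 0)"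
    by (rule det_sign_change[of "\<lambda>t. price_jacobian (c t)" A']) (use c odd kernel_dim[OF e] in auto)
  obtain O' where O': "open O'" "W = E \<inter> O'" using W(1) by (auto simp: openin_open)
  have "(c \<longlongrightarrow> e) (nhds 0)" using c(1,2) by (metis continuous_at tendsto_at_iff_tendsto_nhds)
  then have "eventually (\<lambda>t. c t \<in> O') (nhds 0)" using topological_tendstoD O' W(2) by blast
  with c(3) have "eventually (\<lambda>t. c t \<in> W) (nhds 0)" by eventually_elim (simp add: O'(2))
  then obtain d where d: "d > 0" "\<And>t. \<bar>t\<bar> < d \<Longrightarrow> c t \<in> W"
    unfolding eventually_nhds_metric by (auto simp: dist_norm)
  obtain b where b: "b > 0" "\<And>t. 0 < t \<Longrightarrow> t < b \<Longrightarrow> det (price_jacobian (c t)) * det (price_jacobian (c (- t))) < 0"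
    using sign unfolding eventually_at_right_field by blast
  define t where "t = min b d / 2"
  have t: "0 < t" "t < b" "t < d" using b(1) d(1) by (auto simp: t_def min_def)
  show thesis using that[of "c t" "c (- t)"] d(2)[of t] d(2)[of "- t"] b(2)[OF t(1,2)] t by simp
qed

lemma unavoidable_crisis:
  assumes e: "e \<in> E"
    and odd: "odd (dim (kernel_on (tangent_space E e) (frechet_derivative natural_projection (at e))))"
    and D: "v \<in> tangent_space E e" "has_intrinsic_second_derivative E economies natural_projection e v D"
      "ker_coker_isomorphism (tangent_space E e) (tangent_space economies (natural_projection e))
        (frechet_derivative natural_projection (at e)) D"
  shows "e \<in> crisis_transitions n u \<and>
    (\<forall>W. openin (top_of_set E) W \<and> e \<in> W \<longrightarrow>
       (\<exists>e1\<in>W. \<exists>e2\<in>W. regular_equilibrium n u e1 \<and> regular_equilibrium n u e2 \<and>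
          e1 \<in> E - crisis_transitions n u \<and> e2 \<in> E - crisis_transitions n u \<and>
          \<not> path_component (E - crisis_transitions n u) e1 e2))"
proof -
  have pair: "\<exists>e1\<in>W. \<exists>e2\<in>W. regular_equilibrium n u e1 \<and> regular_equilibrium n u e2 \<and>
          e1 \<in> E - crisis_transitions n u \<and> e2 \<in> E - crisis_transitions n u \<and>
          \<not> path_component (E - crisis_transitions n u) e1 e2"
    if W: "openin (top_of_set E) W" "e \<in> W" for W
  proof -
    obtain e1 e2 where e12: "e1 \<in> W" "e2 \<in> W" and neg: "det (price_jacobian e1) * det (price_jacobian e2) < 0"
      using regular_equilibria_of_opposite_sign[OF e odd D W] by blast
    have E12: "e1 \<in> E" "e2 \<in> E" using openin_imp_subset[OF W(1)] e12 by auto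
    have nz: "det (price_jacobian e1) \<noteq> 0" "det (price_jacobian e2) \<noteq> 0" using neg by auto
    have "sgn (det (price_jacobian e1)) \<noteq> sgn (det (price_jacobian e2))"
      using neg by (auto simp: mult_less_0_iff)
    then have "\<not> path_component (E - crisis_transitions n u) e1 e2"
      using path_component_same_sign[OF _ nz] by blast
    then show ?thesis
      using e12 E12 nz regular_equilibriumI not_crisis_if_regular by blast
  qed
  have "e \<in> crisis_transitions n u"
  proof (rule ccontr)
    assume "e \<notin> crisis_transitions n u"
    then obtain W where W: "openin (top_of_set E) W" "e \<in> W"
      and pc: "\<And>e1 e2. e1 \<in> W \<Longrightarrow> e2 \<in> W \<Longrightarrow> path_component (E - crisis_transitions n u) e1 e2"
      using not_crisis_locally_path_connected[of e] e by blast
    then show False using pair[OF W] by blast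
  qed
  with pair show ?thesis by blast
qed

end

theorem theorem1p4:
  fixes u :: "'m::finite \<Rightarrow> real^'l::finite \<Rightarrow> real"
    and n :: 'l
    and e :: "(real^'l) \<times> (real^'l^'m)"
  assumes "\<And>i. smooth_utility (u i)"
    and "e \<in> equilibrium_manifold n u"
    and "odd (dim (kernel_on (tangent_space (equilibrium_manifold n u) e)
                    (frechet_derivative natural_projection (at e))))"
    and "\<exists>v\<in>tangent_space (equilibrium_manifold n u) e. \<exists>D.
           has_intrinsic_second_derivative (equilibrium_manifold n u) economies
             natural_projection e v D \<and>
           ker_coker_isomorphism (tangent_space (equilibrium_manifold n u) e)
             (tangent_space economies (natural_projection e))
             (frechet_derivative natural_projection (at e)) D"
  shows "e \<in> crisis_transitions n u \<and>
    (\<forall>W. openin (top_of_set (equilibrium_manifold n u)) W \<and> e \<in> W \<longrightarrow>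
       (\<exists>e1\<in>W. \<exists>e2\<in>W. regular_equilibrium n u e1 \<and> regular_equilibrium n u e2 \<and>
          e1 \<in> equilibrium_manifold n u - crisis_transitions n u \<and>
          e2 \<in> equilibrium_manifold n u - crisis_transitions n u \<and>
          \<not> path_component (equilibrium_manifold n u - crisis_transitions n u) e1 e2))"
proof -
  have "\<exists>G. (\<forall>k. Ck_on k orthant G) \<and> (\<forall>p r. p \<in> prices n \<longrightarrow> 0 < r \<longrightarrow> p \<bullet> G (price_income n p r) = r)
      \<and> (\<forall>p w. p \<in> prices n \<longrightarrow> w \<in> orthant \<longrightarrow> demand (u i) p w = G (price_income n p (p \<bullet> w)))" for i
  proof -
    interpret smooth_consumer "u i" by unfold_locales (rule assms(1))
    obtain G where "smooth_on orthant G"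
      "\<And>p r. p \<in> prices n \<Longrightarrow> 0 < r \<Longrightarrow> p \<bullet> G (price_income n p r) = r"
      "\<And>p w. p \<in> prices n \<Longrightarrow> w \<in> orthant \<Longrightarrow> demand (u i) p w = G (price_income n p (p \<bullet> w))"
      using smooth_demand[of n] by metis
    then show ?thesis unfolding smooth_on_def by blast
  qed
  then obtain G where G: "\<And>i. (\<forall>k. Ck_on k orthant (G i)) \<and> (\<forall>p r. p \<in> prices n \<longrightarrow> 0 < r \<longrightarrow> p \<bullet> G i (price_income n p r) = r)
      \<and> (\<forall>p w. p \<in> prices n \<longrightarrow> w \<in> orthant \<longrightarrow> demand (u i) p w = G i (price_income n p (p \<bullet> w)))"
    by metis
  interpret smooth_economy u n G
    by unfold_locales (use G in blast)+
  obtain v D where "v \<in> tangent_space (equilibrium_manifold n u) e"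
    "has_intrinsic_second_derivative (equilibrium_manifold n u) economies natural_projection e v D"
    "ker_coker_isomorphism (tangent_space (equilibrium_manifold n u) e)
             (tangent_space economies (natural_projection e))
             (frechet_derivative natural_projection (at e)) D"
    using assms(4) by blast
  then show ?thesis by (rule unavoidable_crisis[OF assms(2,3)])
qed

end
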